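(* Let $m,n\ge2$ be integers with $mn\ge 6$. Let $w\in L_{m,n}^{\mathbb Z}$ be the cutting sequence of a bi-infinite linear trajectory on the Bouw–Möller surface $S_{m,n}$ (oriented so that its direction lies in $[0,\pi]$). Then $w$ is infinitely derivable.
   Context: **Surface.** For $a,b\ge 0$ let $P_n(a,b)$ be the equiangular polygon whose edges, indexed by $i\in\mathbb Z/2n$ and traversed counterclockwise, have edge vectors $a(\cos\frac{i\pi}{n},\sin\frac{i\pi}{n})$ for $i$ even and $b(\cos\frac{i\pi}{n},\sin\frac{i\pi}{n})$ for $i$ odd (edges of length $0$ are omitted; for $n=2$ this may degenerate to a two-sided segment). For $0\le k\le m-1$ put $P(k)=P_n(\sin\frac{k\pi}{m},\sin\frac{(k+1)\pi}{m})$ if $n$ is odd or $k$ is even, and $P(k)=P_n(\sin\frac{(k+1)\pi}{m},\sin\frac{k\pi}{m})$ if $n$ is even and $k$ is odd. The right edges of $P(k)$ are those of odd index in the first case and those of even index in the second case. The Bouw–Möller surface $S_{m,n}$ is obtained from $P(0),\dots,P(m-1)$ by gluing, for $0\le k\le m-2$, each right edge of $P(k)$, of index $e$, by translation to the edge of $P(k+1)$ of index $e+n$ mod $2n$. The glued edges are labeled by $L_{m,n}=\{1,\dots,n(m-1)\}$: for $1\le r\le m-1$, $1\le s\le n$, the label $(r-1)n+s$ is given to the right edge of $P(r-1)$ of index $e(s)$ mod $2n$, where, if right edges of $P(r-1)$ have odd index, $e(s)=s$ for $s$ odd and $e(s)=1-s$ for $s$ even; if they have even index, $e(s)=s$ for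 $s$ even and $e(s)=1-s$ for $s$ odd. A bi-infinite linear trajectory is a straight line with constant direction on the surface, defined for all times and never hitting a vertex; its cutting sequence is the bi-infinite sequence of labels of edges crossed (origin arbitrary). $S_{n,m}$ and $L_{n,m}$, and all objects below with indices $n,m$, are defined by exchanging the roles of $m$ and $n$. **Transition diagrams.** $\Sigma_i^{m,n}=[i\pi/n,(i+1)\pi/n]$. $T_i^{m,n}$ is the directed graph on $L_{m,n}$ with an arrow $p\to q$ iff some trajectory on $S_{m,n}$ with direction in $\Sigma_i^{m,n}$ crosses edge $p$ and then, next, edge $q$. A word is admissible in $T_i^{m,n}$ if it is a path in it, and admissible if this holds for some $0\le i\le n-1$. **Derivation.** Explicitly, $T_0^{m,n}$ has vertices at positions $(r,c)$, $1\le r\le m-1$, $1\le c\le n$, the vertex at $(r,c)$ being the label $(r-1)n+c$ if $r$ is odd and $rn+1-c$ if $r$ is even; it has arrows in both directions between $(r,c)$ and $(r,c+1)$, and vertical arrows $(r,c)\to(r+1,c)$ for $c$ odd, $(r+1,c)\to(r,c)$ for $c$ even. The derivation diagram $D_0^{m,n}$ is $T_0^{m,n}$ with horizontal arrows labeled by elements of $L_{n,m}$ as follows (vertical arrows have no label): for $c$ odd, the arrow $(r,c+1)\to(r,c)$ has label $(c-1)m+r$ and the arrow $(r,c)\to(r,c+1)$ has label $(c-1)m+r+1$; for $c$ even, the arrow $(r,c)\to(r,c+1)$ has label $cm-r+1$ and the arrow $(r,c+1)\to(r,c)$ has label $cm-r$. For $w$ admissible in $T_0^{m,n}$, $\mathbf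 D_{m,n}w\in L_{n,m}^{\mathbb Z}$ is the sequence of arrow labels read along the path $w$ in $D_0^{m,n}$. **Normalization.** For $0\le i\le 2n-1$, $\phi_i^{m,n}$ is the reflection of the plane across the line of angle $(i+1)\pi/(2n)$; it maps $\Sigma_i^{m,n}$ onto $\Sigma_0^{m,n}$. It is taken as a fact, for every $(m,n)$, that $\phi_i^{m,n}$ also gives an affine diffeomorphism of $S_{m,n}$ to itself, obtained by reflecting each polygon of $S_{m,n}$; $\pi_i^{m,n}$ denotes the permutation of the edge labels $L_{m,n}$ that it induces, which maps sequences admissible in $T_i^{m,n}$ to sequences admissible in $T_0^{m,n}$. If $w$ is admissible in $T_i^{m,n}$, $0\le i\le n-1$, then $\mathbf N_{m,n}w=\pi_i^{m,n}w$ (letter by letter); if $w$ is admissible in several diagrams, any such $i$ may be used. **Infinitely derivable.** $w\in L_{m,n}^{\mathbb Z}$ is infinitely derivable if it is admissible and all sequences obtained by alternately applying normalization and derivation, namely $\mathbf D_{m,n}\mathbf N_{m,n}w$, $\mathbf D_{n,m}\mathbf N_{n,m}\mathbf D_{m,n}\mathbf N_{m,n}w$, $\mathbf D_{m,n}\mathbf N_{m,n}\mathbf D_{n,m}\mathbf N_{n,m}\mathbf D_{m,n}\mathbf N_{m,n}w$, etc., are admissible (in some $T_i^{m,n}$, $0\le i\le n-1$, after an even number of derivations; in some $T_i^{n,m}$, $0\le i\le m-1$, after an odd number).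
   Formalization: For m, n, i all even the reflection φ_i does not map polygons of the surface to polygons (e.g. m=2, n=4, i=0), so π_i is undefined; there the rotation by -iπ/n induces π_i instead. For m, n even and i odd, an unspecified one of the two lifts of φ_i is used. *)

theory Defs
  imports "HOL-Analysis.Analysis"
begin

section \<open>The surface\<close>

text \<open>
  Polygon sides carry integer indices, read modulo \<open>2 n\<close> and normalised to \<open>{0..<2 n}\<close>; polygons
  carry the indices \<open>0, ..., m - 1\<close>.
\<close>

definition edge_vec :: "nat \<Rightarrow> real \<Rightarrow> real \<Rightarrow> int \<Rightarrow> complex" where
  "edge_vec n a b e = of_real (if even e then a else b) * cis (real_of_int e * pi / real n)"

definition bm_vec :: "nat \<Rightarrow> nat \<Rightarrow> nat \<Rightarrow> int \<Rightarrow> complex" where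
  "bm_vec m n k e =
     (let s = sin (real k * pi / real m); t = sin (real (Suc k) * pi / real m)
      in if odd n \<or> even k then edge_vec n s t e else edge_vec n t s e)"

text \<open>
  \<open>P(k)\<close> is placed in the plane with the starting point of side \<open>0\<close> at the origin; side \<open>e\<close> runs
  from \<open>corner m n k e\<close> to \<open>corner m n k (e + 1)\<close>. The set \<open>side m n k e\<close> excludes the endpoints,
  so it is empty for a side of length zero.
\<close>

definition corner :: "nat \<Rightarrow> nat \<Rightarrow> nat \<Rightarrow> int \<Rightarrow> complex" where
  "corner m n k e = (\<Sum>j\<in>{0..<e}. bm_vec m n k j)"

definition side :: "nat \<Rightarrow> nat \<Rightarrow> nat \<Rightarrow> int \<Rightarrow> complex set" where
  "side m n k e = open_segment (corner m n k e) (corner m n k (e + 1))"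

definition right_side :: "nat \<Rightarrow> nat \<Rightarrow> int \<Rightarrow> bool" where
  "right_side n k e \<longleftrightarrow> (if odd n \<or> even k then odd e else even e)"

definition side_of_label :: "nat \<Rightarrow> nat \<Rightarrow> nat \<Rightarrow> int" where
  "side_of_label n k s =
     (if odd n \<or> even k then (if odd s then int s else 1 - int s)
      else (if even s then int s else 1 - int s)) mod (2 * int n)"

text \<open>
  The right side \<open>e\<close> of \<open>P(k)\<close> is glued to the side \<open>e'\<close> of \<open>P(k')\<close>, and the resulting edge of the
  surface has label \<open>l\<close> (with \<open>k = r - 1\<close> in the numbering \<open>l = (r - 1) n + s\<close>).
\<close>

definition glued :: "nat \<Rightarrow> nat \<Rightarrow> nat \<Rightarrow> nat \<Rightarrow> int \<Rightarrow> nat \<Rightarrow> int \<Rightarrow> bool" where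
  "glued m n l k e k' e' \<longleftrightarrow>
     k' = Suc k \<and> k' < m \<and>
     0 \<le> e \<and> e < 2 * int n \<and> right_side n k e \<and> e' = (e + int n) mod (2 * int n) \<and>
     (\<exists>s\<in>{1..n}. e = side_of_label n k s \<and> l = k * n + s)"

definition crosses :: "nat \<Rightarrow> nat \<Rightarrow> nat \<Rightarrow> nat \<Rightarrow> int \<Rightarrow> nat \<Rightarrow> int \<Rightarrow> bool" where
  "crosses m n l k e k' e' \<longleftrightarrow> glued m n l k e k' e' \<or> glued m n l k' e' k e"


section \<open>Trajectories and cutting sequences\<close>

text \<open>
  A bi-infinite trajectory of direction \<open>\<theta>\<close> and unit speed is given by its passages through
  polygons: during the time interval \<open>[\<tau> j, \<tau> (j + 1)]\<close> it is in \<open>P(\<kappa> j)\<close>, at the point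
  \<open>x j + (t - \<tau> j) cis \<theta>\<close> at time \<open>t\<close>; at time \<open>\<tau> (j + 1)\<close> it leaves \<open>P(\<kappa> j)\<close> through an interior
  point of side \<open>e j\<close> and enters \<open>P(\<kappa> (j + 1))\<close> through side \<open>f (j + 1)\<close>, crossing the edge labelled
  \<open>w j\<close>. The polygons being convex, each passage stays inside its polygon.

  The condition on \<open>Im\<close> says that the direction points strictly outwards across side \<open>e j\<close>; the
  glued side having the opposite edge vector, it points strictly into the next polygon. The last
  equation for \<open>x\<close> is the gluing translation, which takes side \<open>e j\<close> to side \<open>f (j + 1)\<close> and thus
  the start of the first to the end of the second.

  Times need not increase strictly: for \<open>n = 2\<close> the polygons \<open>P(0)\<close> and \<open>P(m - 1)\<close> are two-sided
  segments, whose two sides are crossed one after the other at the same instant. The sign condition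
  forces such a crossing to go in by one side and out by the other.
\<close>

definition linear_trajectory ::
  "nat \<Rightarrow> nat \<Rightarrow> real \<Rightarrow> (int \<Rightarrow> nat) \<Rightarrow> (int \<Rightarrow> complex) \<Rightarrow> (int \<Rightarrow> real) \<Rightarrow>
   (int \<Rightarrow> int) \<Rightarrow> (int \<Rightarrow> int) \<Rightarrow> (int \<Rightarrow> nat) \<Rightarrow> bool" where
  "linear_trajectory m n \<theta> \<kappa> x \<tau> f e w \<longleftrightarrow>
     (\<forall>j. let y = x j + of_real (\<tau> (j + 1) - \<tau> j) * cis \<theta> in
        \<tau> j \<le> \<tau> (j + 1) \<and>
        y \<in> side m n (\<kappa> j) (e j) \<and>
        Im (cnj (bm_vec m n (\<kappa> j) (e j)) * cis \<theta>) < 0 \<and>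
        crosses m n (w j) (\<kappa> j) (e j) (\<kappa> (j + 1)) (f (j + 1)) \<and>
        x (j + 1) = y - corner m n (\<kappa> j) (e j) + corner m n (\<kappa> (j + 1)) (f (j + 1) + 1)) \<and>
     filterlim \<tau> at_top at_top \<and> filterlim \<tau> at_bot at_bot"

definition cutting_sequence :: "nat \<Rightarrow> nat \<Rightarrow> real \<Rightarrow> (int \<Rightarrow> nat) \<Rightarrow> bool" where
  "cutting_sequence m n \<theta> w \<longleftrightarrow> (\<exists>\<kappa> x \<tau> f e. linear_trajectory m n \<theta> \<kappa> x \<tau> f e w)"


section \<open>Transition diagrams and admissibility\<close>

definition sector :: "nat \<Rightarrow> nat \<Rightarrow> real set" where
  "sector n i = {real i * pi / real n .. real (Suc i) * pi / real n}"

definition transition :: "nat \<Rightarrow> nat \<Rightarrow> nat \<Rightarrow> nat \<Rightarrow> nat \<Rightarrow> bool" where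
  "transition m n i p q \<longleftrightarrow>
     (\<exists>\<theta>\<in>sector n i. \<exists>w j. cutting_sequence m n \<theta> w \<and> w j = p \<and> w (j + 1) = q)"

definition admissible_in :: "nat \<Rightarrow> nat \<Rightarrow> nat \<Rightarrow> (int \<Rightarrow> nat) \<Rightarrow> bool" where
  "admissible_in m n i w \<longleftrightarrow> (\<forall>j. transition m n i (w j) (w (j + 1)))"

definition admissible :: "nat \<Rightarrow> nat \<Rightarrow> (int \<Rightarrow> nat) \<Rightarrow> bool" where
  "admissible m n w \<longleftrightarrow> (\<exists>i<n. admissible_in m n i w)"


section \<open>Derivation\<close>

definition vertex :: "nat \<Rightarrow> nat \<Rightarrow> nat \<Rightarrow> nat" where
  "vertex n r c = (if odd r then (r - 1) * n + c else r * n + 1 - c)"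

text \<open>\<open>arrow_label m n p q l\<close>: the horizontal arrow from \<open>p\<close> to \<open>q\<close> carries the label \<open>l\<close>.\<close>

inductive arrow_label :: "nat \<Rightarrow> nat \<Rightarrow> nat \<Rightarrow> nat \<Rightarrow> nat \<Rightarrow> bool" for m n where
  odd_left: "\<lbrakk>1 \<le> r; r < m; 1 \<le> c; c < n; odd c\<rbrakk> \<Longrightarrow>
     arrow_label m n (vertex n r (c + 1)) (vertex n r c) ((c - 1) * m + r)"
| odd_right: "\<lbrakk>1 \<le> r; r < m; 1 \<le> c; c < n; odd c\<rbrakk> \<Longrightarrow>
     arrow_label m n (vertex n r c) (vertex n r (c + 1)) ((c - 1) * m + r + 1)"
| even_right: "\<lbrakk>1 \<le> r; r < m; 1 \<le> c; c < n; even c\<rbrakk> \<Longrightarrow>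
     arrow_label m n (vertex n r c) (vertex n r (c + 1)) (c * m - r + 1)"
| even_left: "\<lbrakk>1 \<le> r; r < m; 1 \<le> c; c < n; even c\<rbrakk> \<Longrightarrow>
     arrow_label m n (vertex n r (c + 1)) (vertex n r c) (c * m - r)"

text \<open>
  \<open>h\<close> enumerates, in order, the steps of the path \<open>w\<close> that use a horizontal arrow. The origin of
  the derived sequence is arbitrary.
\<close>

definition is_derived_seq :: "nat \<Rightarrow> nat \<Rightarrow> (int \<Rightarrow> nat) \<Rightarrow> (int \<Rightarrow> nat) \<Rightarrow> bool" where
  "is_derived_seq m n w v \<longleftrightarrow>
     (\<exists>h :: int \<Rightarrow> int. strict_mono h \<and>
        range h = {j. \<exists>l. arrow_label m n (w j) (w (j + 1)) l} \<and>
        (\<forall>j. arrow_label m n (w (h j)) (w (h j + 1)) (v j)))"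

definition derived_seq :: "nat \<Rightarrow> nat \<Rightarrow> (int \<Rightarrow> nat) \<Rightarrow> (int \<Rightarrow> nat)" where
  "derived_seq m n w = (SOME v. is_derived_seq m n w v)"


section \<open>Normalization\<close>

text \<open>
  \<open>induced_perm m n A g \<sigma>\<close>: there is an automorphism of the glued surface that permutes the polygons
  (by \<open>\<beta>\<close>), sends side \<open>e\<close> of each polygon to the side \<open>g e\<close> of its image, transforms edge vectors
  by \<open>A\<close>, and induces \<open>\<sigma>\<close> on the edge labels.
\<close>

definition induced_perm ::
  "nat \<Rightarrow> nat \<Rightarrow> (complex \<Rightarrow> complex) \<Rightarrow> (int \<Rightarrow> int) \<Rightarrow> (nat \<Rightarrow> nat) \<Rightarrow> bool" where
  "induced_perm m n A g \<sigma> \<longleftrightarrow>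
     \<sigma> permutes {1..n * (m - 1)} \<and>
     (\<exists>\<beta>. bij_betw \<beta> {..<m} {..<m} \<and>
        (\<forall>k<m. \<forall>e. bm_vec m n (\<beta> k) (g e) = A (bm_vec m n k e)) \<and>
        (\<forall>l k e k' e'. crosses m n l k e k' e' \<longrightarrow>
           crosses m n (\<sigma> l) (\<beta> k) (g e mod (2 * int n)) (\<beta> k') (g e' mod (2 * int n))))"

definition reflection :: "nat \<Rightarrow> nat \<Rightarrow> complex \<Rightarrow> complex" where
  "reflection n i z = cis (real (i + 1) * pi / real n) * cnj z"

text \<open>
  \<open>reflection n i\<close> is the reflection across the line of angle \<open>(i + 1) \<pi> / (2 n)\<close>. It reverses
  orientation, so the image of a side, traversed counterclockwise, has as edge vector minus the
  reflected edge vector: side \<open>e\<close>, of angle \<open>e \<pi> / n\<close>, goes to the side of angle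
  \<open>(i + 1 - e) \<pi> / n + \<pi>\<close>, of index \<open>i + 1 + n - e\<close>.
\<close>

definition reflection_perm :: "nat \<Rightarrow> nat \<Rightarrow> nat \<Rightarrow> (nat \<Rightarrow> nat) \<Rightarrow> bool" where
  "reflection_perm m n i \<sigma> \<longleftrightarrow>
     induced_perm m n (\<lambda>z. - reflection n i z) (\<lambda>e. int i + 1 + int n - e) \<sigma>"

definition rotation_perm :: "nat \<Rightarrow> nat \<Rightarrow> nat \<Rightarrow> (nat \<Rightarrow> nat) \<Rightarrow> bool" where
  "rotation_perm m n i \<sigma> \<longleftrightarrow>
     induced_perm m n (\<lambda>z. cis (- (real i * pi / real n)) * z) (\<lambda>e. e - int i) \<sigma>"

text \<open>
  The permutation \<open>\<pi>\<^sub>i\<close> is the one induced by the reflection. The reflection maps every polygon to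
  a polygon of the surface except when \<open>m\<close>, \<open>n\<close> and \<open>i\<close> are all even: it then exchanges sides of
  even and odd index, whereas \<open>P(k)\<close> for \<open>n\<close> even has no partner with exchanged side lengths (for
  \<open>m = 2\<close>, \<open>n = 4\<close> it turns both squares by \<open>\<pi>/4\<close>). In that case only, the rotation by
  \<open>- i \<pi> / n\<close> is used, which likewise maps \<open>sector n i\<close> onto \<open>sector n 0\<close> and is an automorphism
  of the surface. For \<open>m\<close>, \<open>n\<close> even the permutation is determined only up to the translation
  automorphism exchanging \<open>P(k)\<close> and \<open>P(m - 1 - k)\<close>; otherwise it is unique.
\<close>

definition label_perm :: "nat \<Rightarrow> nat \<Rightarrow> nat \<Rightarrow> (nat \<Rightarrow> nat)" where
  "label_perm m n i =
     (if \<exists>\<sigma>. reflection_perm m n i \<sigma> then (SOME \<sigma>. reflection_perm m n i \<sigma>)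
      else (SOME \<sigma>. rotation_perm m n i \<sigma>))"


section \<open>Infinite derivability\<close>

text \<open>
  \<open>renormalized m n w p q v\<close>: the sequence \<open>v\<close>, over the labels of the surface with indices
  \<open>p, q\<close>, results from \<open>w\<close> by finitely many rounds of normalization followed by derivation. When a
  sequence is admissible in several diagrams, every choice of \<open>i\<close> is allowed.
\<close>

inductive renormalized ::
  "nat \<Rightarrow> nat \<Rightarrow> (int \<Rightarrow> nat) \<Rightarrow> nat \<Rightarrow> nat \<Rightarrow> (int \<Rightarrow> nat) \<Rightarrow> bool" for m n w where
  start: "renormalized m n w m n w"
| step: "\<lbrakk>renormalized m n w p q v; i < q; admissible_in p q i v\<rbrakk> \<Longrightarrow>
     renormalized m n w q p (derived_seq p q (label_perm p q i \<circ> v))"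

text \<open>
  As \<open>label_perm\<close> and \<open>derived_seq\<close> are total, a next sequence exists whenever the current one is
  admissible, so the condition below is never vacuous at a later round.
\<close>

definition infinitely_derivable :: "nat \<Rightarrow> nat \<Rightarrow> (int \<Rightarrow> nat) \<Rightarrow> bool" where
  "infinitely_derivable m n w \<longleftrightarrow>
     (\<forall>p q v. renormalized m n w p q v \<longrightarrow> admissible p q v)"

end

theory Submission
  imports Defs
begin

text \<open>
  The invariant of renormalization is that the current sequence is a cutting sequence of a
  trajectory with direction in \<open>[0, \<pi>]\<close>.

  Derivation: certain diagonals (chords) cut the polygons of \<open>S\<^bsub>m,n\<^esub>\<close> into quadrilaterals having two
  opposite sides that are edges and two that are chords. Regrouping the quadrilaterals along edges
  instead of chords gives, up to a linear map, the polygons of \<open>S\<^bsub>n,m\<^esub>\<close>, with edges and chords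
  exchanged. A trajectory with direction in the first sector crosses a chord exactly when it takes a
  horizontal arrow, and the arrow label is the label of that chord.

  Normalization: a sequence may be admissible in a diagram other than the one of its direction. But
  each arrow of the first diagram displaces the midpoint of the edge by a vector in the first sector,
  so a trajectory following the arrows has its direction there. A trajectory going against the
  arrows is horizontal and has a boundary direction, hence period two, and its cutting sequence is
  also that of the reversed trajectory.
\<close>

text \<open>In the basis of the directions 0 and pi/n, the coordinates of sides and chords are, up
  to sign, products of a sine of a multiple of pi/n and a sine of a multiple of pi/m. For a side the
  second factor, its length, is common to both coordinates and the first runs through two
  consecutive sines; for a chord the roles are exchanged. Hence a single linear map,
  \<open>shear_flip\<close>, can turn the chords into sides of the dual surface. It reverses
  orientation and sends the first sector to the directions from pi/m to pi, so the derived sequence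
  has to be normalized anew.

  The obstacle is that the index i is chosen from the sequence and not from the direction. After
  normalization the direction is only known to lie in [pi/n - pi, pi]. The two ends of this interval
  are the opposites of pi/n and of 0, so it meets the sector opposite to the first one in boundary
  directions only. This is what confines motion against the arrows to a boundary direction.\<close>

definition sn :: "nat \<Rightarrow> int \<Rightarrow> real" where
  "sn n e = sin (of_int e * pi / of_nat n)"

lemma sn_minus [simp]: "sn n (- e) = - sn n e"
  by (simp add: sn_def)

lemma sn_supplement: "n > 0 \<Longrightarrow> sn n (int n - e) = sn n e"
proof -
  assume "n > 0"
  then have "of_int (int n - e) * pi / of_nat n = pi - of_int e * pi / of_nat n"
    by (simp add: field_simps)
  then show ?thesis unfolding sn_def by (simp only: sin_pi_minus)
qed

lemma sn_nonneg: "0 \<le> e \<Longrightarrow> e \<le> int n \<Longrightarrow> 0 \<le> sn n e"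
  unfolding sn_def
  by (rule sin_ge_zero) (auto simp: divide_le_eq mult_right_mono)

lemma cis_int_mult_add:
  "cis (of_int (a + b) * pi / of_nat n) = cis (of_int a * pi / of_nat n) * cis (of_int b * pi / of_nat n)"
  by (simp add: cis_mult add_divide_distrib distrib_right)

lemma cis_half_turn: "n > 0 \<Longrightarrow> cis (of_int (e + int n) * pi / of_nat n) = - cis (of_int e * pi / of_nat n)"
  by (subst cis_int_mult_add) simp

lemma cis_int_mod:
  assumes "n > 0"
  shows "cis (of_int (e mod (2 * int n)) * pi / of_nat n) = cis (of_int e * pi / of_nat n)"
proof -
  have *: "e = e mod (2 * int n) + (e div (2 * int n)) * (2 * int n)"
    by (rule mod_div_mult_eq[symmetric])
  have "cis (of_int ((e div (2 * int n)) * (2 * int n)) * pi / of_nat n) = cis (2 * pi * of_int (e div (2 * int n)))"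
    using assms by (simp add: field_simps)
  also have "\<dots> = 1" by (simp add: cis_multiple_2pi)
  finally show ?thesis by (subst (2) *) (simp only: cis_int_mult_add mult_1_right)
qed

section \<open>Coordinates with respect to the directions \<open>0\<close> and \<open>\<pi> / n\<close>\<close>

text \<open>\<open>xc n w\<close> and \<open>Im w\<close> are \<open>sin (\<pi> / n)\<close> times the coordinates of \<open>w\<close> in the basis
  \<open>1, cis (\<pi> / n)\<close>.\<close>

definition xc :: "nat \<Rightarrow> complex \<Rightarrow> real" where
  "xc n w = Re w * sin (pi / of_nat n) - Im w * cos (pi / of_nat n)"

lemma xc_linear [simp]:
  "xc n (w + w') = xc n w + xc n w'" "xc n (w - w') = xc n w - xc n w'" "xc n (- w) = - xc n w"
  "xc n (of_real t * w) = t * xc n w" "xc n 0 = 0"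
  by (simp_all add: xc_def algebra_simps)

lemma xc_cis: "xc n (cis t) = sin (pi / of_nat n - t)"
  by (simp add: xc_def sin_diff algebra_simps)

lemma xc_cis_int: "n > 0 \<Longrightarrow> xc n (cis (of_int e * pi / of_nat n)) = - sn n (e - 1)"
proof -
  assume "n > 0"
  then have "pi / of_nat n - of_int e * pi / of_nat n = - (of_int (e - 1) * pi / of_nat n)"
    by (simp add: field_simps)
  then show ?thesis unfolding xc_cis sn_def by (simp only: sin_minus)
qed

lemma sin_pi_over_pos: "n \<ge> 2 \<Longrightarrow> sin (pi / of_nat n) > 0"
  by (rule sin_gt_zero) (auto simp: divide_less_eq)

lemma xc_Im_eqI:
  assumes "n \<ge> 2" "xc n w = xc n w'" "Im w = Im w'"
  shows "w = w'"
  using assms sin_pi_over_pos[of n] by (simp add: xc_def complex_eq_iff)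

lemma cross_xc_Im: "Im (cnj d * w) * sin (pi / of_nat n) = xc n d * Im w - Im d * xc n w"
  by (simp add: xc_def algebra_simps)

text \<open>The linear map that fixes the direction \<open>\<pi> / n\<close> (as \<open>\<pi> / m\<close>) and reverses the direction \<open>0\<close>.\<close>

definition shear_flip :: "nat \<Rightarrow> nat \<Rightarrow> complex \<Rightarrow> complex" where
  "shear_flip m n w =
     (of_real (Im w) * cis (pi / of_nat m) - of_real (xc n w)) / of_real (sin (pi / of_nat m))"

lemma Im_shear_flip: "m \<ge> 2 \<Longrightarrow> Im (shear_flip m n w) = Im w"
  using sin_pi_over_pos[of m] by (simp add: shear_flip_def)

lemma xc_shear_flip: "m \<ge> 2 \<Longrightarrow> xc m (shear_flip m n w) = - xc n w"
  using sin_pi_over_pos[of m] by (simp add: shear_flip_def xc_def field_simps)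

lemma shear_flip_linear:
  "shear_flip m n (w + w') = shear_flip m n w + shear_flip m n w'"
  "shear_flip m n (w - w') = shear_flip m n w - shear_flip m n w'"
  "shear_flip m n (- w) = - shear_flip m n w"
  "shear_flip m n (of_real t * w) = of_real t * shear_flip m n w"
  by (simp_all add: shear_flip_def add_divide_distrib[symmetric] diff_divide_distrib[symmetric]
      minus_divide_left algebra_simps xc_def)

text \<open>Both cross products are determinants of the same coordinates up to the sign of the first
  one. The minus sign says that \<open>shear_flip\<close> exchanges left and right of a
  trajectory.\<close>

lemma cross_shear_flip:
  assumes "m \<ge> 2"
  shows "Im (cnj (shear_flip m n d) * shear_flip m n w) * sin (pi / of_nat m)
    = - (Im (cnj d * w) * sin (pi / of_nat n))"
  unfolding cross_xc_Im using assms by (simp add: Im_shear_flip xc_shear_flip)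

section \<open>Polygons\<close>

text \<open>The parity conventions are absorbed into \<open>right_side\<close>, so that passing from
  left to right sides is always the shift from k to k + 1.\<close>

definition slen :: "nat \<Rightarrow> nat \<Rightarrow> nat \<Rightarrow> int \<Rightarrow> real" where
  "slen m n k e = (if right_side n k e then sn m (int k + 1) else sn m (int k))"

lemma bm_vec_slen: "bm_vec m n k e = of_real (slen m n k e) * cis (of_int e * pi / of_nat n)"
  by (auto simp: bm_vec_def edge_vec_def slen_def right_side_def sn_def Let_def add.commute)

lemma right_side_add2 [simp]: "right_side n k (e + 2) = right_side n k e"
  by (simp add: right_side_def)

lemma right_side_Suc: "right_side n k (e + 1) \<longleftrightarrow> \<not> right_side n k e"
  by (simp add: right_side_def)

lemma right_side_minus [simp]: "right_side n k (- e) = right_side n k e"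
  by (simp add: right_side_def)

lemma right_side_mod [simp]: "right_side n k (e mod (2 * int n)) = right_side n k e"
  by (simp add: right_side_def dvd_mod_iff)

lemma slen_simps [simp]:
  "slen m n k (e + 2) = slen m n k e" "slen m n k (- e) = slen m n k e"
  "slen m n k (e mod (2 * int n)) = slen m n k e"
  by (simp_all add: slen_def)

lemma slen_cong: "even (e - e') \<Longrightarrow> slen m n k e = slen m n k e'"
  by (auto simp: slen_def right_side_def)

lemma slen_nonneg: "k < m \<Longrightarrow> 0 \<le> slen m n k e"
  by (auto simp: slen_def intro!: sn_nonneg)

lemma xc_bm_vec: "n > 0 \<Longrightarrow> xc n (bm_vec m n k e) = - (slen m n k e * sn n (e - 1))"
  by (simp add: bm_vec_slen xc_cis_int)

lemma Im_bm_vec: "Im (bm_vec m n k e) = slen m n k e * sn n e"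
  by (simp add: bm_vec_slen sn_def)

lemma bm_vec_mod: "n > 0 \<Longrightarrow> bm_vec m n k (e mod (2 * int n)) = bm_vec m n k e"
  by (simp add: bm_vec_slen cis_int_mod)

text \<open>The corners of \<open>P(k)\<close>, placed with its centre at the origin, in closed form: the two geometric
  progressions of sides are summed, so that periodicity is evident.\<close>

definition vtx :: "nat \<Rightarrow> nat \<Rightarrow> nat \<Rightarrow> int \<Rightarrow> complex" where
  "vtx m n k e = (of_real (slen m n k e) + of_real (slen m n k (e + 1)) * cis (pi / of_nat n))
     * cis (of_int e * pi / of_nat n) / (cis (pi / of_nat n) ^ 2 - 1)"

lemma cis_pi_over_square_ne: "n \<ge> 2 \<Longrightarrow> cis (pi / of_nat n) ^ 2 - 1 \<noteq> 0"
proof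
  assume n: "n \<ge> 2" and "cis (pi / of_nat n) ^ 2 - 1 = 0"
  then have "cis (pi / of_nat n) = 1 \<or> cis (pi / of_nat n) = -1"
    by (simp add: power2_eq_1_iff)
  then have "sin (pi / of_nat n) = 0" by (auto simp: complex_eq_iff)
  then show False using sin_pi_over_pos[OF n] by simp
qed

lemma vtx_add1:
  assumes "n \<ge> 2"
  shows "vtx m n k (e + 1) = vtx m n k e + bm_vec m n k e"
proof -
  let ?z = "cis (pi / of_nat n)" and ?w = "cis (of_int e * pi / of_nat n)"
  let ?a = "complex_of_real (slen m n k e)" and ?b = "complex_of_real (slen m n k (e + 1))"
  have w: "cis (of_int (e + 1) * pi / of_nat n) = ?w * ?z"
    by (subst cis_int_mult_add) simp
  have "slen m n k (e + 1 + 1) = slen m n k e" using slen_simps(1)[of m n k e] by (simp add: add.assoc)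
  then have "vtx m n k (e + 1) - vtx m n k e = ((?b + ?a * ?z) * (?w * ?z) - (?a + ?b * ?z) * ?w) / (?z ^ 2 - 1)"
    unfolding vtx_def w by (simp add: diff_divide_distrib)
  also have "\<dots> = (?a * ?w * (?z ^ 2 - 1)) / (?z ^ 2 - 1)"
    by (simp add: algebra_simps power2_eq_square)
  also have "\<dots> = bm_vec m n k e"
    using cis_pi_over_square_ne[OF assms] by (simp add: bm_vec_slen)
  finally show ?thesis by (simp add: algebra_simps)
qed

lemma vtx_mod: "n > 0 \<Longrightarrow> vtx m n k (e mod (2 * int n)) = vtx m n k e"
proof -
  assume n: "n > 0"
  have "slen m n k (e mod (2 * int n) + 1) = slen m n k (e + 1)"
    by (simp add: slen_def right_side_def dvd_mod_iff)
  then show ?thesis by (simp add: vtx_def cis_int_mod[OF n])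
qed

lemma vtx_cong:
  assumes "n > 0" "e mod (2 * int n) = e' mod (2 * int n)"
  shows "vtx m n k e = vtx m n k e'"
  using vtx_mod[OF assms(1), of m k e] vtx_mod[OF assms(1), of m k e'] assms(2) by simp

lemma corner_vtx:
  assumes "n \<ge> 2" "0 \<le> e"
  shows "corner m n k e = vtx m n k e - vtx m n k 0"
  using assms(2)
proof (induction e rule: int_ge_induct)
  case base
  then show ?case by (simp add: corner_def)
next
  case (step e)
  have "{0..<e + 1} = insert e {0..<e}" using step.hyps by auto
  then have "corner m n k (e + 1) = corner m n k e + bm_vec m n k e" by (simp add: corner_def)
  then show ?case using step.IH vtx_add1[OF assms(1)] by simp
qed

text \<open>\<open>chord m n k a\<close> runs from corner \<open>- a\<close> to corner \<open>a + 2\<close>. Up to a linear map,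
  the chords are the sides of the polygons of the dual surface.\<close>

definition chord :: "nat \<Rightarrow> nat \<Rightarrow> nat \<Rightarrow> int \<Rightarrow> complex" where
  "chord m n k a = vtx m n k (a + 2) - vtx m n k (- a)"

text \<open>By periodicity of the lengths, corners \<open>a + 2\<close> and \<open>- a\<close> share
  the factor \<open>slen a + slen (a + 1) cis (pi / n)\<close>, and the chord is
  \<open>sn n (a + 1) / sin (pi / n)\<close> times it. So chords of one polygon whose indices have
  the same parity are parallel, and for k < m and 0 \<le> a + 1 \<le> n they lie in the first
  sector.\<close>

lemma chord_closed:
  assumes "n \<ge> 2"
  shows "xc n (chord m n k a) = sn n (a + 1) * slen m n k a \<and>
    Im (chord m n k a) = sn n (a + 1) * slen m n k (a + 1)"
proof -
  let ?z = "cis (pi / of_nat n)"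
  let ?w = "cis (of_int (a + 1) * pi / of_nat n)" and ?w' = "cis (of_int (- a - 1) * pi / of_nat n)"
  let ?a = "complex_of_real (slen m n k a)" and ?b = "complex_of_real (slen m n k (a + 1))"
  have sin: "complex_of_real (sin (pi / of_nat n)) \<noteq> 0" using sin_pi_over_pos[OF assms] by simp
  have e1: "cis (of_int (a + 2) * pi / of_nat n) = ?w * ?z"
    using cis_int_mult_add[of "a + 1" 1 n] by (simp add: add.assoc)
  have e2: "cis (of_int (- a) * pi / of_nat n) = ?w' * ?z"
    using cis_int_mult_add[of "- a - 1" 1 n] by (simp add: add.assoc)
  have s1: "slen m n k (a + 2 + 1) = slen m n k (a + 1)" using slen_simps(1)[of m n k "a + 1"] by (simp add: add.assoc)
  have s2: "slen m n k (- a + 1) = slen m n k (a + 1)" by (rule slen_cong) simp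
  have z2: "?z ^ 2 - 1 = ?z * (2 * \<i> * of_real (sin (pi / of_nat n)))"
    using sin_cos_squared_add3[of "pi / of_nat n"] by (simp add: complex_eq_iff power2_eq_square algebra_simps)
  have w: "?w - ?w' = 2 * \<i> * of_real (sn n (a + 1))"
  proof -
    have "of_int (- a - 1) * pi / of_nat n = - (of_int (a + 1) * pi / of_nat n)"
      by (simp add: divide_simps algebra_simps)
    then show ?thesis by (simp add: complex_eq_iff sn_def del: of_int_add)
  qed
  have "chord m n k a = (?a + ?b * ?z) * ?z * (?w - ?w') / (?z ^ 2 - 1)"
    unfolding chord_def vtx_def s1 s2 e1 e2 by (simp add: diff_divide_distrib algebra_simps)
  also have "\<dots> = (?a + ?b * ?z) * of_real (sn n (a + 1)) / of_real (sin (pi / of_nat n))"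
    unfolding z2 w using sin by (simp add: field_simps)
  finally have "of_real (sin (pi / of_nat n)) * chord m n k a = (?a + ?b * ?z) * of_real (sn n (a + 1))"
    using sin by simp
  then have "of_real (sin (pi / of_nat n)) * chord m n k a
      = of_real (slen m n k a * sn n (a + 1)) * cis 0 + of_real (slen m n k (a + 1) * sn n (a + 1)) * ?z"
    by (simp add: algebra_simps)
  then have "sin (pi / of_nat n) * xc n (chord m n k a) = slen m n k a * sn n (a + 1) * sin (pi / of_nat n)"
    "sin (pi / of_nat n) * Im (chord m n k a) = slen m n k (a + 1) * sn n (a + 1) * sin (pi / of_nat n)"
    by (metis (no_types) xc_linear(1,4) xc_cis diff_zero diff_self sin_zero mult_zero_right add_0_right,
        simp add: complex_eq_iff)
  then show ?thesis using sin_pi_over_pos[OF assms] by simp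
qed

lemmas xc_chord = chord_closed[THEN conjunct1] and Im_chord = chord_closed[THEN conjunct2]

section \<open>Labels in the grid\<close>

text \<open>The edge at \<open>(r, c)\<close> joins \<open>P(r - 1)\<close> and \<open>P(r)\<close>. A trajectory with direction in the first
  sector crosses it from \<open>poly_before r c\<close>, where it is side \<open>side_index n r c\<close>, to
  \<open>poly_after r c\<close>.\<close>

definition side_index :: "nat \<Rightarrow> nat \<Rightarrow> nat \<Rightarrow> int" where
  "side_index n r c = (if even (r + c) then int c else int n + 1 - int c)"

definition poly_before :: "nat \<Rightarrow> nat \<Rightarrow> nat" where
  "poly_before r c = (if odd c then r - 1 else r)"

definition poly_after :: "nat \<Rightarrow> nat \<Rightarrow> nat" where
  "poly_after r c = (if odd c then r else r - 1)"

lemma side_index_bounds: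
  "1 \<le> c \<Longrightarrow> c \<le> n \<Longrightarrow> 1 \<le> side_index n r c \<and> side_index n r c \<le> int n"
  by (auto simp: side_index_def)

lemma vertex_eq: "1 \<le> r \<Longrightarrow> c \<le> n \<Longrightarrow> vertex n r c = (r - 1) * n + (if odd r then c else n + 1 - c)"
  by (cases r) (auto simp: vertex_def)

text \<open>Uniqueness of division with remainder, with remainders counted from 1 as in the
  labels.\<close>

lemma add_mult_eq_iff:
  fixes s t n :: nat
  assumes "k * n + s = k' * n + t" "1 \<le> s" "s \<le> n" "1 \<le> t" "t \<le> n"
  shows "k = k' \<and> s = t"
proof -
  have *: "(k * n + a) div n = k" if "a < n" for k a :: nat
    using that by simp
  have "s - 1 < n" "t - 1 < n" and "k * n + (s - 1) = k' * n + (t - 1)" using assms by linarith+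
  then have "k = k'" using *[of "s - 1" k] *[of "t - 1" k'] by metis
  then show ?thesis using assms(1) by simp
qed

lemma vertex_inj:
  assumes "vertex n r c = vertex n r' c'" "1 \<le> r" "1 \<le> r'" "1 \<le> c" "c \<le> n" "1 \<le> c'" "c' \<le> n"
  shows "r = r' \<and> c = c'"
proof -
  have "r - 1 = r' - 1 \<and> (if odd r then c else n + 1 - c) = (if odd r' then c' else n + 1 - c')"
    by (rule add_mult_eq_iff) (use assms in \<open>auto simp: vertex_eq\<close>)
  moreover from this have "r = r'" using assms by linarith
  ultimately show ?thesis using assms by (cases "odd r") auto
qed

text \<open>The rows of the grid are numbered alternately forwards and backwards, hence s = c for k
  even and s = n + 1 - c for k odd. Of two glued sides exactly one has its index in 1..n, namely
  \<open>side_index\<close>; the parity of c decides whether it belongs to P(k) or to P(k +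
  1).\<close>

lemma side_of_label_vertex:
  fixes k :: nat
  assumes "1 \<le> c" "c \<le> n"
  defines "e \<equiv> side_of_label n k (if even k then c else n + 1 - c)" and "\<alpha> \<equiv> side_index n (Suc k) c"
  shows "e = (if odd c then \<alpha> else (\<alpha> + int n) mod (2 * int n))"
    and "(e + int n) mod (2 * int n) = (if odd c then (\<alpha> + int n) mod (2 * int n) else \<alpha>)"
    and "right_side n k e"
proof -
  have \<alpha>: "1 \<le> \<alpha>" "\<alpha> \<le> int n" using side_index_bounds[OF assms(1,2)] by (auto simp: \<alpha>_def)
  have m: "(x + 2 * int n) mod (2 * int n) = x mod (2 * int n)" for x by simp
  have e: "e = (if odd c then \<alpha> else \<alpha> + int n) mod (2 * int n)"
  proof (cases "even k")
    case True
    then show ?thesis using m[of "1 - int c"] by (auto simp: e_def \<alpha>_def side_of_label_def side_index_def)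
  next
    case False
    define s where "s = n + 1 - c"
    have s: "int s = int n + 1 - int c" "even s \<longleftrightarrow> (even n \<longleftrightarrow> odd c)"
      using assms(1,2) by (auto simp: s_def)
    have "(int c - int n) mod (2 * int n) = (int c + int n) mod (2 * int n)"
      using m[of "int c - int n"] by (simp add: add.commute)
    then show ?thesis using False s
      by (simp add: e_def \<alpha>_def side_of_label_def side_index_def s_def[symmetric] add.commute)
  qed
  have \<alpha>m: "\<alpha> mod (2 * int n) = \<alpha>" using \<alpha> by (intro mod_pos_pos_trivial) linarith+
  show e': "e = (if odd c then \<alpha> else (\<alpha> + int n) mod (2 * int n))"
    by (cases "odd c") (simp_all only: e \<alpha>m if_True if_False not_not simp_thms)
  show "(e + int n) mod (2 * int n) = (if odd c then (\<alpha> + int n) mod (2 * int n) else \<alpha>)"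
  proof (cases "odd c")
    case True
    then show ?thesis by (simp only: e' if_True not_False_eq_True)
  next
    case False
    have "((\<alpha> + int n) mod (2 * int n) + int n) mod (2 * int n) = (\<alpha> + 2 * int n) mod (2 * int n)"
      by (simp only: mod_add_left_eq) (simp add: add.assoc)
    then show ?thesis using False by (simp only: e' m \<alpha>m if_False not_not not_True_eq_False)
  qed
  show "right_side n k e"
    unfolding e using assms(1,2)
    by (auto simp: right_side_def \<alpha>_def side_index_def dvd_mod_iff)
qed

lemma glued_iff_vertex:
  "glued m n l k e k' e' \<longleftrightarrow>
     k' = Suc k \<and> Suc k < m \<and>
     (\<exists>c. 1 \<le> c \<and> c \<le> n \<and> l = vertex n (Suc k) c \<and>
        (odd c \<and> e = side_index n (Suc k) c \<and> e' = (side_index n (Suc k) c + int n) mod (2 * int n) \<or>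
         even c \<and> e = (side_index n (Suc k) c + int n) mod (2 * int n) \<and> e' = side_index n (Suc k) c))"
  (is "_ \<longleftrightarrow> ?R")
proof
  assume g: "glued m n l k e k' e'"
  then obtain s where s: "s \<in> {1..n}" "e = side_of_label n k s" "l = k * n + s"
    by (auto simp: glued_def)
  define c where "c = (if even k then s else n + 1 - s)"
  have c: "1 \<le> c" "c \<le> n" "s = (if even k then c else n + 1 - c)" using s(1) by (auto simp: c_def)
  note * = side_of_label_vertex[OF c(1,2), of k, folded c(3)]
  have "l = vertex n (Suc k) c" using s c by (auto simp: vertex_eq)
  moreover have "odd c \<and> e = side_index n (Suc k) c \<and> e' = (side_index n (Suc k) c + int n) mod (2 * int n)
     \<or> even c \<and> e = (side_index n (Suc k) c + int n) mod (2 * int n) \<and> e' = side_index n (Suc k) c"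
    using g * s(2) by (cases "odd c") (simp_all add: glued_def)
  ultimately show ?R using g c(1,2) unfolding glued_def by blast
next
  assume ?R
  then obtain c where c: "1 \<le> c" "c \<le> n" "l = vertex n (Suc k) c" and k: "k' = Suc k" "Suc k < m" and
    e: "odd c \<and> e = side_index n (Suc k) c \<and> e' = (side_index n (Suc k) c + int n) mod (2 * int n)
     \<or> even c \<and> e = (side_index n (Suc k) c + int n) mod (2 * int n) \<and> e' = side_index n (Suc k) c"
    by blast
  define s where "s = (if even k then c else n + 1 - c)"
  have s: "s \<in> {1..n}" using c by (auto simp: s_def)
  note * = side_of_label_vertex[OF c(1,2), of k, folded s_def]
  have e': "e = side_of_label n k s" "e' = (e + int n) mod (2 * int n)" using e * by (cases "odd c"; simp)+
  have "0 \<le> e \<and> e < 2 * int n" using e'(1) c by (simp add: side_of_label_def)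
  moreover have "l = k * n + s" using c by (simp add: vertex_eq s_def)
  ultimately show "glued m n l k e k' e'" using e' s *(3) k by (auto simp: glued_def)
qed

lemma crosses_sym: "crosses m n l k e k' e' \<longleftrightarrow> crosses m n l k' e' k e"
  by (auto simp: crosses_def)

lemma crosses_vertex:
  assumes "1 \<le> r" "r < m" "1 \<le> c" "c \<le> n"
  shows "crosses m n (vertex n r c) (poly_before r c) (side_index n r c)
    (poly_after r c) ((side_index n r c + int n) mod (2 * int n))"
proof -
  let ?a = "side_index n r c" and ?a' = "(side_index n r c + int n) mod (2 * int n)"
  have r: "Suc (r - 1) = r" using assms(1) by simp
  have "glued m n (vertex n r c) (r - 1) (if odd c then ?a else ?a') r (if odd c then ?a' else ?a)"
    unfolding glued_iff_vertex r using assms by (intro conjI exI[of _ c]) simp_all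
  then show ?thesis
    unfolding crosses_def poly_before_def poly_after_def by (cases "odd c") simp_all
qed

text \<open>From here on the numbering of labels is replaced by grid positions, and only the two
  senses of crossing an edge remain to be distinguished.\<close>

lemma crosses_cases:
  assumes "crosses m n l k e k' e'"
  obtains r c where "1 \<le> r" "r < m" "1 \<le> c" "c \<le> n" "l = vertex n r c"
    "(k = poly_before r c \<and> e = side_index n r c \<and>
      k' = poly_after r c \<and> e' = (side_index n r c + int n) mod (2 * int n)) \<or>
     (k' = poly_before r c \<and> e' = side_index n r c \<and>
      k = poly_after r c \<and> e = (side_index n r c + int n) mod (2 * int n))"
proof -
  have *: "\<exists>r c. 1 \<le> r \<and> r < m \<and> 1 \<le> c \<and> c \<le> n \<and> l = vertex n r c \<and>
    ((k = poly_before r c \<and> e = side_index n r c \<and>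
      k' = poly_after r c \<and> e' = (side_index n r c + int n) mod (2 * int n)) \<or>
     (k' = poly_before r c \<and> e' = side_index n r c \<and>
      k = poly_after r c \<and> e = (side_index n r c + int n) mod (2 * int n)))"
    if gl: "glued m n l k e k' e'" for k e k' e'
  proof -
    obtain c where c: "k' = Suc k" "Suc k < m" "1 \<le> c" "c \<le> n" "l = vertex n (Suc k) c"
      and e: "odd c \<and> e = side_index n (Suc k) c \<and> e' = (side_index n (Suc k) c + int n) mod (2 * int n)
        \<or> even c \<and> e = (side_index n (Suc k) c + int n) mod (2 * int n) \<and> e' = side_index n (Suc k) c"
      using gl unfolding glued_iff_vertex by blast
    show ?thesis
      by (intro exI[of _ "Suc k"] exI[of _ c], use c e in \<open>cases "odd c"\<close>)
        (simp_all add: poly_before_def poly_after_def)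
  qed
  from assms consider "glued m n l k e k' e'" | "glued m n l k' e' k e"
    unfolding crosses_def by blast
  then show ?thesis
  proof cases
    case 1
    then show ?thesis using *[OF 1] that by blast
  next
    case 2
    then show ?thesis using *[OF 2] that by blast
  qed
qed

lemma crosses_bounds:
  assumes "crosses m n l k e k' e'"
  shows "k < m" "k' < m" "0 \<le> e" "e < 2 * int n" "0 \<le> e'" "e' < 2 * int n"
  using assms by (auto simp: crosses_def glued_def)

lemma right_side_glued: "right_side n (Suc k) (e + int n) \<longleftrightarrow> \<not> right_side n k e"
  by (auto simp: right_side_def)

text \<open>Right sides of P(k) and left sides of P(k + 1) both have length
  \<open>sn m (k + 1)\<close>, and the index shift by n is a half turn.\<close>

lemma crosses_bm_vec:
  assumes "crosses m n l k e k' e'"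
  shows "bm_vec m n k' e' = - bm_vec m n k e"
proof -
  have *: "bm_vec m n k' e' = - bm_vec m n k e" if g: "glued m n l k e k' e'" for k e k' e'
  proof -
    have n: "n > 0" and r: "right_side n k e" and e': "e' = (e + int n) mod (2 * int n)" and k: "k' = Suc k"
      using g by (auto simp: glued_def)
    have "bm_vec m n k' e' = bm_vec m n (Suc k) (e + int n)"
      unfolding e' k by (rule bm_vec_mod[OF n])
    also have "\<dots> = - bm_vec m n k e"
      using r unfolding bm_vec_slen by (simp only: cis_half_turn[OF n]) (simp add: slen_def right_side_glued add.commute)
    finally show ?thesis .
  qed
  show ?thesis using assms *[of k e k' e'] *[of k' e' k e] by (auto simp: crosses_def)
qed

section \<open>Developed trajectories\<close>

text \<open>The polygons passed by a trajectory are placed in the plane one after the other, the centre of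
  the \<open>j\<close>-th at \<open>c j\<close>, so that the trajectory becomes the line \<open>t \<mapsto> t d\<close>.\<close>

definition developed ::
  "nat \<Rightarrow> nat \<Rightarrow> complex \<Rightarrow> (int \<Rightarrow> nat) \<Rightarrow> (int \<Rightarrow> complex) \<Rightarrow> (int \<Rightarrow> real) \<Rightarrow>
   (int \<Rightarrow> int) \<Rightarrow> (int \<Rightarrow> int) \<Rightarrow> (int \<Rightarrow> nat) \<Rightarrow> bool" where
  "developed m n d \<kappa> c \<tau> f e w \<longleftrightarrow>
     (\<forall>j. \<tau> j \<le> \<tau> (j + 1) \<and>
        of_real (\<tau> (j + 1)) * d \<in>
          open_segment (c j + vtx m n (\<kappa> j) (e j)) (c j + vtx m n (\<kappa> j) (e j + 1)) \<and>
        Im (cnj (bm_vec m n (\<kappa> j) (e j)) * d) < 0 \<and>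
        crosses m n (w j) (\<kappa> j) (e j) (\<kappa> (j + 1)) (f (j + 1)) \<and>
        c (j + 1) + vtx m n (\<kappa> (j + 1)) (f (j + 1) + 1) = c j + vtx m n (\<kappa> j) (e j)) \<and>
     filterlim \<tau> at_top at_top \<and> filterlim \<tau> at_bot at_bot"

lemma developedD:
  assumes "developed m n d \<kappa> c \<tau> f e w"
  shows "\<tau> j \<le> \<tau> (j + 1)"
    "of_real (\<tau> (j + 1)) * d \<in>
          open_segment (c j + vtx m n (\<kappa> j) (e j)) (c j + vtx m n (\<kappa> j) (e j + 1))"
    "Im (cnj (bm_vec m n (\<kappa> j) (e j)) * d) < 0"
    "crosses m n (w j) (\<kappa> j) (e j) (\<kappa> (j + 1)) (f (j + 1))"
    "c (j + 1) + vtx m n (\<kappa> (j + 1)) (f (j + 1) + 1) = c j + vtx m n (\<kappa> j) (e j)"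
    "filterlim \<tau> at_top at_top" "filterlim \<tau> at_bot at_bot"
  using assms by (simp_all only: developed_def)

lemma cutting_sequence_developed:
  assumes n: "n \<ge> 2"
  shows "cutting_sequence m n \<theta> w \<longleftrightarrow> (\<exists>\<kappa> c \<tau> f e. developed m n (cis \<theta>) \<kappa> c \<tau> f e w)"
proof
  assume "cutting_sequence m n \<theta> w"
  then obtain \<kappa> x \<tau> f e where t: "linear_trajectory m n \<theta> \<kappa> x \<tau> f e w"
    by (auto simp: cutting_sequence_def)
  \<comment> \<open>\<open>x j\<close> is measured from corner 0 of its polygon, \<open>vtx\<close>
    from the centre. The choice puts the entry point of passage j at \<open>\<tau> j\<close> times
    the direction.\<close>
  define c where "c j = of_real (\<tau> j) * cis \<theta> - x j - vtx m n (\<kappa> j) 0" for j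
  have "\<tau> j \<le> \<tau> (j + 1) \<and>
        of_real (\<tau> (j + 1)) * cis \<theta> \<in>
          open_segment (c j + vtx m n (\<kappa> j) (e j)) (c j + vtx m n (\<kappa> j) (e j + 1)) \<and>
        Im (cnj (bm_vec m n (\<kappa> j) (e j)) * cis \<theta>) < 0 \<and>
        crosses m n (w j) (\<kappa> j) (e j) (\<kappa> (j + 1)) (f (j + 1)) \<and>
        c (j + 1) + vtx m n (\<kappa> (j + 1)) (f (j + 1) + 1) = c j + vtx m n (\<kappa> j) (e j)" for j
  proof -
    define y where "y = x j + of_real (\<tau> (j + 1) - \<tau> j) * cis \<theta>"
    have t': "\<tau> j \<le> \<tau> (j + 1)" "y \<in> side m n (\<kappa> j) (e j)"
        "Im (cnj (bm_vec m n (\<kappa> j) (e j)) * cis \<theta>) < 0"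
        "crosses m n (w j) (\<kappa> j) (e j) (\<kappa> (j + 1)) (f (j + 1))"
        "x (j + 1) = y - corner m n (\<kappa> j) (e j) + corner m n (\<kappa> (j + 1)) (f (j + 1) + 1)"
      using t unfolding linear_trajectory_def Let_def y_def by blast+
    note b = crosses_bounds[OF t'(4)]
    have co: "corner m n (\<kappa> j) (e j) = vtx m n (\<kappa> j) (e j) - vtx m n (\<kappa> j) 0"
      "corner m n (\<kappa> j) (e j + 1) = vtx m n (\<kappa> j) (e j + 1) - vtx m n (\<kappa> j) 0"
      "corner m n (\<kappa> (j + 1)) (f (j + 1) + 1) = vtx m n (\<kappa> (j + 1)) (f (j + 1) + 1) - vtx m n (\<kappa> (j + 1)) 0"
      using b by (auto intro!: corner_vtx[OF n])
    let ?s = "of_real (\<tau> j) * cis \<theta> - x j"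
    have "?s + y \<in> open_segment (?s + corner m n (\<kappa> j) (e j)) (?s + corner m n (\<kappa> j) (e j + 1))"
      using t'(2) unfolding side_def by simp
    moreover have "?s + y = of_real (\<tau> (j + 1)) * cis \<theta>" by (simp add: y_def algebra_simps)
    moreover have "?s + corner m n (\<kappa> j) (e j) = c j + vtx m n (\<kappa> j) (e j)"
      "?s + corner m n (\<kappa> j) (e j + 1) = c j + vtx m n (\<kappa> j) (e j + 1)"
      unfolding co c_def by simp_all
    ultimately have "of_real (\<tau> (j + 1)) * cis \<theta> \<in>
          open_segment (c j + vtx m n (\<kappa> j) (e j)) (c j + vtx m n (\<kappa> j) (e j + 1))"
      by metis
    moreover have "c (j + 1) + vtx m n (\<kappa> (j + 1)) (f (j + 1) + 1) = c j + vtx m n (\<kappa> j) (e j)"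
      using t'(5) unfolding co by (simp add: c_def y_def algebra_simps)
    ultimately show ?thesis using t'(1,3,4) by (intro conjI)
  qed
  moreover have "filterlim \<tau> at_top at_top \<and> filterlim \<tau> at_bot at_bot"
    using t unfolding linear_trajectory_def by (rule conjunct2)
  ultimately have "developed m n (cis \<theta>) \<kappa> c \<tau> f e w"
    unfolding developed_def by (intro conjI allI) auto
  then show "\<exists>\<kappa> c \<tau> f e. developed m n (cis \<theta>) \<kappa> c \<tau> f e w" by blast
next
  assume "\<exists>\<kappa> c \<tau> f e. developed m n (cis \<theta>) \<kappa> c \<tau> f e w"
  then obtain \<kappa> c \<tau> f e where t: "developed m n (cis \<theta>) \<kappa> c \<tau> f e w" by blast
  define x where "x j = of_real (\<tau> j) * cis \<theta> - c j - vtx m n (\<kappa> j) 0" for j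
  have "let y = x j + of_real (\<tau> (j + 1) - \<tau> j) * cis \<theta> in
        \<tau> j \<le> \<tau> (j + 1) \<and>
        y \<in> side m n (\<kappa> j) (e j) \<and>
        Im (cnj (bm_vec m n (\<kappa> j) (e j)) * cis \<theta>) < 0 \<and>
        crosses m n (w j) (\<kappa> j) (e j) (\<kappa> (j + 1)) (f (j + 1)) \<and>
        x (j + 1) = y - corner m n (\<kappa> j) (e j) + corner m n (\<kappa> (j + 1)) (f (j + 1) + 1)" for j
  proof -
    note t' = developedD(1-5)[OF t, of j]
    note b = crosses_bounds[OF t'(4)]
    have co: "corner m n (\<kappa> j) (e j) = vtx m n (\<kappa> j) (e j) - vtx m n (\<kappa> j) 0"
      "corner m n (\<kappa> j) (e j + 1) = vtx m n (\<kappa> j) (e j + 1) - vtx m n (\<kappa> j) 0"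
      "corner m n (\<kappa> (j + 1)) (f (j + 1) + 1) = vtx m n (\<kappa> (j + 1)) (f (j + 1) + 1) - vtx m n (\<kappa> (j + 1)) 0"
      using b by (auto intro!: corner_vtx[OF n])
    define y where "y = x j + of_real (\<tau> (j + 1) - \<tau> j) * cis \<theta>"
    let ?s = "c j + vtx m n (\<kappa> j) 0"
    have y: "?s + y = of_real (\<tau> (j + 1)) * cis \<theta>" by (simp add: y_def x_def algebra_simps)
    have "?s + y \<in> open_segment (?s + corner m n (\<kappa> j) (e j)) (?s + corner m n (\<kappa> j) (e j + 1))"
      using t'(2) unfolding y co by simp
    then have "y \<in> side m n (\<kappa> j) (e j)" unfolding side_def by (simp only: open_segment_translation_eq)
    moreover have "x (j + 1) = y - corner m n (\<kappa> j) (e j) + corner m n (\<kappa> (j + 1)) (f (j + 1) + 1)"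
      using t'(5) unfolding co by (simp add: x_def y_def algebra_simps)
    ultimately show ?thesis using t'(1,3,4) unfolding Let_def y_def by (intro conjI)
  qed
  then have "linear_trajectory m n \<theta> \<kappa> x \<tau> f e w"
    using developedD(6,7)[OF t] unfolding linear_trajectory_def by (intro conjI allI)
  then show "cutting_sequence m n \<theta> w" unfolding cutting_sequence_def by blast
qed

text \<open>\<open>developed\<close> matches one pair of ends of the glued sides; the other pair
  follows because their vectors are opposite.\<close>

lemma developed_glue_end:
  assumes "n \<ge> 2" "developed m n d \<kappa> c \<tau> f e w"
  shows "c (j + 1) + vtx m n (\<kappa> (j + 1)) (f (j + 1)) = c j + vtx m n (\<kappa> j) (e j + 1)"
proof -
  have b: "bm_vec m n (\<kappa> (j + 1)) (f (j + 1)) = - bm_vec m n (\<kappa> j) (e j)"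
    by (rule crosses_bm_vec[OF developedD(4)[OF assms(2)]])
  have "c (j + 1) + vtx m n (\<kappa> (j + 1)) (f (j + 1))
      = c (j + 1) + vtx m n (\<kappa> (j + 1)) (f (j + 1) + 1) + bm_vec m n (\<kappa> j) (e j)"
    unfolding vtx_add1[OF assms(1), of m "\<kappa> (j + 1)"] b by simp
  also have "\<dots> = c j + vtx m n (\<kappa> j) (e j + 1)"
    unfolding developedD(5)[OF assms(2)] vtx_add1[OF assms(1), of m "\<kappa> j"] by simp
  finally show ?thesis .
qed

lemma filterlim_minus_reflect:
  fixes \<tau> :: "int \<Rightarrow> real"
  assumes "filterlim \<tau> at_top at_top" "filterlim \<tau> at_bot at_bot"
  shows "filterlim (\<lambda>j. - \<tau> (a - j)) at_top at_top" "filterlim (\<lambda>j. - \<tau> (a - j)) at_bot at_bot"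
proof -
  have 1: "filterlim (\<lambda>j. a - j) at_bot (at_top :: int filter)"
    unfolding filterlim_at_bot eventually_at_top_linorder
    by (rule allI, rule_tac x = "a - Z" in exI) auto
  have 2: "filterlim (\<lambda>j. a - j) at_top (at_bot :: int filter)"
    unfolding filterlim_at_top eventually_at_bot_linorder
    by (rule allI, rule_tac x = "a - Z" in exI) auto
  show "filterlim (\<lambda>j. - \<tau> (a - j)) at_top at_top"
    using filterlim_compose[OF assms(2) 1] by (simp add: filterlim_uminus_at_top)
  show "filterlim (\<lambda>j. - \<tau> (a - j)) at_bot at_bot"
    using filterlim_compose[OF assms(1) 2] by (simp add: filterlim_uminus_at_bot)
qed

text \<open>Crossing j separates polygons j and j + 1 and happens at time
  \<open>\<tau> (j + 1)\<close>. Reversed crossing j is to be the old crossing -j, so polygon j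
  becomes polygon 1 - j and time j becomes time 2 - j. Entry and exit sides change roles.\<close>

lemma developed_reverse:
  assumes n: "n \<ge> 2" and t: "developed m n d \<kappa> c \<tau> f e w"
  shows "developed m n (- d) (\<lambda>j. \<kappa> (1 - j)) (\<lambda>j. c (1 - j)) (\<lambda>j. - \<tau> (2 - j))
    (\<lambda>j. e (1 - j)) (\<lambda>j. f (1 - j)) (\<lambda>j. w (- j))"
proof -
  have "- \<tau> (2 - j) \<le> - \<tau> (2 - (j + 1)) \<and>
     of_real (- \<tau> (2 - (j + 1))) * - d \<in>
          open_segment (c (1 - j) + vtx m n (\<kappa> (1 - j)) (f (1 - j))) (c (1 - j) + vtx m n (\<kappa> (1 - j)) (f (1 - j) + 1)) \<and>
        Im (cnj (bm_vec m n (\<kappa> (1 - j)) (f (1 - j))) * - d) < 0 \<and>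
        crosses m n (w (- j)) (\<kappa> (1 - j)) (f (1 - j)) (\<kappa> (1 - (j + 1))) (e (1 - (j + 1))) \<and>
        c (1 - (j + 1)) + vtx m n (\<kappa> (1 - (j + 1))) (e (1 - (j + 1)) + 1) = c (1 - j) + vtx m n (\<kappa> (1 - j)) (f (1 - j))" for j
  proof -
    have j: "1 - (j + 1) = - j" "1 - j = - j + 1" "2 - (j + 1) = - j + 1" "2 - j = (- j + 1) + 1" by simp_all
    note t' = developedD(1-5)[OF t, of "- j"] and g = developed_glue_end[OF n t, of "- j"]
    show ?thesis
      unfolding j
      using t' g developedD(1)[OF t, of "- j + 1"] crosses_bm_vec[OF t'(4)]
      by (simp only: crosses_sym[of _ _ _ _ _ "\<kappa> (- j)"]) (simp add: open_segment_commute)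
  qed
  then show ?thesis
    using filterlim_minus_reflect[OF developedD(6,7)[OF t], of 2] unfolding developed_def
    by (intro conjI allI) auto
qed

section \<open>Trajectories with direction in the first sector\<close>

text \<open>The cross product of d and w, positive to the left of the line spanned by d. Its sign
  tells on which side of the developed trajectory a corner lies.\<close>

definition height :: "complex \<Rightarrow> complex \<Rightarrow> real" where
  "height d w = Im (cnj d * w)"

lemma height_linear [simp]:
  "height d (w + w') = height d w + height d w'" "height d (w - w') = height d w - height d w'"
  "height d (- w) = - height d w" "height d (of_real t * w) = t * height d w" "height d 0 = 0"
  "height d d = 0"
  by (simp_all add: height_def algebra_simps)

lemma height_swap: "Im (cnj w * d) = - height d w"
  by (simp add: height_def)

lemma height_coords: "height d w * sin (pi / of_nat n) = xc n d * Im w - Im d * xc n w"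
  unfolding height_def by (rule cross_xc_Im)

text \<open>\<open>in_cone n d\<close>: the direction of \<open>d\<close> lies in the first sector.\<close>

definition in_cone :: "nat \<Rightarrow> complex \<Rightarrow> bool" where
  "in_cone n d \<longleftrightarrow> 0 \<le> xc n d \<and> 0 \<le> Im d"

text \<open>A nonzero such w has its direction between pi/n and pi, hence counterclockwise from
  every d of the first sector by at most a half turn.\<close>

lemma height_nonneg:
  assumes "n \<ge> 2" "in_cone n d" "0 \<le> Im w" "xc n w \<le> 0"
  shows "0 \<le> height d w"
proof -
  have "0 \<le> xc n d * Im w" "Im d * xc n w \<le> 0"
    using assms(2-4) by (auto simp: in_cone_def intro: mult_nonneg_nonneg mult_nonneg_nonpos)
  then have "0 \<le> xc n d * Im w - Im d * xc n w" by simp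
  then show ?thesis
    unfolding height_coords[symmetric] using sin_pi_over_pos[OF assms(1)] by (simp add: zero_le_mult_iff)
qed

lemma height_nonpos:
  assumes "n \<ge> 2" "in_cone n d" "Im w \<le> 0" "0 \<le> xc n w"
  shows "height d w \<le> 0"
  using height_nonneg[OF assms(1,2), of "- w"] assms(3,4) by simp

lemma height_right_side_nonneg:
  assumes "n \<ge> 2" "in_cone n d" "k < m" "1 \<le> e" "e \<le> int n"
  shows "0 \<le> height d (bm_vec m n k e)"
  using assms slen_nonneg[OF assms(3), of n e] sn_nonneg[of e n] sn_nonneg[of "e - 1" n]
  by (intro height_nonneg) (auto simp: Im_bm_vec xc_bm_vec)

lemma height_vtx_mono:
  assumes "n \<ge> 2" "in_cone n d" "k < m" "1 \<le> e" "e \<le> e'" "e' \<le> int n + 1"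
  shows "height d (vtx m n k e) \<le> height d (vtx m n k e')"
  using assms(5,6)
proof (induction e' rule: int_ge_induct)
  case (step i)
  then show ?case
    using height_right_side_nonneg[OF assms(1-3), of i] assms(4) by (simp add: vtx_add1[OF assms(1)])
qed simp

text \<open>The exit side, traversed counterclockwise, passes from the right of the trajectory to
  its left: \<open>near_end\<close> is the end on the right and \<open>far_end\<close> the end on
  the left (see \<open>developed_heights\<close>).\<close>

definition near_end :: "nat \<Rightarrow> nat \<Rightarrow> (int \<Rightarrow> nat) \<Rightarrow> (int \<Rightarrow> complex) \<Rightarrow> (int \<Rightarrow> int) \<Rightarrow> int \<Rightarrow> complex" where
  "near_end m n \<kappa> c e j = c j + vtx m n (\<kappa> j) (e j)"

definition far_end :: "nat \<Rightarrow> nat \<Rightarrow> (int \<Rightarrow> nat) \<Rightarrow> (int \<Rightarrow> complex) \<Rightarrow> (int \<Rightarrow> int) \<Rightarrow> int \<Rightarrow> complex" where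
  "far_end m n \<kappa> c e j = c j + vtx m n (\<kappa> j) (e j + 1)"

lemma far_minus_near: "n \<ge> 2 \<Longrightarrow> far_end m n \<kappa> c e j - near_end m n \<kappa> c e j = bm_vec m n (\<kappa> j) (e j)"
  by (simp add: far_end_def near_end_def vtx_add1)

lemma developed_ends:
  assumes n: "n \<ge> 2" and t: "developed m n d \<kappa> c \<tau> f e w"
  obtains u where "0 < u" "u < 1"
    "of_real (\<tau> (j + 1)) * d = near_end m n \<kappa> c e j + of_real u * bm_vec m n (\<kappa> j) (e j)"
    "of_real (\<tau> (j + 1)) * d = far_end m n \<kappa> c e j - of_real (1 - u) * bm_vec m n (\<kappa> j) (e j)"
proof -
  from developedD(2)[OF t, of j, folded near_end_def far_end_def] obtain u where u: "0 < u" "u < 1"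
    "of_real (\<tau> (j + 1)) * d = (1 - u) *\<^sub>R near_end m n \<kappa> c e j + u *\<^sub>R far_end m n \<kappa> c e j"
    by (auto simp: in_segment)
  have "far_end m n \<kappa> c e j = near_end m n \<kappa> c e j + bm_vec m n (\<kappa> j) (e j)"
    using far_minus_near[OF n, of m \<kappa> c e j] by (simp add: algebra_simps)
  then show ?thesis using u by (intro that[of u]) (auto simp: scaleR_conv_of_real algebra_simps)
qed

lemma developed_heights:
  assumes n: "n \<ge> 2" and t: "developed m n d \<kappa> c \<tau> f e w"
  shows "height d (near_end m n \<kappa> c e j) < 0" "0 < height d (far_end m n \<kappa> c e j)"
proof -
  have pos: "0 < height d (bm_vec m n (\<kappa> j) (e j))"
    using developedD(3)[OF t, of j, unfolded height_swap] by simp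
  obtain u where u: "0 < u" "u < 1"
    and e1: "of_real (\<tau> (j + 1)) * d = near_end m n \<kappa> c e j + of_real u * bm_vec m n (\<kappa> j) (e j)"
    and e2: "of_real (\<tau> (j + 1)) * d = far_end m n \<kappa> c e j - of_real (1 - u) * bm_vec m n (\<kappa> j) (e j)"
    by (rule developed_ends[OF n t])
  from arg_cong[OF e1, of "height d"] show "height d (near_end m n \<kappa> c e j) < 0"
    using mult_pos_pos[OF u(1) pos] by simp
  from arg_cong[OF e2, of "height d"] show "0 < height d (far_end m n \<kappa> c e j)"
    using mult_pos_pos[of "1 - u", OF _ pos] u by (simp del: of_real_diff)
qed

text \<open>\<open>on_grid\<close>: the trajectory crosses the edge \<open>w j\<close>, at \<open>(r j, q j)\<close>, in the sense in which the
  directions of the first sector cross it.\<close>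

definition on_grid ::
  "nat \<Rightarrow> nat \<Rightarrow> (int \<Rightarrow> nat) \<Rightarrow> (int \<Rightarrow> int) \<Rightarrow> (int \<Rightarrow> int) \<Rightarrow> (int \<Rightarrow> nat) \<Rightarrow> (int \<Rightarrow> nat) \<Rightarrow> (int \<Rightarrow> nat) \<Rightarrow> bool" where
  "on_grid m n \<kappa> f e w r q \<longleftrightarrow>
    (\<forall>j. 1 \<le> r j \<and> r j < m \<and> 1 \<le> q j \<and> q j \<le> n \<and> w j = vertex n (r j) (q j) \<and>
      \<kappa> j = poly_before (r j) (q j) \<and> e j = side_index n (r j) (q j) \<and>
      \<kappa> (j + 1) = poly_after (r j) (q j) \<and> f (j + 1) = (side_index n (r j) (q j) + int n) mod (2 * int n))"

lemma on_gridD: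
  assumes "on_grid m n \<kappa> f e w r q"
  shows "1 \<le> r j" "r j < m" "1 \<le> q j" "q j \<le> n" "w j = vertex n (r j) (q j)"
    "\<kappa> j = poly_before (r j) (q j)" "e j = side_index n (r j) (q j)"
    "\<kappa> (j + 1) = poly_after (r j) (q j)" "f (j + 1) = (side_index n (r j) (q j) + int n) mod (2 * int n)"
    "1 \<le> e j" "e j \<le> int n"
  using assms[unfolded on_grid_def, rule_format, of j] side_index_bounds[of "q j" n "r j"] by auto

text \<open>In the opposite sense, the side entered would have its index in 1..n and so nonnegative
  height; the side left, with the opposite vector, could then not be an exit.\<close>

lemma first_sector_on_grid:
  assumes n: "n \<ge> 2" and t: "developed m n d \<kappa> c \<tau> f e w" and d: "in_cone n d"
  obtains r q where "on_grid m n \<kappa> f e w r q"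
proof -
  have "\<exists>r q. 1 \<le> r \<and> r < m \<and> 1 \<le> q \<and> q \<le> n \<and> w j = vertex n r q \<and>
      \<kappa> j = poly_before r q \<and> e j = side_index n r q \<and>
      \<kappa> (j + 1) = poly_after r q \<and> f (j + 1) = (side_index n r q + int n) mod (2 * int n)" for j
  proof -
    note x = developedD(4)[OF t, of j]
    from x obtain r q where rq: "1 \<le> r" "r < m" "1 \<le> q" "q \<le> n" "w j = vertex n r q" and
     "(\<kappa> j = poly_before r q \<and> e j = side_index n r q \<and>
      \<kappa> (j + 1) = poly_after r q \<and> f (j + 1) = (side_index n r q + int n) mod (2 * int n)) \<or>
      (\<kappa> (j + 1) = poly_before r q \<and> f (j + 1) = side_index n r q \<and>
      \<kappa> j = poly_after r q \<and> e j = (side_index n r q + int n) mod (2 * int n))"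
      by (rule crosses_cases)
    then consider "\<kappa> j = poly_before r q \<and> e j = side_index n r q \<and>
      \<kappa> (j + 1) = poly_after r q \<and> f (j + 1) = (side_index n r q + int n) mod (2 * int n)"
      | "f (j + 1) = side_index n r q" by blast
    then show ?thesis
    proof cases
      case 1
      then show ?thesis using rq by blast
    next
      case 2
      have "0 \<le> height d (bm_vec m n (\<kappa> (j + 1)) (f (j + 1)))"
        using side_index_bounds[OF rq(3,4), of r] crosses_bounds[OF x] unfolding 2
        by (intro height_right_side_nonneg[OF n d]) auto
      then have False
        using developedD(3)[OF t, of j, unfolded height_swap] crosses_bm_vec[OF x] by simp
      then show ?thesis ..
    qed
  qed
  then have "\<exists>r q. \<forall>j. 1 \<le> r j \<and> r j < m \<and> 1 \<le> q j \<and> q j \<le> n \<and> w j = vertex n (r j) (q j) \<and>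
      \<kappa> j = poly_before (r j) (q j) \<and> e j = side_index n (r j) (q j) \<and>
      \<kappa> (j + 1) = poly_after (r j) (q j) \<and> f (j + 1) = (side_index n (r j) (q j) + int n) mod (2 * int n)"
    by metis
  then show ?thesis using that unfolding on_grid_def by blast
qed

text \<open>The side entered, of index \<open>e j + n\<close>, is written as -i. The quadrilateral
  behind it then has the corners -i, 1 - i, i + 1, i + 2; its sides are the edges -i and i + 1 and
  the chords i - 1 and i.\<close>

lemma on_grid_entry:
  assumes n: "n \<ge> 2" and t: "developed m n d \<kappa> c \<tau> f e w" and g: "on_grid m n \<kappa> f e w r q"
  defines "i \<equiv> \<lambda>j. int n - e j"
  shows "near_end m n \<kappa> c e j = c (j + 1) + vtx m n (\<kappa> (j + 1)) (1 - i j)"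
    and "far_end m n \<kappa> c e j = c (j + 1) + vtx m n (\<kappa> (j + 1)) (- i j)"
proof -
  have f: "f (j + 1) = (- i j + 2 * int n) mod (2 * int n)"
    using on_gridD(7,9)[OF g, of j] by (simp add: i_def algebra_simps)
  then have fm: "f (j + 1) = (- i j) mod (2 * int n)" by simp
  have "vtx m n (\<kappa> (j + 1)) (f (j + 1)) = vtx m n (\<kappa> (j + 1)) (- i j)"
    unfolding fm using n by (intro vtx_mod) simp
  moreover have "vtx m n (\<kappa> (j + 1)) (f (j + 1) + 1) = vtx m n (\<kappa> (j + 1)) (1 - i j)"
    unfolding fm using n by (intro vtx_cong) (simp_all add: mod_add_left_eq)
  ultimately show "near_end m n \<kappa> c e j = c (j + 1) + vtx m n (\<kappa> (j + 1)) (1 - i j)"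
    "far_end m n \<kappa> c e j = c (j + 1) + vtx m n (\<kappa> (j + 1)) (- i j)"
    using developedD(5)[OF t, of j] developed_glue_end[OF n t, of j] by (simp_all add: near_end_def far_end_def)
qed

text \<open>The vector from corner -i to corner i + 3 is the chord i plus side i + 2; its first
  coordinate cancels, so it is a nonnegative multiple of the direction pi/n. As corner -i is on the
  left, so are corner i + 3 and all later ones up to n + 1, and no exit lies beyond side i + 2.
  Likewise the vector from corner 1 - i to corner i is a nonnegative multiple of the direction 0,
  which keeps corners 1, ..., i on the right and excludes exits before side i.\<close>

lemma first_sector_exit:
  assumes n: "n \<ge> 2" and t: "developed m n d \<kappa> c \<tau> f e w" and d: "in_cone n d"
    and g: "on_grid m n \<kappa> f e w r q"
  shows "e (j + 1) + e j - int n \<in> {0, 1, 2}"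
proof -
  define i where "i = int n - e j"
  define k where "k = \<kappa> (j + 1)"
  have k: "k < m" using crosses_bounds(2)[OF developedD(4)[OF t, of j]] by (simp add: k_def)
  have i: "0 \<le> i" "i < int n" using on_gridD(10,11)[OF g, of j] by (auto simp: i_def)
  have e: "1 \<le> e (j + 1)" "e (j + 1) \<le> int n" using on_gridD(10,11)[OF g, of "j + 1"] by auto
  note h = developed_heights[OF n t]
  define H where "H s = height d (c (j + 1) + vtx m n k s)" for s
  have h1: "H (1 - i) < 0" "0 < H (- i)"
    using h[of j] unfolding on_grid_entry[OF n t g] H_def i_def k_def by auto
  have h2: "H (e (j + 1)) < 0" "0 < H (e (j + 1) + 1)"
    using h[of "j + 1"] unfolding near_end_def far_end_def H_def k_def by auto
  have mono: "H s \<le> H s'" if "1 \<le> s" "s \<le> s'" "s' \<le> int n + 1" for s s'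
    using height_vtx_mono[OF n d k that] by (simp add: H_def)
  have "e (j + 1) \<le> i + 2"
  proof (rule ccontr)
    assume "\<not> e (j + 1) \<le> i + 2"
    then have le: "i + 3 \<le> e (j + 1)" by simp
    have v: "vtx m n k (i + 3) - vtx m n k (- i) = chord m n k i + bm_vec m n k (i + 2)"
      using vtx_add1[OF n, of m k "i + 2"] by (simp add: chord_def add.commute)
    have "0 \<le> height d (vtx m n k (i + 3) - vtx m n k (- i))"
      unfolding v
    proof (rule height_nonneg[OF n d])
      have "xc n (bm_vec m n k (i + 2)) = - (slen m n k i * sn n (i + 1))"
        using n by (simp add: xc_bm_vec add.commute)
      then show "xc n (chord m n k i + bm_vec m n k (i + 2)) \<le> 0"
        by (simp add: xc_chord[OF n])
      have "0 \<le> sn n (i + 1)" "0 \<le> sn n (i + 2)" using i le e by (auto intro!: sn_nonneg)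
      then show "0 \<le> Im (chord m n k i + bm_vec m n k (i + 2))"
        by (simp add: Im_chord[OF n] Im_bm_vec slen_nonneg[OF k])
    qed
    then have "H (- i) \<le> H (i + 3)" by (simp add: H_def)
    also have "\<dots> \<le> H (e (j + 1))" using le e i by (intro mono) auto
    finally show False using h1 h2 by simp
  qed
  moreover have "i \<le> e (j + 1)"
  proof (rule ccontr)
    assume "\<not> i \<le> e (j + 1)"
    then have le: "e (j + 1) + 1 \<le> i" by simp
    have v: "vtx m n k i - vtx m n k (1 - i) = chord m n k (i - 1) - bm_vec m n k i"
      using vtx_add1[OF n, of m k i] by (simp add: chord_def add.commute)
    have s: "0 \<le> sn n i" "0 \<le> sn n (i - 1)" using i le e by (auto intro!: sn_nonneg)
    have "height d (vtx m n k i - vtx m n k (1 - i)) \<le> 0"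
      unfolding v using n s
      by (intro height_nonpos[OF n d])
        (simp_all add: Im_chord[OF n] Im_bm_vec xc_chord[OF n] xc_bm_vec slen_nonneg[OF k])
    then have "H i \<le> H (1 - i)" by (simp add: H_def)
    moreover have "H (e (j + 1) + 1) \<le> H i" using le e i by (intro mono) auto
    ultimately show False using h1 h2 by simp
  qed
  ultimately show ?thesis unfolding i_def by auto
qed

text \<open>The three possible exits are the two horizontal arrows and the vertical one.\<close>

lemma side_index_step:
  assumes "1 \<le> r" "1 \<le> q" "q \<le> n" "1 \<le> r'" "1 \<le> q'" "q' \<le> n"
    and "poly_before r' q' = poly_after r q"
  shows "side_index n r' q' + side_index n r q - int n = 0 \<longleftrightarrow>
      r' = r \<and> (if odd (r + q) then q = q' + 1 else q' = q + 1)" (is ?D)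
    and "side_index n r' q' + side_index n r q - int n = 1 \<longleftrightarrow>
      q' = q \<and> (if odd q then r' = r + 1 else r = r' + 1)" (is ?V)
    and "side_index n r' q' + side_index n r q - int n = 2 \<longleftrightarrow>
      r' = r \<and> (if odd (r + q) then q' = q + 1 else q = q' + 1)" (is ?R)
proof -
  consider (oo) "odd q" "odd q'" "r' = r + 1" | (oe) "odd q" "even q'" "r' = r"
    | (eo) "even q" "odd q'" "r' = r" | (ee) "even q" "even q'" "r = r' + 1"
    using assms unfolding poly_before_def poly_after_def by (cases "odd q"; cases "odd q'") auto
  then have "?D \<and> ?V \<and> ?R"
  proof cases
    case oo
    then show ?thesis unfolding side_index_def by (cases "odd r"; simp; presburger)
  next
    case oe
    then show ?thesis unfolding side_index_def by (cases "odd r"; simp; presburger)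
  next
    case eo
    then show ?thesis unfolding side_index_def by (cases "odd r"; simp; presburger)
  next
    case ee
    then show ?thesis unfolding side_index_def by (cases "odd r'"; simp; presburger)
  qed
  then show ?D ?V ?R by blast+
qed

text \<open>These are the arrows of the explicit first diagram. \<open>transition\<close> is defined
  by trajectories; \<open>transition_0_grid_step\<close> links the two.\<close>

definition grid_step :: "nat \<Rightarrow> nat \<Rightarrow> nat \<Rightarrow> nat \<Rightarrow> bool" where
  "grid_step r q r' q' \<longleftrightarrow>
     r' = r \<and> (q' = q + 1 \<or> q = q' + 1) \<or> q' = q \<and> (if odd q then r' = r + 1 else r = r' + 1)"

lemma grid_step_poly: "grid_step r q r' q' \<Longrightarrow> 1 \<le> r \<Longrightarrow> 1 \<le> r' \<Longrightarrow> poly_before r' q' = poly_after r q"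
  unfolding grid_step_def poly_before_def poly_after_def by (auto split: if_splits)

lemma grid_step_iff:
  assumes "1 \<le> r" "1 \<le> q" "q \<le> n" "1 \<le> r'" "1 \<le> q'" "q' \<le> n"
  shows "grid_step r q r' q' \<longleftrightarrow> poly_before r' q' = poly_after r q \<and>
    side_index n r' q' + side_index n r q - int n \<in> {0, 1, 2}"
proof (cases "poly_before r' q' = poly_after r q")
  case True
  then show ?thesis
    unfolding insert_iff side_index_step[OF assms True] grid_step_def by (cases "odd (r + q)") auto
next
  case False
  then show ?thesis using grid_step_poly[of r q r' q'] assms by auto
qed

lemma first_sector_grid_step:
  assumes n: "n \<ge> 2" and t: "developed m n d \<kappa> c \<tau> f e w" and d: "in_cone n d"
    and g: "on_grid m n \<kappa> f e w r q"
  shows "grid_step (r j) (q j) (r (j + 1)) (q (j + 1))"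
  using first_sector_exit[OF n t d g, of j] on_gridD(1-8)[OF g, of j] on_gridD(1-8)[OF g, of "j + 1"]
  by (subst grid_step_iff[of _ _ n]) auto

text \<open>The value 1 is the exit through the opposite edge of the quadrilateral, both of whose
  chords then join ends of the two edges. For 0 and 2 the trajectory cuts across the chord i - 1 or
  i, which joins the right end of one edge to the left end of the other.\<close>

lemma on_grid_moves:
  assumes n: "n \<ge> 2" and t: "developed m n d \<kappa> c \<tau> f e w" and g: "on_grid m n \<kappa> f e w r q"
  defines "k \<equiv> \<lambda>j. \<kappa> (j + 1)" and "i \<equiv> \<lambda>j. int n - e j"
    and "A \<equiv> near_end m n \<kappa> c e" and "B \<equiv> far_end m n \<kappa> c e"
  shows "e (j + 1) + e j - int n = 0 \<Longrightarrow> B (j + 1) = A j + chord m n (k j) (i j - 1)"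
    and "e (j + 1) + e j - int n = 1 \<Longrightarrow> A (j + 1) = A j + chord m n (k j) (i j - 1)"
    and "e (j + 1) + e j - int n = 1 \<Longrightarrow> B (j + 1) = B j + chord m n (k j) (i j)"
    and "e (j + 1) + e j - int n = 2 \<Longrightarrow> A (j + 1) = B j + chord m n (k j) (i j)"
proof -
  have en: "A j = c (j + 1) + vtx m n (k j) (1 - i j)" "B j = c (j + 1) + vtx m n (k j) (- i j)"
    unfolding A_def B_def k_def i_def by (rule on_grid_entry[OF n t g])+
  have ex: "A (j + 1) = c (j + 1) + vtx m n (k j) (e (j + 1))"
    "B (j + 1) = c (j + 1) + vtx m n (k j) (e (j + 1) + 1)"
    by (simp_all add: A_def B_def near_end_def far_end_def k_def)
  have ch: "chord m n (k j) (i j - 1) = vtx m n (k j) (i j + 1) - vtx m n (k j) (1 - i j)"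
    "chord m n (k j) (i j) = vtx m n (k j) (i j + 2) - vtx m n (k j) (- i j)"
    by (simp_all add: chord_def add.commute)
  show "B (j + 1) = A j + chord m n (k j) (i j - 1)" if "e (j + 1) + e j - int n = 0"
  proof -
    have "e (j + 1) = i j" using that by (simp add: i_def)
    then show ?thesis by (simp add: ex(2) en(1) ch(1))
  qed
  show "A (j + 1) = A j + chord m n (k j) (i j - 1)" "B (j + 1) = B j + chord m n (k j) (i j)"
    if "e (j + 1) + e j - int n = 1"
  proof -
    have *: "e (j + 1) = i j + 1" using that by (simp add: i_def)
    show "A (j + 1) = A j + chord m n (k j) (i j - 1)" "B (j + 1) = B j + chord m n (k j) (i j)"
      unfolding ex en ch * by (simp_all add: add.assoc)
  qed
  show "A (j + 1) = B j + chord m n (k j) (i j)" if "e (j + 1) + e j - int n = 2"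
  proof -
    have *: "e (j + 1) = i j + 2" using that by (simp add: i_def)
    show ?thesis unfolding ex en ch * by simp
  qed
qed

section \<open>Duality\<close>

text \<open>Up to \<open>shear_flip\<close>, the chords of \<open>S\<^bsub>m,n\<^esub>\<close> are the sides of \<open>S\<^bsub>n,m\<^esub>\<close> and conversely: the edge at
  \<open>(r, q)\<close> is the chord \<open>dual_index m r q - 1\<close> of the polygon \<open>P(q - 1)\<close> of \<open>S\<^bsub>n,m\<^esub>\<close>.\<close>

definition dual_index :: "nat \<Rightarrow> nat \<Rightarrow> nat \<Rightarrow> int" where
  "dual_index m r q = (if odd q then int r else int m - int r)"

lemma dual_index_bounds: "1 \<le> r \<Longrightarrow> r < m \<Longrightarrow> 1 \<le> dual_index m r q \<and> dual_index m r q < int m"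
  by (auto simp: dual_index_def)

text \<open>The entered side is the edge at (r, q), of length \<open>sn m r\<close>; sides of the
  other parity have a neighbouring sine as length. Replacing r by m - r in even columns makes this
  neighbour \<open>dual_index + 1\<close> in all cases.\<close>

lemma slen_after:
  assumes "1 \<le> r" "r < m" "1 \<le> q" "q \<le> n"
  defines "k \<equiv> poly_after r q" and "i \<equiv> int n - side_index n r q"
  shows "slen m n k i = sn m (dual_index m r q)"
    and "slen m n k (i + 1) = sn m (dual_index m r q + 1)"
proof -
  have right: "right_side n k i \<longleftrightarrow> even q"
    using assms(1) unfolding k_def i_def right_side_def poly_after_def side_index_def
    by (cases "odd q"; cases "odd r") auto
  have m: "m > 0" using assms by simp
  have k: "int k = (if odd q then int r else int r - 1)" using assms(1) by (simp add: k_def poly_after_def)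
  have s: "sn m (int m - int r) = sn m (int r)" "sn m (int m - int r + 1) = sn m (int r - 1)"
    using sn_supplement[OF m, of "int r"] sn_supplement[OF m, of "int r - 1"] by (simp_all add: algebra_simps)
  show "slen m n k i = sn m (dual_index m r q)"
    unfolding slen_def right k dual_index_def by (cases "odd q") (simp_all add: s)
  show "slen m n k (i + 1) = sn m (dual_index m r q + 1)"
    unfolding slen_def right_side_Suc right k dual_index_def by (cases "odd q") (simp_all add: s)
qed

lemma slen_dual:
  assumes "1 \<le> r" "r < m" "1 \<le> q" "q \<le> n"
  shows "slen n m (q - 1) (dual_index m r q) = sn n (side_index n r q)"
    and "slen n m (q - 1) (dual_index m r q + 1) = sn n (side_index n r q - 1)"
proof -
  have right: "right_side m (q - 1) (dual_index m r q) \<longleftrightarrow> even (r + q)"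
    using assms(3) unfolding right_side_def dual_index_def by (cases "odd q"; cases "odd r") auto
  have n: "n > 0" using assms by simp
  have q: "int (q - 1) = int q - 1" using assms(3) by simp
  have s: "sn n (int n + 1 - int q) = sn n (int q - 1)" "sn n (int n - int q) = sn n (int q)"
    using sn_supplement[OF n, of "int q"] sn_supplement[OF n, of "int q - 1"] by (simp_all add: algebra_simps)
  show "slen n m (q - 1) (dual_index m r q) = sn n (side_index n r q)"
    unfolding slen_def right q side_index_def using s by (cases "even (r + q)") simp_all
  show "slen n m (q - 1) (dual_index m r q + 1) = sn n (side_index n r q - 1)"
    unfolding slen_def right_side_Suc right q side_index_def using s by (cases "even (r + q)") simp_all
qed

lemma slen_minus1: "slen m n k (e - 1) = slen m n k (e + 1)"
  by (rule slen_cong) simp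

text \<open>Both coordinates are compared: the sine over n is the common factor of the chord and the
  length of the dual side, the sine over m is the length in the one and the angle in the
  other.\<close>

lemma shear_flip_chord:
  assumes m: "m \<ge> 2" and n: "n \<ge> 2" and r: "1 \<le> r" "r < m" and q: "1 \<le> q" "q \<le> n"
  defines "k \<equiv> poly_after r q" and "i \<equiv> int n - side_index n r q" and "b \<equiv> dual_index m r q"
  shows "shear_flip m n (chord m n k (i - 1)) = - bm_vec n m (q - 1) (- b)"
    and "shear_flip m n (chord m n k i) = bm_vec n m (q - 1) (b + 1)"
    and "shear_flip m n (- bm_vec m n k (- i)) = chord n m (q - 1) (b - 1)"
proof -
  note l = slen_after[OF r q, folded k_def i_def b_def] slen_dual[OF r q, folded b_def]
  have mn: "m > 0" "n > 0" using m n by auto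
  have i: "sn n (side_index n r q) = sn n i" "sn n (side_index n r q - 1) = sn n (i + 1)"
    using sn_supplement[OF mn(2), of i] sn_supplement[OF mn(2), of "i + 1"] by (simp_all add: i_def algebra_simps)
  have sm: "sn n (- i - 1) = - sn n (i + 1)" "sn m (- b - 1) = - sn m (b + 1)"
    using sn_minus[of n "i + 1"] sn_minus[of m "b + 1"] by (simp_all only: minus_add_distrib diff_conv_add_uminus)
  note simps = Im_shear_flip[OF m] xc_shear_flip[OF m] Im_chord[OF n] xc_chord[OF n] Im_chord[OF m] xc_chord[OF m]
    Im_bm_vec xc_bm_vec[OF mn(1)] xc_bm_vec[OF mn(2)] l[unfolded One_nat_def] i slen_minus1 sm
  show "shear_flip m n (chord m n k (i - 1)) = - bm_vec n m (q - 1) (- b)"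
    by (rule xc_Im_eqI[OF m]) (simp_all add: simps)
  show "shear_flip m n (chord m n k i) = bm_vec n m (q - 1) (b + 1)"
    by (rule xc_Im_eqI[OF m]) (simp_all add: simps)
  show "shear_flip m n (- bm_vec m n k (- i)) = chord n m (q - 1) (b - 1)"
    by (rule xc_Im_eqI[OF m]) (simp_all add: simps)
qed

lemma dual_index_flip:
  "q' = q + 1 \<or> q = q' + 1 \<Longrightarrow> dual_index m r q' = int m - dual_index m r q"
  by (auto simp: dual_index_def)

text \<open>The chord common to the quadrilaterals of (r, q) and (r, q') lies inside
  P(\<open>poly_after r q\<close>). In the dual grid it is the edge in row \<open>min q q'\<close>
  and column \<open>poly_after r q + 1\<close>. The first case crosses it in the sense of the first
  sector of the dual surface, the second case against it.\<close>

lemma crosses_dual: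
  assumes r: "1 \<le> r" "r < m" and q: "1 \<le> q" "q \<le> n" "1 \<le> q'" "q' \<le> n"
  defines "l \<equiv> vertex m (min q q') (poly_after r q + 1)"
  shows "(if odd (r + q) then q' = q + 1 else q = q' + 1) \<Longrightarrow>
      crosses n m l (q - 1) ((dual_index m r q + 1) mod (2 * int m))
        (q' - 1) ((1 - dual_index m r q') mod (2 * int m))" (is "?R \<Longrightarrow> _")
    and "(if odd (r + q) then q = q' + 1 else q' = q + 1) \<Longrightarrow>
      crosses n m l (q - 1) ((- dual_index m r q) mod (2 * int m))
        (q' - 1) (dual_index m r q' mod (2 * int m))" (is "?D \<Longrightarrow> _")
proof -
  define \<rho> x where "\<rho> = min q q'" and "x = poly_after r q + 1"
  have l: "l = vertex m \<rho> x" by (simp add: l_def \<rho>_def x_def)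
  have x: "1 \<le> x" "x \<le> m" using r by (auto simp: x_def poly_after_def)
  note b = dual_index_bounds[OF r, of q] dual_index_bounds[OF r, of q']
  have per: "(s - int m) mod (2 * int m) = (s + int m) mod (2 * int m)" for s
  proof -
    have "s + int m = (s - int m) + 2 * int m" by simp
    then show ?thesis by (metis mod_add_self2)
  qed
  show "crosses n m l (q - 1) ((dual_index m r q + 1) mod (2 * int m))
        (q' - 1) ((1 - dual_index m r q') mod (2 * int m))" if R: ?R
  proof -
    have adj: "q' = q + 1 \<or> q = q' + 1" using R by (auto split: if_splits)
    have \<rho>: "1 \<le> \<rho>" "\<rho> < n" using adj q by (auto simp: \<rho>_def)
    have "side_index m \<rho> x = dual_index m r q + 1" "poly_before \<rho> x = q - 1" "poly_after \<rho> x = q' - 1"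
      using R r q unfolding side_index_def dual_index_def \<rho>_def x_def poly_after_def poly_before_def
      by (cases "odd r"; cases "odd q"; simp)+
    moreover have "(1 - dual_index m r q') mod (2 * int m) = (dual_index m r q + 1 + int m) mod (2 * int m)"
      using per[of "dual_index m r q + 1"] by (simp add: dual_index_flip[OF adj] algebra_simps)
    moreover have "(dual_index m r q + 1) mod (2 * int m) = dual_index m r q + 1"
      using b by (intro mod_pos_pos_trivial) auto
    ultimately show ?thesis
      using crosses_vertex[OF \<rho> x] by (simp add: l)
  qed
  show "crosses n m l (q - 1) ((- dual_index m r q) mod (2 * int m))
        (q' - 1) (dual_index m r q' mod (2 * int m))" if D: ?D
  proof -
    have adj: "q' = q + 1 \<or> q = q' + 1" using D by (auto split: if_splits)
    have \<rho>: "1 \<le> \<rho>" "\<rho> < n" using adj q by (auto simp: \<rho>_def)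
    have "side_index m \<rho> x = dual_index m r q'" "poly_before \<rho> x = q' - 1" "poly_after \<rho> x = q - 1"
      using D r q unfolding side_index_def dual_index_def \<rho>_def x_def poly_after_def poly_before_def
      by (cases "odd r"; cases "odd q"; simp)+
    moreover have "(- dual_index m r q) mod (2 * int m) = (dual_index m r q' + int m) mod (2 * int m)"
      using per[of "dual_index m r q'"] by (simp add: dual_index_flip[OF adj] algebra_simps)
    moreover have "dual_index m r q' mod (2 * int m) = dual_index m r q'"
      using b by (intro mod_pos_pos_trivial) auto
    ultimately show ?thesis
      using crosses_vertex[OF \<rho> x] unfolding crosses_sym[of n m l "q - 1"]
      by (simp add: l)
  qed
qed

text \<open>The four label formulas of the derivation diagram are one: the dual grid label of the
  chord that is crossed, as in \<open>crosses_dual\<close>.\<close>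

lemma arrow_label_iff:
  assumes "1 \<le> r" "r < m" "1 \<le> q" "q \<le> n" "1 \<le> r'" "r' < m" "1 \<le> q'" "q' \<le> n"
  shows "arrow_label m n (vertex n r q) (vertex n r' q') l \<longleftrightarrow>
    r' = r \<and> (q' = q + 1 \<or> q = q' + 1) \<and> l = vertex m (min q q') (poly_after r q + 1)" (is "?L \<longleftrightarrow> ?R")
proof
  have inj: "s = r \<and> c = q" if "vertex n r q = vertex n s c" "1 \<le> s" "1 \<le> c" "c \<le> n" for s c
    using vertex_inj[OF that(1)] that assms by auto
  have inj': "s = r' \<and> c = q'" if "vertex n r' q' = vertex n s c" "1 \<le> s" "1 \<le> c" "c \<le> n" for s c
    using vertex_inj[OF that(1)] that assms by auto
  assume ?L
  then show ?R
  proof cases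
    case (odd_left s c)
    then show ?thesis using inj[of s "c + 1"] inj'[of s c] by (auto simp: vertex_def poly_after_def)
  next
    case (odd_right s c)
    then show ?thesis using inj[of s "c"] inj'[of s "c + 1"] by (auto simp: vertex_def poly_after_def)
  next
    case (even_right s c)
    \<comment> \<open>Makes the truncated subtraction in the label harmless.\<close>
    then have "s \<le> c * m" by (metis One_nat_def le_trans less_imp_le mult_le_mono1 nat_mult_1)
    then show ?thesis using even_right inj[of s "c"] inj'[of s "c + 1"] by (auto simp: vertex_def poly_after_def)
  next
    case (even_left s c)
    then show ?thesis using inj[of s "c + 1"] inj'[of s "c"] by (auto simp: vertex_def poly_after_def)
  qed
next
  assume R: ?R
  then consider "q' = q + 1" "odd q" | "q' = q + 1" "even q" | "q = q' + 1" "odd q'" | "q = q' + 1" "even q'"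
    by auto
  then show ?L
  proof cases
    case 1
    then show ?thesis using R assms arrow_label.odd_right[of r m q n] by (simp add: vertex_def poly_after_def)
  next
    case 2
    have "r \<le> q * m" using assms by (metis le_trans less_imp_le mult_le_mono1 nat_mult_1)
    then show ?thesis using 2 R assms arrow_label.even_right[of r m q n]
      by (simp add: vertex_def poly_after_def Suc_diff_le)
  next
    case 3
    then show ?thesis using R assms arrow_label.odd_left[of r m q' n] by (simp add: vertex_def poly_after_def)
  next
    case 4
    then show ?thesis using R assms arrow_label.even_left[of r m q' n] by (simp add: vertex_def poly_after_def)
  qed
qed

section \<open>The derived sequence\<close>

lemma height_eq_0:
  assumes "height d w = 0" "d \<noteq> 0"
  obtains t where "w = of_real t * d"
proof -
  have "of_real (Re (cnj d * w)) = cnj d * w" using assms(1) by (simp add: height_def complex_eq_iff)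
  then have "w = of_real (Re (cnj d * w) / (cmod d)\<^sup>2) * d"
    using assms(2) complex_norm_square[of d] by (simp add: field_simps)
  then show ?thesis by (rule that)
qed

lemma height_shear_flip:
  assumes "m \<ge> 2"
  shows "height (shear_flip m n d) (shear_flip m n w) * sin (pi / of_nat m) = - (height d w * sin (pi / of_nat n))"
  unfolding height_def by (rule cross_shear_flip[OF assms])

lemma height_shear_flip_less:
  assumes "m \<ge> 2" "n \<ge> 2" "height d w < 0"
  shows "0 < height (shear_flip m n d) (shear_flip m n w)"
proof -
  have "height d w * sin (pi / of_nat n) < 0"
    using sin_pi_over_pos[OF assms(2)] assms(3) by (simp add: mult_neg_pos)
  then have "0 < height (shear_flip m n d) (shear_flip m n w) * sin (pi / of_nat m)"
    unfolding height_shear_flip[OF assms(1)] by simp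
  then show ?thesis using sin_pi_over_pos[OF assms(1)] by (simp add: zero_less_mult_iff)
qed

lemma shear_flip_open_segment:
  assumes "w \<in> open_segment a b" "m \<ge> 2" "n \<ge> 2"
  shows "shear_flip m n w \<in> open_segment (shear_flip m n a) (shear_flip m n b)"
proof -
  obtain u where u: "0 < u" "u < 1" "w = (1 - u) *\<^sub>R a + u *\<^sub>R b" and "a \<noteq> b"
    using assms(1) by (auto simp: in_segment)
  have "shear_flip m n a \<noteq> shear_flip m n b"
  proof
    assume "shear_flip m n a = shear_flip m n b"
    then have "a = b" using xc_Im_eqI[OF assms(3), of a b] Im_shear_flip[OF assms(2)] xc_shear_flip[OF assms(2)]
      by (metis neg_equal_iff_equal)
    then show False using \<open>a \<noteq> b\<close> by simp
  qed
  moreover have "shear_flip m n w = (1 - u) *\<^sub>R shear_flip m n a + u *\<^sub>R shear_flip m n b"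
    unfolding u scaleR_conv_of_real shear_flip_linear ..
  ultimately show ?thesis using u(1,2) by (auto simp: in_segment)
qed

text \<open>Along a horizontal arrow the trajectory crosses a chord, from its end \<open>a\<close> on the left of the
  direction to its end \<open>b\<close> on the right.\<close>

lemma chord_crossing:
  fixes j :: int
  assumes n: "n \<ge> 2" and t: "developed m n d \<kappa> c \<tau> f e w" and d: "in_cone n d" and g: "on_grid m n \<kappa> f e w r q"
  defines "A \<equiv> near_end m n \<kappa> c e" and "B \<equiv> far_end m n \<kappa> c e" and "\<delta> \<equiv> e (j + 1) + e j - int n"
  assumes \<delta>: "\<delta> = 0 \<or> \<delta> = 2"
  defines "a \<equiv> (if \<delta> = 2 then B j else B (j + 1))" and "b \<equiv> (if \<delta> = 2 then A (j + 1) else A j)"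
  shows "height d (b - a) < 0"
    and "\<exists>s. \<tau> (j + 1) \<le> s \<and> s \<le> \<tau> (j + 2) \<and> of_real s * d \<in> open_segment a b"
proof -
  note h = developed_heights[OF n t, folded A_def B_def]
  have ha: "0 < height d a" and hb: "height d b < 0" using h by (auto simp: a_def b_def)
  then show hab: "height d (b - a) < 0" by simp
  then have ab: "a \<noteq> b" by auto
  have d0: "d \<noteq> 0" using ha by (auto simp: height_def)
  \<comment> \<open>The parameter at which the height, affine along the chord, vanishes.\<close>
  define u where "u = height d a / (height d a - height d b)"
  have u: "0 < u" "u < 1" using ha hb by (auto simp: u_def field_simps)
  have "height d (a + of_real u * (b - a)) = 0"
  proof -
    have "u * (height d a - height d b) = height d a" using ha hb by (simp add: u_def)
    moreover have "height d (a + of_real u * (b - a)) = height d a + u * (height d b - height d a)"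
      by (simp only: height_linear)
    ultimately show ?thesis by (simp add: algebra_simps)
  qed
  from height_eq_0[OF this d0] obtain s where s: "a + of_real u * (b - a) = of_real s * d" .
  have "a + of_real u * (b - a) = (1 - u) *\<^sub>R a + u *\<^sub>R b"
    by (simp add: scaleR_conv_of_real algebra_simps)
  then have seg: "of_real s * d \<in> open_segment a b"
    unfolding s[symmetric] using u ab by (auto simp: in_segment)
  define k where "k = \<kappa> (j + 1)"
  define i where "i = int n - e j"
  \<comment> \<open>To order the times, heights are now taken with respect to the direction F of the
    chord. F lies in the first sector, so all exit sides have nonnegative height for F; hence the
    points at times \<open>\<tau> (j + 1)\<close> and \<open>\<tau> (j + 2)\<close> are separated by
    the line of the chord. The sign of \<open>height F d\<close> turns this into inequalities
    between times.\<close>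
  define F where "F = chord m n k (if \<delta> = 2 then i else i - 1)"
  have k: "k < m" using crosses_bounds(2)[OF developedD(4)[OF t, of j]] by (simp add: k_def)
  have i: "0 \<le> i" "i < int n" using on_gridD(10,11)[OF g, of j] by (auto simp: i_def)
  have F: "in_cone n F"
    using i by (auto simp: F_def in_cone_def xc_chord[OF n] Im_chord[OF n] slen_nonneg[OF k] sn_nonneg)
  have FE: "0 \<le> height F (bm_vec m n (\<kappa> l) (e l))" for l
    using crosses_bounds(1)[OF developedD(4)[OF t, of l]] on_gridD(10,11)[OF g, of l]
    by (intro height_right_side_nonneg[OF n F]) auto
  have j2: "j + 1 + 1 = j + 2" by simp
  obtain v where v: "0 < v" "v < 1"
    "of_real (\<tau> (j + 1)) * d = A j + of_real v * bm_vec m n (\<kappa> j) (e j)"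
    "of_real (\<tau> (j + 1)) * d = B j - of_real (1 - v) * bm_vec m n (\<kappa> j) (e j)"
    by (rule developed_ends[OF n t, of j, folded A_def B_def])
  obtain v' where v': "0 < v'" "v' < 1"
    "of_real (\<tau> (j + 2)) * d = A (j + 1) + of_real v' * bm_vec m n (\<kappa> (j + 1)) (e (j + 1))"
    "of_real (\<tau> (j + 2)) * d = B (j + 1) - of_real (1 - v') * bm_vec m n (\<kappa> (j + 1)) (e (j + 1))"
    by (rule developed_ends[OF n t, of "j + 1", folded A_def B_def, unfolded j2])
  have swap: "height F d = - height d F" by (simp add: height_def)
  have vE: "0 \<le> v * height F (bm_vec m n (\<kappa> j) (e j))" "0 \<le> (1 - v) * height F (bm_vec m n (\<kappa> j) (e j))"
    "0 \<le> v' * height F (bm_vec m n (\<kappa> (j + 1)) (e (j + 1)))"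
    "0 \<le> (1 - v') * height F (bm_vec m n (\<kappa> (j + 1)) (e (j + 1)))"
    using FE v v' by auto
  have "\<tau> (j + 1) \<le> s \<and> s \<le> \<tau> (j + 2)"
  proof (cases "\<delta> = 2")
    case True
    then have ab: "a = B j" "b = A (j + 1)" by (auto simp: a_def b_def)
    have bF: "b = a + F"
      using on_grid_moves(4)[OF n t g, of j] True by (simp add: ab F_def \<delta>_def A_def B_def k_def i_def)
    then have "0 < height F d" using hab swap by simp
    have hF: "height F (of_real s * d) = height F a" "height F a = height F b"
      unfolding s[symmetric] bF by simp_all
    have "height F (of_real (\<tau> (j + 1)) * d) \<le> height F (of_real s * d)"
      unfolding hF v(4) ab using vE(2) by (simp del: of_real_diff)
    moreover have "height F (of_real s * d) \<le> height F (of_real (\<tau> (j + 2)) * d)"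
      unfolding hF v'(3) ab(2) using vE(3) by (simp del: of_real_diff)
    ultimately show ?thesis using \<open>0 < height F d\<close> by simp
  next
    case False
    then have ab: "a = B (j + 1)" "b = A j" by (auto simp: a_def b_def)
    have aF: "a = b + F"
      using on_grid_moves(1)[OF n t g, of j] \<delta> False by (simp add: ab F_def \<delta>_def A_def B_def k_def i_def)
    then have "height F d < 0" using hab swap by simp
    have hF: "height F (of_real s * d) = height F b" "height F b = height F a"
      unfolding s[symmetric] aF by simp_all
    have "height F (of_real s * d) \<le> height F (of_real (\<tau> (j + 1)) * d)"
      unfolding hF(1) v(3) ab using vE(1) by (simp del: of_real_diff)
    moreover have "height F (of_real (\<tau> (j + 2)) * d) \<le> height F (of_real s * d)"
      unfolding hF v'(4) ab(1) using vE(4) by (simp del: of_real_diff)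
    ultimately show ?thesis using \<open>height F d < 0\<close> by simp
  qed
  then show "\<exists>s. \<tau> (j + 1) \<le> s \<and> s \<le> \<tau> (j + 2) \<and> of_real s * d \<in> open_segment a b"
    using seg by blast
qed

text \<open>Trajectories have unit speed, which \<open>shear_flip\<close> does not respect; the time
  is rescaled instead.\<close>

lemma developed_scale:
  assumes t: "developed m n (of_real \<rho> * d) \<kappa> c \<tau> f e w" and \<rho>: "0 < \<rho>"
  shows "developed m n d \<kappa> c (\<lambda>j. \<tau> j * \<rho>) f e w"
proof -
  have sgn: "Im (cnj x * d) < 0" if "Im (cnj x * (of_real \<rho> * d)) < 0" for x
  proof -
    have "Im (cnj x * (of_real \<rho> * d)) = \<rho> * Im (cnj x * d)" by (simp add: algebra_simps)
    then show ?thesis using that \<rho> by (simp add: mult_less_0_iff)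
  qed
  have "filterlim (\<lambda>j. \<tau> j * \<rho>) at_top at_top" "filterlim (\<lambda>j. \<tau> j * \<rho>) at_bot at_bot"
    using developedD(6,7)[OF t] \<rho>
    by (auto intro: filterlim_at_top_mult_tendsto_pos filterlim_tendsto_pos_mult_at_bot
        simp: mult.commute[of _ \<rho>] filterlim_tendsto_pos_mult_at_top[OF tendsto_const])
  then show ?thesis
    using developedD(1-5)[OF t] sgn \<rho> unfolding developed_def
    by (auto simp: mult.assoc)
qed

section \<open>Increasing enumerations of sets of integers\<close>

lemma strict_mono_int_ge:
  fixes h :: "int \<Rightarrow> int"
  assumes "strict_mono h"
  shows "0 \<le> j \<Longrightarrow> h 0 + j \<le> h j" and "j \<le> 0 \<Longrightarrow> h j \<le> h 0 + j"
proof -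
  have step: "h i + 1 \<le> h (i + 1)" for i using strict_monoD[OF assms, of i "i + 1"] by simp
  show "h 0 + j \<le> h j" if "0 \<le> j"
    using that
  proof (induction j rule: int_ge_induct)
    case (step i)
    then show ?case using \<open>\<And>i. h i + 1 \<le> h (i + 1)\<close>[of i] by simp
  qed simp
  show "h j \<le> h 0 + j" if "j \<le> 0"
    using that
  proof (induction j rule: int_le_induct)
    case (step i)
    then show ?case using \<open>\<And>i. h i + 1 \<le> h (i + 1)\<close>[of "i - 1"] by simp
  qed simp
qed

lemma strict_mono_int_filterlim:
  fixes h :: "int \<Rightarrow> int"
  assumes "strict_mono h"
  shows "filterlim (\<lambda>j. h (j - a) + b) at_top at_top" "filterlim (\<lambda>j. h (j - a) + b) at_bot at_bot"
proof -
  show "filterlim (\<lambda>j. h (j - a) + b) at_top at_top"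
    unfolding filterlim_at_top eventually_at_top_linorder
  proof
    fix Z
    show "\<exists>N. \<forall>j\<ge>N. Z \<le> h (j - a) + b"
    proof (intro exI[of _ "max a (a + Z - h 0 - b)"] allI impI)
      fix j assume "max a (a + Z - h 0 - b) \<le> j"
      then show "Z \<le> h (j - a) + b" using strict_mono_int_ge(1)[OF assms, of "j - a"] by simp
    qed
  qed
  show "filterlim (\<lambda>j. h (j - a) + b) at_bot at_bot"
    unfolding filterlim_at_bot eventually_at_bot_linorder
  proof
    fix Z
    show "\<exists>N. \<forall>j\<le>N. h (j - a) + b \<le> Z"
    proof (intro exI[of _ "min a (a + Z - h 0 - b)"] allI impI)
      fix j assume "j \<le> min a (a + Z - h 0 - b)"
      then show "h (j - a) + b \<le> Z" using strict_mono_int_ge(2)[OF assms, of "j - a"] by simp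
    qed
  qed
qed

lemma enumerate_int_set:
  fixes S :: "int set"
  assumes up: "\<And>j. \<exists>s\<ge>j. s \<in> S" and down: "\<And>j. \<exists>s\<le>j. s \<in> S"
  obtains h :: "int \<Rightarrow> int" where "strict_mono h" "range h = S"
proof -
  \<comment> \<open>The negative part is indexed by -1 - k, so that 0 is counted once.\<close>
  define A B where "A = {k::nat. int k \<in> S}" and "B = {k::nat. - 1 - int k \<in> S}"
  have A: "infinite A"
    unfolding infinite_nat_iff_unbounded_le
  proof
    fix k
    obtain s where "s \<ge> int k" "s \<in> S" using up by blast
    then show "\<exists>l\<ge>k. l \<in> A" by (intro exI[of _ "nat s"]) (auto simp: A_def)
  qed
  have B: "infinite B"
    unfolding infinite_nat_iff_unbounded_le
  proof
    fix k
    obtain s where "s \<le> - 1 - int k" "s \<in> S" using down by blast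
    then show "\<exists>l\<ge>k. l \<in> B" by (intro exI[of _ "nat (- 1 - s)"]) (auto simp: B_def)
  qed
  define h where "h j = (if 0 \<le> j then int (enumerate A (nat j)) else - 1 - int (enumerate B (nat (- 1 - j))))" for j
  have "strict_mono h"
  proof (rule strict_monoI)
    fix x y :: int assume xy: "x < y"
    show "h x < h y"
    proof (cases "0 \<le> x")
      case True
      then show ?thesis using enumerate_mono[OF _ A, of "nat x" "nat y"] xy by (simp add: h_def)
    next
      case False
      then show ?thesis using enumerate_mono[OF _ B, of "nat (- 1 - y)" "nat (- 1 - x)"] xy by (simp add: h_def)
    qed
  qed
  moreover have "range h = S"
  proof
    show "range h \<subseteq> S" using enumerate_in_set[OF A] enumerate_in_set[OF B] by (auto simp: h_def A_def B_def)
    show "S \<subseteq> range h"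
    proof
      fix s assume s: "s \<in> S"
      show "s \<in> range h"
      proof (cases "0 \<le> s")
        case True
        then have "nat s \<in> range (enumerate A)" using s unfolding range_enumerate[OF A] by (simp add: A_def)
        then obtain k where "nat s = enumerate A k" by blast
        then have "h (int k) = s" using True by (simp add: h_def flip: \<open>nat s = enumerate A k\<close>)
        then show ?thesis by blast
      next
        case False
        then have "nat (- 1 - s) \<in> range (enumerate B)" using s unfolding range_enumerate[OF B] by (simp add: B_def)
        then obtain k where k: "nat (- 1 - s) = enumerate B k" by blast
        then have "h (- 1 - int k) = s" using False by (simp add: h_def flip: k)
        then show ?thesis by blast
      qed
    qed
  qed
  ultimately show ?thesis by (rule that)
qed

lemma vtx_mod_add1: "n > 0 \<Longrightarrow> vtx m n k (e mod (2 * int n) + 1) = vtx m n k (e + 1)"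
  by (rule vtx_cong) (simp_all add: mod_add_left_eq)

section \<open>The dual itinerary of a trajectory with direction in the first sector\<close>

locale first_sector_trajectory =
  fixes m n :: nat and d :: complex and \<kappa> c \<tau> f e and w :: "int \<Rightarrow> nat" and r q :: "int \<Rightarrow> nat"
  assumes m: "m \<ge> 2" and n: "n \<ge> 2" and traj: "developed m n d \<kappa> c \<tau> f e w"
    and cone: "in_cone n d" and grid: "on_grid m n \<kappa> f e w r q"
begin

abbreviation "A \<equiv> near_end m n \<kappa> c e"
abbreviation "B \<equiv> far_end m n \<kappa> c e"
abbreviation "flip \<equiv> shear_flip m n"

definition turn :: "int \<Rightarrow> int" where "turn j = e (j + 1) + e j - int n"

definition b :: "int \<Rightarrow> int" where "b j = dual_index m (r j) (q j)"

definition horizontal :: "int \<Rightarrow> bool" where "horizontal j \<longleftrightarrow> turn j = 0 \<or> turn j = 2"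

text \<open>Places the dual polygon P(q j - 1) so that the image of the edge crossed is its chord
  \<open>b j - 1\<close>, from corner 1 - b to corner b + 1 (see \<open>flip_ends\<close>).\<close>

definition dual_center :: "int \<Rightarrow> complex" where
  "dual_center j = flip (A j) - vtx n m (q j - 1) (1 - b j)"

lemmas bounds = on_gridD(1-4)[OF grid]

lemma mn: "m > 0" "n > 0" using m n by auto

lemma poly_step: "poly_before (r (j + 1)) (q (j + 1)) = poly_after (r j) (q j)"
  using on_gridD(6)[OF grid, of "j + 1"] on_gridD(8)[OF grid, of j] by simp

lemma turn_cases: "turn j = 0 \<or> turn j = 1 \<or> turn j = 2"
  using first_sector_exit[OF n traj cone grid, of j] by (simp add: turn_def)

lemma turn_0: "turn j = 0 \<longleftrightarrow>
    r (j + 1) = r j \<and> (if odd (r j + q j) then q j = q (j + 1) + 1 else q (j + 1) = q j + 1)"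
  unfolding turn_def on_gridD(7)[OF grid]
  by (rule side_index_step(1)[OF bounds(1,3,4) bounds(1,3,4) poly_step])

lemma turn_1: "turn j = 1 \<longleftrightarrow>
    q (j + 1) = q j \<and> (if odd (q j) then r (j + 1) = r j + 1 else r j = r (j + 1) + 1)"
  unfolding turn_def on_gridD(7)[OF grid]
  by (rule side_index_step(2)[OF bounds(1,3,4) bounds(1,3,4) poly_step])

lemma turn_2: "turn j = 2 \<longleftrightarrow>
    r (j + 1) = r j \<and> (if odd (r j + q j) then q (j + 1) = q j + 1 else q j = q (j + 1) + 1)"
  unfolding turn_def on_gridD(7)[OF grid]
  by (rule side_index_step(3)[OF bounds(1,3,4) bounds(1,3,4) poly_step])

lemma horizontal_iff: "horizontal j \<longleftrightarrow> r (j + 1) = r j \<and> (q (j + 1) = q j + 1 \<or> q j = q (j + 1) + 1)"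
  unfolding horizontal_def turn_0 turn_2 by auto

lemma arrow_label_iff_horizontal:
  "arrow_label m n (w j) (w (j + 1)) l \<longleftrightarrow>
     horizontal j \<and> l = vertex m (min (q j) (q (j + 1))) (poly_after (r j) (q j) + 1)"
  unfolding on_gridD(5)[OF grid] horizontal_iff
  by (subst arrow_label_iff[OF bounds bounds]) blast

lemma vertical:
  assumes "\<not> horizontal j"
  shows "q (j + 1) = q j" "b (j + 1) = b j + 1" "turn j = 1"
proof -
  show t: "turn j = 1" using assms turn_cases[of j] by (auto simp: horizontal_def)
  then show "q (j + 1) = q j" "b (j + 1) = b j + 1"
    unfolding turn_1 b_def dual_index_def by (auto split: if_splits)
qed

lemma b_bounds: "1 \<le> b j" "b j < int m"
  using dual_index_bounds[OF bounds(1,2), of j] by (auto simp: b_def)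

text \<open>A vertical arrow raises b by one, and b stays between 1 and m - 1, so vertical runs are
  finite.\<close>

lemma horizontal_above: "\<exists>s\<ge>j. horizontal s"
proof (rule ccontr)
  assume *: "\<not> (\<exists>s\<ge>j. horizontal s)"
  have "b s = b j + (s - j)" if "j \<le> s" for s
    using that
  proof (induction s rule: int_ge_induct)
    case (step s)
    then show ?case using vertical(2)[of s] * by auto
  qed simp
  from this[of "j + int m"] show False using b_bounds[of j] b_bounds[of "j + int m"] by simp
qed

lemma horizontal_below: "\<exists>s\<le>j. horizontal s"
proof (rule ccontr)
  assume *: "\<not> (\<exists>s\<le>j. horizontal s)"
  have "b s = b j + (s - j)" if "s \<le> j" for s
    using that
  proof (induction s rule: int_le_induct)
    case (step s)
    then show ?case using vertical(2)[of "s - 1"] * by auto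
  qed simp
  from this[of "j - int m"] show False using b_bounds[of j] b_bounds[of "j - int m"] by simp
qed

lemma is_derived_seq_derived_seq: "is_derived_seq m n w (derived_seq m n w)"
proof -
  obtain h :: "int \<Rightarrow> int" where h: "strict_mono h" "range h = {j. horizontal j}"
    by (rule enumerate_int_set[of "{j. horizontal j}"]) (use horizontal_above horizontal_below in auto)
  define v where "v J = vertex m (min (q (h J)) (q (h J + 1))) (poly_after (r (h J)) (q (h J)) + 1)" for J
  have "horizontal (h J)" for J using h(2) by blast
  then have "is_derived_seq m n w v"
    unfolding is_derived_seq_def arrow_label_iff_horizontal using h by (intro exI[of _ h]) (simp add: v_def)
  then show ?thesis unfolding derived_seq_def by (rule someI[of "is_derived_seq m n w"])
qed

lemma flip_chord:
  shows "flip (chord m n (\<kappa> (j + 1)) (int n - e j - 1)) = - bm_vec n m (q j - 1) (- b j)"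
    and "flip (chord m n (\<kappa> (j + 1)) (int n - e j)) = bm_vec n m (q j - 1) (b j + 1)"
    and "flip (B j) - flip (A j) = vtx n m (q j - 1) (b j + 1) - vtx n m (q j - 1) (1 - b j)"
proof -
  note fc = shear_flip_chord[OF m n bounds[of j], folded on_gridD(7,8)[OF grid, of j] b_def]
  show "flip (chord m n (\<kappa> (j + 1)) (int n - e j - 1)) = - bm_vec n m (q j - 1) (- b j)"
    "flip (chord m n (\<kappa> (j + 1)) (int n - e j)) = bm_vec n m (q j - 1) (b j + 1)"
    by (rule fc)+
  have f: "f (j + 1) = (- (int n - e j) + 2 * int n) mod (2 * int n)"
    using on_gridD(7,9)[OF grid, of j] by (simp add: algebra_simps)
  then have "bm_vec m n (\<kappa> (j + 1)) (f (j + 1)) = bm_vec m n (\<kappa> (j + 1)) (- (int n - e j))"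
    using bm_vec_mod[OF mn(2)] by (metis mod_add_self2)
  then have "B j - A j = - bm_vec m n (\<kappa> (j + 1)) (- (int n - e j))"
    using far_minus_near[OF n, of m \<kappa> c e j] crosses_bm_vec[OF developedD(4)[OF traj, of j]]
    by (metis minus_minus)
  then have "flip (B j) - flip (A j) = chord n m (q j - 1) (b j - 1)"
    unfolding shear_flip_linear(2)[symmetric] by (simp only: fc)
  then show "flip (B j) - flip (A j) = vtx n m (q j - 1) (b j + 1) - vtx n m (q j - 1) (1 - b j)"
    by (simp add: chord_def add.commute)
qed

lemma flip_ends:
  "flip (A j) = dual_center j + vtx n m (q j - 1) (1 - b j)"
  "flip (B j) = dual_center j + vtx n m (q j - 1) (b j + 1)"
  using flip_chord(3)[of j] by (simp_all add: dual_center_def algebra_simps)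

text \<open>A vertical arrow leads from the chord b - 1 to the chord b of the same dual
  polygon.\<close>

lemma dual_center_vertical:
  assumes "\<not> horizontal j"
  shows "dual_center (j + 1) = dual_center j"
proof -
  have "A (j + 1) = A j + chord m n (\<kappa> (j + 1)) (int n - e j - 1)"
    by (rule on_grid_moves(2)[OF n traj grid]) (use vertical(3)[OF assms] in \<open>simp add: turn_def\<close>)
  then have "flip (A (j + 1)) = flip (A j) - bm_vec n m (q j - 1) (- b j)"
    by (simp only: shear_flip_linear flip_chord) simp
  moreover have "vtx n m (q j - 1) (1 - b j) = vtx n m (q j - 1) (- b j) + bm_vec n m (q j - 1) (- b j)"
    using vtx_add1[OF m, of n "q j - 1" "- b j"] by (simp add: add.commute)
  ultimately show ?thesis by (simp add: dual_center_def vertical[OF assms])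
qed

text \<open>Behind the chord b - 1 lies the dual quadrilateral with corners -b, 1 - b, b + 1, b + 2.
  Its two edges are the sides -b and b + 1 of the dual polygon, the exits for turns 0 and 2.\<close>

definition exit_side :: "int \<Rightarrow> int" where
  "exit_side j = (if turn j = 2 then b j + 1 else - b j) mod (2 * int m)"

definition entry_side :: "int \<Rightarrow> int" where
  "entry_side j = (if turn j = 2 then 1 - b (j + 1) else b (j + 1)) mod (2 * int m)"

definition left_end :: "int \<Rightarrow> complex" where
  "left_end j = (if turn j = 2 then B j else B (j + 1))"

definition right_end :: "int \<Rightarrow> complex" where
  "right_end j = (if turn j = 2 then A (j + 1) else A j)"

lemma crosses_horizontal:
  assumes "arrow_label m n (w j) (w (j + 1)) l"
  shows "crosses n m l (q j - 1) (exit_side j) (q (j + 1) - 1) (entry_side j)"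
proof -
  have h: "horizontal j" and l: "l = vertex m (min (q j) (q (j + 1))) (poly_after (r j) (q j) + 1)"
    using assms by (auto simp: arrow_label_iff_horizontal)
  have r: "r (j + 1) = r j" using h by (simp add: horizontal_iff)
  note cd = crosses_dual[OF bounds[of j] bounds(3,4)[of "j + 1"], folded l]
  show ?thesis
  proof (cases "turn j = 2")
    case True
    then have "if odd (r j + q j) then q (j + 1) = q j + 1 else q j = q (j + 1) + 1" using turn_2 by blast
    from cd(1)[OF this] show ?thesis using True r by (simp add: exit_side_def entry_side_def b_def)
  next
    case False
    then have "turn j = 0" using h by (simp add: horizontal_def)
    then have "if odd (r j + q j) then q j = q (j + 1) + 1 else q (j + 1) = q j + 1" using turn_0 by blast
    from cd(2)[OF this] show ?thesis using False r by (simp add: exit_side_def entry_side_def b_def)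
  qed
qed

text \<open>Since \<open>flip\<close> reverses orientation, the left end of the chord becomes the
  right end of the dual side, which is where the exit side starts.\<close>

lemma horizontal_ends:
  assumes "horizontal j"
  shows "dual_center j + vtx n m (q j - 1) (exit_side j) = flip (left_end j)"
    and "dual_center j + vtx n m (q j - 1) (exit_side j + 1) = flip (right_end j)"
    and "dual_center (j + 1) + vtx n m (q (j + 1) - 1) (entry_side j + 1) = flip (left_end j)"
proof -
  have "dual_center j + vtx n m (q j - 1) (exit_side j) = flip (left_end j) \<and>
    dual_center j + vtx n m (q j - 1) (exit_side j + 1) = flip (right_end j) \<and>
    dual_center (j + 1) + vtx n m (q (j + 1) - 1) (entry_side j + 1) = flip (left_end j)"
  proof (cases "turn j = 2")
    case True
    have mv: "A (j + 1) = B j + chord m n (\<kappa> (j + 1)) (int n - e j)"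
      by (rule on_grid_moves(4)[OF n traj grid]) (use True in \<open>simp add: turn_def\<close>)
    then have R: "flip (right_end j) = flip (B j) + bm_vec n m (q j - 1) (b j + 1)"
      unfolding right_end_def True by (simp only: mv if_True simp_thms shear_flip_linear flip_chord)
    have 1: "dual_center j + vtx n m (q j - 1) (exit_side j) = flip (left_end j)"
      using True by (simp add: exit_side_def left_end_def flip_ends vtx_mod mn)
    have 2: "dual_center j + vtx n m (q j - 1) (exit_side j + 1) = flip (right_end j)"
      using True vtx_add1[OF m, of n "q j - 1" "b j + 1"] unfolding R
      by (simp add: exit_side_def flip_ends vtx_mod_add1 mn)
    have "arrow_label m n (w j) (w (j + 1)) (vertex m (min (q j) (q (j + 1))) (poly_after (r j) (q j) + 1))"
      using assms by (simp add: arrow_label_iff_horizontal)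
    from crosses_bm_vec[OF crosses_horizontal[OF this]]
    have bm: "bm_vec n m (q (j + 1) - 1) (entry_side j) = - bm_vec n m (q j - 1) (b j + 1)"
      using True by (simp add: exit_side_def bm_vec_mod mn)
    have "dual_center (j + 1) + vtx n m (q (j + 1) - 1) (entry_side j) = flip (A (j + 1))"
      using True by (simp add: entry_side_def flip_ends vtx_mod mn)
    then have "dual_center (j + 1) + vtx n m (q (j + 1) - 1) (entry_side j + 1)
        = flip (A (j + 1)) - bm_vec n m (q j - 1) (b j + 1)"
      unfolding vtx_add1[OF m] bm by simp
    also have "\<dots> = flip (left_end j)"
      using R True by (simp add: right_end_def left_end_def)
    finally show ?thesis using 1 2 by blast
  next
    case False
    then have 0: "turn j = 0" using assms by (simp add: horizontal_def)
    have mv: "B (j + 1) = A j + chord m n (\<kappa> (j + 1)) (int n - e j - 1)"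
      by (rule on_grid_moves(1)[OF n traj grid]) (use 0 in \<open>simp add: turn_def\<close>)
    then have L: "flip (left_end j) = flip (A j) - bm_vec n m (q j - 1) (- b j)"
      using False by (simp only: left_end_def if_False shear_flip_linear flip_chord) simp
    have 2: "dual_center j + vtx n m (q j - 1) (exit_side j + 1) = flip (right_end j)"
      using False by (simp add: exit_side_def right_end_def flip_ends vtx_mod_add1 mn)
    have "dual_center j + vtx n m (q j - 1) (exit_side j) + bm_vec n m (q j - 1) (- b j)
        = dual_center j + vtx n m (q j - 1) (exit_side j + 1)"
      using False by (simp add: exit_side_def vtx_mod_add1 vtx_mod bm_vec_mod mn vtx_add1[OF m])
    then have "dual_center j + vtx n m (q j - 1) (exit_side j) = flip (left_end j)"
      using 2 False unfolding L by (simp add: right_end_def algebra_simps)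
    moreover have "dual_center (j + 1) + vtx n m (q (j + 1) - 1) (entry_side j + 1) = flip (left_end j)"
      using False by (simp add: entry_side_def left_end_def flip_ends vtx_mod_add1 mn)
    ultimately show ?thesis using 2 by blast
  qed
  then show "dual_center j + vtx n m (q j - 1) (exit_side j) = flip (left_end j)"
    "dual_center j + vtx n m (q j - 1) (exit_side j + 1) = flip (right_end j)"
    "dual_center (j + 1) + vtx n m (q (j + 1) - 1) (entry_side j + 1) = flip (left_end j)"
    by blast+
qed

lemma horizontal_crossing:
  assumes "horizontal j"
  shows "height d (right_end j - left_end j) < 0"
    and "\<exists>s. \<tau> (j + 1) \<le> s \<and> s \<le> \<tau> (j + 2) \<and> of_real s * d \<in> open_segment (left_end j) (right_end j)"
  using chord_crossing[OF n traj cone grid, of j] assms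
  unfolding horizontal_def turn_def left_end_def right_end_def by auto

lemma tau_mono: "i \<le> j \<Longrightarrow> \<tau> i \<le> \<tau> j"
proof (induction j rule: int_ge_induct)
  case (step k)
  then show ?case using developedD(1)[OF traj, of k] by simp
qed simp

theorem derived_developed:
  assumes "is_derived_seq m n w v"
  shows "\<exists>\<kappa>' c' \<tau>' f' e'. developed n m (flip d) \<kappa>' c' \<tau>' f' e' v"
proof -
  obtain h where h: "strict_mono h" "range h = {j. horizontal j}"
    and v: "\<And>J. arrow_label m n (w (h J)) (w (h J + 1)) (v J)"
  proof -
    have "{j. \<exists>l. arrow_label m n (w j) (w (j + 1)) l} = {j. horizontal j}"
      by (simp add: arrow_label_iff_horizontal)
    then show ?thesis using assms that unfolding is_derived_seq_def by metis
  qed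
  have hor: "horizontal (h J)" for J using h(2) by blast
  have "\<exists>S. \<forall>j. horizontal j \<longrightarrow>
      \<tau> (j + 1) \<le> S j \<and> S j \<le> \<tau> (j + 2) \<and> of_real (S j) * d \<in> open_segment (left_end j) (right_end j)"
    using horizontal_crossing(2) by metis
  then obtain S where S: "\<And>J. \<tau> (h J + 1) \<le> S (h J)" "\<And>J. S (h J) \<le> \<tau> (h J + 2)"
    "\<And>J. of_real (S (h J)) * d \<in> open_segment (left_end (h J)) (right_end (h J))"
    using hor by blast
  \<comment> \<open>Between two consecutive horizontal steps all arrows are vertical, so the dual
    polygon does not change.\<close>
  have run: "q (h (J + 1)) = q (h J + 1)" "dual_center (h (J + 1)) = dual_center (h J + 1)" for J
  proof -
    have lt: "h J < h (J + 1)" using h(1) by (simp add: strict_mono_less)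
    have "i \<le> h (J + 1) \<Longrightarrow> q i = q (h J + 1) \<and> dual_center i = dual_center (h J + 1)" if "h J + 1 \<le> i" for i
      using that
    proof (induction i rule: int_ge_induct)
      case (step i)
      have "\<not> horizontal i"
      proof
        assume "horizontal i"
        then obtain I where I: "i = h I" using h(2) by blast
        then have "h J < h I" "h I < h (J + 1)" using step.hyps step.prems by simp_all
        then have "J < I" "I < J + 1" unfolding strict_mono_less[OF h(1)] .
        then show False by simp
      qed
      then show ?case using step.IH step.prems vertical(1) dual_center_vertical by simp
    qed simp
    from this[of "h (J + 1)"] lt show "q (h (J + 1)) = q (h J + 1)" "dual_center (h (J + 1)) = dual_center (h J + 1)"
      by simp_all
  qed
  \<comment> \<open>In \<open>developed\<close>, crossing J takes place at time J + 1, hence the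
    shift by one.\<close>
  define \<tau>' where "\<tau>' J = S (h (J - 1))" for J
  have "developed n m (flip d) (\<lambda>J. q (h J) - 1) (\<lambda>J. dual_center (h J)) \<tau>'
    (\<lambda>J. entry_side (h (J - 1))) (\<lambda>J. exit_side (h J)) v"
    unfolding developed_def
  proof (intro conjI allI)
    fix J :: int
    show "\<tau>' J \<le> \<tau>' (J + 1)"
    proof -
      have "h (J - 1) < h J" using h(1) by (simp add: strict_mono_less)
      then have "\<tau> (h (J - 1) + 2) \<le> \<tau> (h J + 1)" by (intro tau_mono) simp
      then show ?thesis using S(2)[of "J - 1"] S(1)[of J] by (simp add: \<tau>'_def)
    qed
    show "of_real (\<tau>' (J + 1)) * flip d \<in> open_segment
        (dual_center (h J) + vtx n m (q (h J) - 1) (exit_side (h J)))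
        (dual_center (h J) + vtx n m (q (h J) - 1) (exit_side (h J) + 1))"
      unfolding horizontal_ends[OF hor] using shear_flip_open_segment[OF S(3)[of J] m n]
      by (simp add: \<tau>'_def shear_flip_linear)
    show "Im (cnj (bm_vec n m (q (h J) - 1) (exit_side (h J))) * flip d) < 0"
    proof -
      have "bm_vec n m (q (h J) - 1) (exit_side (h J)) = flip (right_end (h J)) - flip (left_end (h J))"
        unfolding horizontal_ends(1,2)[OF hor, symmetric] by (simp add: vtx_add1[OF m])
      then show ?thesis
        using height_shear_flip_less[OF m n horizontal_crossing(1)[OF hor]]
        unfolding height_swap by (simp only: shear_flip_linear neg_less_0_iff_less)
    qed
    show "crosses n m (v J) (q (h J) - 1) (exit_side (h J)) (q (h (J + 1)) - 1) (entry_side (h (J + 1 - 1)))"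
      using crosses_horizontal[OF v] by (simp add: run)
    show "dual_center (h (J + 1)) + vtx n m (q (h (J + 1)) - 1) (entry_side (h (J + 1 - 1)) + 1) =
        dual_center (h J) + vtx n m (q (h J) - 1) (exit_side (h J))"
      using horizontal_ends(1,3)[OF hor, of J] by (simp add: run)
  next
    have "filterlim (\<lambda>J. \<tau> (h (J - 1) + 1)) at_top at_top"
      by (rule filterlim_compose[OF developedD(6)[OF traj] strict_mono_int_filterlim(1)[OF h(1)]])
    then show "filterlim \<tau>' at_top at_top"
      by (rule filterlim_at_top_mono) (simp add: \<tau>'_def S)
    have "filterlim (\<lambda>J. \<tau> (h (J - 1) + 2)) at_bot at_bot"
      by (rule filterlim_compose[OF developedD(7)[OF traj] strict_mono_int_filterlim(2)[OF h(1)]])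
    then show "filterlim \<tau>' at_bot at_bot"
      by (rule filterlim_at_bot_mono) (simp add: \<tau>'_def S)
  qed
  then show ?thesis by blast
qed

end

lemma in_cone_sector:
  assumes "n \<ge> 2" "\<theta> \<in> sector n 0"
  shows "in_cone n (cis \<theta>)"
proof -
  have *: "0 \<le> \<theta>" "\<theta> \<le> pi / n" "pi / n \<le> pi"
    using assms by (auto simp: sector_def divide_le_eq)
  then have "0 \<le> sin (pi / n - \<theta>)" "0 \<le> sin \<theta>" by (auto intro!: sin_ge_zero)
  then show ?thesis by (simp add: in_cone_def xc_cis)
qed

text \<open>It is the cutting sequence of the same trajectory with respect to the dual polygons.\<close>

theorem derived_cutting_sequence:
  assumes m: "m \<ge> 2" and n: "n \<ge> 2" and \<theta>: "\<theta> \<in> sector n 0" and w: "cutting_sequence m n \<theta> w"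
  shows "\<exists>\<theta>'. 0 \<le> \<theta>' \<and> \<theta>' \<le> pi \<and> cutting_sequence n m \<theta>' (derived_seq m n w)"
proof -
  from w obtain \<kappa> c \<tau> f e where t: "developed m n (cis \<theta>) \<kappa> c \<tau> f e w"
    unfolding cutting_sequence_developed[OF n] by blast
  note cone = in_cone_sector[OF n \<theta>]
  obtain r q where "on_grid m n \<kappa> f e w r q" by (rule first_sector_on_grid[OF n t cone])
  then interpret first_sector_trajectory m n "cis \<theta>" \<kappa> c \<tau> f e w r q
    using m n t cone by unfold_locales
  obtain \<kappa>' c' \<tau>' f' e' where t': "developed n m (flip (cis \<theta>)) \<kappa>' c' \<tau>' f' e' (derived_seq m n w)"
    using derived_developed[OF is_derived_seq_derived_seq] by blast
  let ?d = "flip (cis \<theta>)"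
  have "?d \<noteq> 0" using developedD(3)[OF t'] by auto
  then have "?d = of_real (cmod ?d) * cis (Arg ?d)" "0 < cmod ?d"
    using rcis_cmod_Arg[of ?d] by (simp_all add: rcis_def)
  then have "developed n m (cis (Arg ?d)) \<kappa>' c' (\<lambda>j. \<tau>' j * cmod ?d) f' e' (derived_seq m n w)"
    using developed_scale[of n m "cmod ?d" "cis (Arg ?d)"] t' by metis
  then have "cutting_sequence n m (Arg ?d) (derived_seq m n w)"
    unfolding cutting_sequence_developed[OF m] by blast
  moreover have "0 \<le> Arg ?d" "Arg ?d \<le> pi"
    using cone Arg_bounded[of ?d] by (simp_all add: Arg_less_0 Im_shear_flip[OF m] in_cone_def)
  ultimately show ?thesis by blast
qed

section \<open>Normalization\<close>

text \<open>Corner s of a polygon goes to corner \<open>g s + 1\<close> of its image: a reflected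
  side is traversed backwards, so its start becomes the end of side \<open>g s\<close>.\<close>

lemma developed_reflection:
  assumes n: "n \<ge> 2" and \<sigma>: "reflection_perm m n i \<sigma>" and t: "developed m n d \<kappa> c \<tau> f e w"
  shows "\<exists>\<kappa>' c' f' e'. developed m n (reflection n i d) \<kappa>' c' \<tau> f' e' (\<sigma> \<circ> w)"
proof -
  define R where "R = reflection n i"
  define g where "g s = int i + 1 + int n - s" for s
  define N where "N = 2 * int n"
  have n0: "n > 0" using n by simp
  have R_add: "R (x + y) = R x + R y" and R_scale: "R (of_real a * x) = of_real a * R x" for x y a
    by (simp_all add: R_def reflection_def algebra_simps)
  have lin: "linear R" "inj R"
    by (rule linearI, simp_all add: R_add R_scale scaleR_conv_of_real)
      (simp add: inj_def R_def reflection_def)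
  have R_cross: "Im (cnj (- R x) * R y) = Im (cnj x * y)" for x y
  proof -
    have "cnj (R x) * R y = x * cnj y * (cnj (cis (real (i + 1) * pi / real n)) * cis (real (i + 1) * pi / real n))"
      by (simp add: R_def reflection_def algebra_simps)
    also have "\<dots> = x * cnj y" by (simp add: cis_cnj cis_mult)
    finally show ?thesis by simp
  qed
  obtain \<beta> where \<beta>: "\<And>k s. k < m \<Longrightarrow> bm_vec m n (\<beta> k) (g s) = - R (bm_vec m n k s)"
    and cr: "\<And>l k e k' e'. crosses m n l k e k' e' \<Longrightarrow>
      crosses m n (\<sigma> l) (\<beta> k) (g e mod N) (\<beta> k') (g e' mod N)"
    using \<sigma> unfolding reflection_perm_def induced_perm_def R_def g_def N_def by blast
  define c' where "c' j = R (c j + vtx m n (\<kappa> j) 0) - vtx m n (\<beta> (\<kappa> j)) (g 0 + 1)" for j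
  have pos: "c' j + vtx m n (\<beta> (\<kappa> j)) (g s + 1) = R (c j + vtx m n (\<kappa> j) s)" for j s
  proof -
    have k: "\<kappa> j < m" by (rule crosses_bounds(1)[OF developedD(4)[OF t]])
    have step: "(c' j + vtx m n (\<beta> (\<kappa> j)) (g (s + 1) + 1) = R (c j + vtx m n (\<kappa> j) (s + 1))) \<longleftrightarrow>
        (c' j + vtx m n (\<beta> (\<kappa> j)) (g s + 1) = R (c j + vtx m n (\<kappa> j) s))" for s
    proof -
      have "g (s + 1) + 1 = g s" by (simp add: g_def)
      then have v: "c' j + vtx m n (\<beta> (\<kappa> j)) (g (s + 1) + 1) =
          (c' j + vtx m n (\<beta> (\<kappa> j)) (g s + 1)) + R (bm_vec m n (\<kappa> j) s)"
        using vtx_add1[OF n, of m "\<beta> (\<kappa> j)" "g s"] \<beta>[OF k, of s] by simp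
      have "R (c j + vtx m n (\<kappa> j) (s + 1)) = R (c j + vtx m n (\<kappa> j) s) + R (bm_vec m n (\<kappa> j) s)"
        unfolding vtx_add1[OF n] add.assoc[symmetric] by (rule R_add)
      then show ?thesis unfolding v by (simp only: add_right_cancel)
    qed
    show ?thesis
    proof (induction s rule: int_induct[where k = 0])
      case base
      show ?case by (simp add: c'_def)
    next
      case (step1 s)
      then show ?case using step[of s] by simp
    next
      case (step2 s)
      then show ?case using step[of "s - 1"] by simp
    qed
  qed
  have pos': "c' j + vtx m n (\<beta> (\<kappa> j)) (g s) = R (c j + vtx m n (\<kappa> j) (s + 1))" for j s
    using pos[of j "s + 1"] by (simp add: g_def algebra_simps)
  have md: "vtx m n k (s mod N) = vtx m n k s" "vtx m n k (s mod N + 1) = vtx m n k (s + 1)"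
    "bm_vec m n k (s mod N) = bm_vec m n k s" for k s
    unfolding N_def using n0 by (auto intro: vtx_mod bm_vec_mod vtx_cong simp: mod_add_left_eq)
  have "developed m n (R d) (\<lambda>j. \<beta> (\<kappa> j)) c' \<tau> (\<lambda>j. g (f j) mod N) (\<lambda>j. g (e j) mod N) (\<sigma> \<circ> w)"
    unfolding developed_def md comp_def
  proof (intro conjI allI)
    fix j
    note t' = developedD(1-5)[OF t, of j]
    have k: "\<kappa> j < m" by (rule crosses_bounds(1)[OF t'(4)])
    show "\<tau> j \<le> \<tau> (j + 1)" by (rule t')
    have "of_real (\<tau> (j + 1)) * R d \<in>
        open_segment (R (c j + vtx m n (\<kappa> j) (e j))) (R (c j + vtx m n (\<kappa> j) (e j + 1)))"
      unfolding R_scale[symmetric] open_segment_linear_image[OF lin] by (rule imageI[OF t'(2)])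
    then show "of_real (\<tau> (j + 1)) * R d \<in> open_segment
       (c' j + vtx m n (\<beta> (\<kappa> j)) (g (e j))) (c' j + vtx m n (\<beta> (\<kappa> j)) (g (e j) + 1))"
      unfolding pos pos' by (simp only: open_segment_commute)
    show "Im (cnj (bm_vec m n (\<beta> (\<kappa> j)) (g (e j))) * R d) < 0"
      unfolding \<beta>[OF k] R_cross by (rule t')
    show "crosses m n (\<sigma> (w j)) (\<beta> (\<kappa> j)) (g (e j) mod N) (\<beta> (\<kappa> (j + 1))) (g (f (j + 1)) mod N)"
      by (rule cr[OF t'(4)])
    show "c' (j + 1) + vtx m n (\<beta> (\<kappa> (j + 1))) (g (f (j + 1)) + 1) = c' j + vtx m n (\<beta> (\<kappa> j)) (g (e j))"
      unfolding pos pos' developed_glue_end[OF n t] ..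
  qed (rule developedD[OF t])+
  then show ?thesis unfolding R_def by blast
qed

lemma developed_rotation:
  assumes n: "n \<ge> 2" and \<sigma>: "rotation_perm m n i \<sigma>" and t: "developed m n d \<kappa> c \<tau> f e w"
  shows "\<exists>\<kappa>' c' f' e'. developed m n (cis (- (real i * pi / real n)) * d) \<kappa>' c' \<tau> f' e' (\<sigma> \<circ> w)"
proof -
  define R where "R x = cis (- (real i * pi / real n)) * x" for x
  define g where "g s = s - int i" for s
  define N where "N = 2 * int n"
  have n0: "n > 0" using n by simp
  have R_add: "R (x + y) = R x + R y" and R_scale: "R (of_real a * x) = of_real a * R x" for x y a
    by (simp_all add: R_def algebra_simps)
  have lin: "linear R" "inj R"
    by (rule linearI, simp_all add: R_add R_scale scaleR_conv_of_real)
      (simp add: inj_def R_def)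
  have R_cross: "Im (cnj (R x) * R y) = Im (cnj x * y)" for x y
  proof -
    have "cnj (R x) * R y = cnj x * y * (cnj (cis (- (real i * pi / real n))) * cis (- (real i * pi / real n)))"
      by (simp add: R_def algebra_simps)
    also have "\<dots> = cnj x * y" by (simp add: cis_cnj cis_mult)
    finally show ?thesis by simp
  qed
  obtain \<beta> where \<beta>: "\<And>k s. k < m \<Longrightarrow> bm_vec m n (\<beta> k) (g s) = R (bm_vec m n k s)"
    and cr: "\<And>l k e k' e'. crosses m n l k e k' e' \<Longrightarrow>
      crosses m n (\<sigma> l) (\<beta> k) (g e mod N) (\<beta> k') (g e' mod N)"
    using \<sigma> unfolding rotation_perm_def induced_perm_def R_def g_def N_def by blast
  define c' where "c' j = R (c j + vtx m n (\<kappa> j) 0) - vtx m n (\<beta> (\<kappa> j)) (g 0)" for j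
  have pos: "c' j + vtx m n (\<beta> (\<kappa> j)) (g s) = R (c j + vtx m n (\<kappa> j) s)" for j s
  proof -
    have k: "\<kappa> j < m" by (rule crosses_bounds(1)[OF developedD(4)[OF t]])
    have step: "(c' j + vtx m n (\<beta> (\<kappa> j)) (g (s + 1)) = R (c j + vtx m n (\<kappa> j) (s + 1))) \<longleftrightarrow>
        (c' j + vtx m n (\<beta> (\<kappa> j)) (g s) = R (c j + vtx m n (\<kappa> j) s))" for s
    proof -
      have "g (s + 1) = g s + 1" by (simp add: g_def)
      then have v: "c' j + vtx m n (\<beta> (\<kappa> j)) (g (s + 1)) =
          (c' j + vtx m n (\<beta> (\<kappa> j)) (g s)) + R (bm_vec m n (\<kappa> j) s)"
        using vtx_add1[OF n, of m "\<beta> (\<kappa> j)" "g s"] \<beta>[OF k, of s] by simp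
      have "R (c j + vtx m n (\<kappa> j) (s + 1)) = R (c j + vtx m n (\<kappa> j) s) + R (bm_vec m n (\<kappa> j) s)"
        unfolding vtx_add1[OF n] add.assoc[symmetric] by (rule R_add)
      then show ?thesis unfolding v by (simp only: add_right_cancel)
    qed
    show ?thesis
    proof (induction s rule: int_induct[where k = 0])
      case base
      show ?case by (simp add: c'_def)
    next
      case (step1 s)
      then show ?case using step[of s] by simp
    next
      case (step2 s)
      then show ?case using step[of "s - 1"] by simp
    qed
  qed
  have pos': "c' j + vtx m n (\<beta> (\<kappa> j)) (g s + 1) = R (c j + vtx m n (\<kappa> j) (s + 1))" for j s
    using pos[of j "s + 1"] by (simp add: g_def algebra_simps)
  have md: "vtx m n k (s mod N) = vtx m n k s" "vtx m n k (s mod N + 1) = vtx m n k (s + 1)"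
    "bm_vec m n k (s mod N) = bm_vec m n k s" for k s
    unfolding N_def using n0 by (auto intro: vtx_mod bm_vec_mod vtx_cong simp: mod_add_left_eq)
  have "developed m n (R d) (\<lambda>j. \<beta> (\<kappa> j)) c' \<tau> (\<lambda>j. g (f j) mod N) (\<lambda>j. g (e j) mod N) (\<sigma> \<circ> w)"
    unfolding developed_def md comp_def
  proof (intro conjI allI)
    fix j
    note t' = developedD(1-5)[OF t, of j]
    have k: "\<kappa> j < m" by (rule crosses_bounds(1)[OF t'(4)])
    show "\<tau> j \<le> \<tau> (j + 1)" by (rule t')
    show "of_real (\<tau> (j + 1)) * R d \<in> open_segment
       (c' j + vtx m n (\<beta> (\<kappa> j)) (g (e j))) (c' j + vtx m n (\<beta> (\<kappa> j)) (g (e j) + 1))"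
      unfolding pos pos' R_scale[symmetric] open_segment_linear_image[OF lin] by (rule imageI[OF t'(2)])
    show "Im (cnj (bm_vec m n (\<beta> (\<kappa> j)) (g (e j))) * R d) < 0"
      unfolding \<beta>[OF k] R_cross by (rule t')
    show "crosses m n (\<sigma> (w j)) (\<beta> (\<kappa> j)) (g (e j) mod N) (\<beta> (\<kappa> (j + 1))) (g (f (j + 1)) mod N)"
      by (rule cr[OF t'(4)])
    show "c' (j + 1) + vtx m n (\<beta> (\<kappa> (j + 1))) (g (f (j + 1)) + 1) = c' j + vtx m n (\<beta> (\<kappa> j)) (g (e j))"
      unfolding pos pos' using developedD(5)[OF t, of j] by simp
  qed (rule developedD[OF t])+
  then show ?thesis unfolding R_def by blast
qed

section \<open>Symmetries of the gluing and the permutations of labels they induce\<close>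

lemma label_exists:
  assumes "right_side n k e" "0 \<le> e" "e < 2 * int n" "Suc k < m"
  shows "\<exists>l. glued m n l k e (Suc k) ((e + int n) mod (2 * int n))"
proof -
  have per: "(1 - int s) mod (2 * int n) = e" if "int s = 2 * int n + 1 - e" for s
  proof -
    have "(e - 2 * int n) mod (2 * int n) = (e - 2 * int n + 2 * int n) mod (2 * int n)" by (simp only: mod_add_self2)
    then show ?thesis using that assms(2,3) by simp
  qed
  \<comment> \<open>The two formulas of \<open>side_of_label\<close> solved for s: e = s for e in
    1..n, and e congruent to 1 - s otherwise, with s = 1 for e = 0.\<close>
  define s where "s = nat (if 1 \<le> e \<and> e \<le> int n then e else if e = 0 then 1 else 2 * int n + 1 - e)"
  have "s \<in> {1..n}" using assms(2,3) by (auto simp: s_def)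
  moreover have "e = side_of_label n k s"
  proof (cases "1 \<le> e \<and> e \<le> int n")
    case True
    then have "int s = e" "odd s \<longleftrightarrow> odd e" by (simp_all add: s_def even_nat_iff)
    then show ?thesis using assms(1-3) by (auto simp: side_of_label_def right_side_def)
  next
    case False
    then consider "e = 0" "s = 1" | "int s = 2 * int n + 1 - e" using assms(2,3) by (auto simp: s_def)
    then show ?thesis
    proof cases
      case 1
      then show ?thesis using assms(1) by (auto simp: side_of_label_def right_side_def)
    next
      case 2
      then have "odd s \<longleftrightarrow> even e" by presburger
      then show ?thesis using assms(1) per[OF 2] by (auto simp: side_of_label_def right_side_def)
    qed
  qed
  ultimately show ?thesis using assms unfolding glued_def by blast
qed

text \<open>The larger polygon number is r. Only one of the two sides has its index in 1..n; it
  determines \<open>side_index\<close> and \<open>poly_before\<close>, and the latter gives the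
  parity of c, so c is known.\<close>

lemma crosses_label_unique:
  assumes "crosses m n l k e k' e'" "crosses m n l' k e k' e'"
  shows "l = l'"
proof -
  obtain r c where 1: "1 \<le> r" "r < m" "1 \<le> c" "c \<le> n" "l = vertex n r c"
    "(k = poly_before r c \<and> e = side_index n r c \<and>
      k' = poly_after r c \<and> e' = (side_index n r c + int n) mod (2 * int n)) \<or>
     (k' = poly_before r c \<and> e' = side_index n r c \<and>
      k = poly_after r c \<and> e = (side_index n r c + int n) mod (2 * int n))"
    by (rule crosses_cases[OF assms(1)])
  obtain r' c' where 2: "1 \<le> r'" "r' < m" "1 \<le> c'" "c' \<le> n" "l' = vertex n r' c'"
    "(k = poly_before r' c' \<and> e = side_index n r' c' \<and>
      k' = poly_after r' c' \<and> e' = (side_index n r' c' + int n) mod (2 * int n)) \<or>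
     (k' = poly_before r' c' \<and> e' = side_index n r' c' \<and>
      k = poly_after r' c' \<and> e = (side_index n r' c' + int n) mod (2 * int n))"
    by (rule crosses_cases[OF assms(2)])
  have not_low: "\<not> (1 \<le> (x + int n) mod (2 * int n) \<and> (x + int n) mod (2 * int n) \<le> int n)"
    if "1 \<le> x" "x \<le> int n" for x
  proof (cases "x = int n")
    case False
    then have "(x + int n) mod (2 * int n) = x + int n" using that by (intro mod_pos_pos_trivial) auto
    then show ?thesis using that by simp
  qed simp
  have r: "r = max k k'" "r' = max k k'" using 1 2 by (auto simp: poly_before_def poly_after_def split: if_splits)
  note b = side_index_bounds[OF 1(3,4), of r] side_index_bounds[OF 2(3,4), of r']
  have nb: "\<not> (1 \<le> (side_index n r c + int n) mod (2 * int n) \<and> (side_index n r c + int n) mod (2 * int n) \<le> int n)"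
    "\<not> (1 \<le> (side_index n r' c' + int n) mod (2 * int n) \<and> (side_index n r' c' + int n) mod (2 * int n) \<le> int n)"
    using not_low b by blast+
  have "side_index n r c = side_index n r c'" "poly_before r c = poly_before r c'"
    using 1(6) 2(6) nb b r by metis+
  then have "c = c'"
    using 1(1) unfolding side_index_def poly_before_def by (auto split: if_splits)
  then show ?thesis using 1 2 r by simp
qed

lemma crosses_sides_unique:
  assumes "crosses m n l k e k' e'" "crosses m n l a x a' x'"
  shows "(a = k \<and> x = e \<and> a' = k' \<and> x' = e') \<or> (a = k' \<and> x = e' \<and> a' = k \<and> x' = e)"
proof -
  obtain r c where 1: "1 \<le> r" "r < m" "1 \<le> c" "c \<le> n" "l = vertex n r c"
    "(k = poly_before r c \<and> e = side_index n r c \<and>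
      k' = poly_after r c \<and> e' = (side_index n r c + int n) mod (2 * int n)) \<or>
     (k' = poly_before r c \<and> e' = side_index n r c \<and>
      k = poly_after r c \<and> e = (side_index n r c + int n) mod (2 * int n))"
    by (rule crosses_cases[OF assms(1)])
  obtain r' c' where 2: "1 \<le> r'" "r' < m" "1 \<le> c'" "c' \<le> n" "l = vertex n r' c'"
    "(a = poly_before r' c' \<and> x = side_index n r' c' \<and>
      a' = poly_after r' c' \<and> x' = (side_index n r' c' + int n) mod (2 * int n)) \<or>
     (a' = poly_before r' c' \<and> x' = side_index n r' c' \<and>
      a = poly_after r' c' \<and> x = (side_index n r' c' + int n) mod (2 * int n))"
    by (rule crosses_cases[OF assms(2)])
  have "r = r' \<and> c = c'" using vertex_inj[of n r c r' c'] 1 2 by simp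
  then show ?thesis using 1(6) 2(6) by blast
qed

lemma crosses_iff_label: "(\<exists>k e k' e'. crosses m n l k e k' e') \<longleftrightarrow> l \<in> {1..n * (m - 1)}"
proof
  assume "\<exists>k e k' e'. crosses m n l k e k' e'"
  then obtain r c where rc: "1 \<le> r" "r < m" "1 \<le> c" "c \<le> n" "l = vertex n r c"
    by (metis crosses_cases)
  then have "(r - 1) * n + n \<le> (m - 1) * n"
    by (metis Suc_diff_1 Suc_le_mono add.commute less_eq_Suc_le mult_Suc mult_le_mono1 le_trans
        diff_le_mono diff_Suc_1 less_le_trans zero_less_one)
  moreover have "1 \<le> (if odd r then c else n + 1 - c)" "(if odd r then c else n + 1 - c) \<le> n" using rc by auto
  ultimately show "l \<in> {1..n * (m - 1)}" unfolding rc(5) using rc by (auto simp: vertex_eq mult.commute)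
next
  assume l: "l \<in> {1..n * (m - 1)}"
  then have n: "n > 0" by (cases n) auto
  define k s where "k = (l - 1) div n" and "s = (l - 1) mod n + 1"
  have "l - 1 = k * n + (s - 1)" by (simp add: k_def s_def)
  then have ls: "l = k * n + s" using l by (simp add: s_def)
  have "s \<in> {1..n}" using n by (auto simp: s_def Suc_le_eq)
  have "l - 1 < (m - 1) * n" using l by (auto simp: mult.commute)
  then have "k < m - 1" unfolding k_def using n by (simp add: less_mult_imp_div_less)
  define e where "e = side_of_label n k s"
  define c where "c = (if even k then s else n + 1 - s)"
  have c: "1 \<le> c" "c \<le> n" "s = (if even k then c else n + 1 - c)" using \<open>s \<in> {1..n}\<close> by (auto simp: c_def)
  have "right_side n k e" using side_of_label_vertex(3)[OF c(1,2), of k] unfolding c(3)[symmetric] e_def .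
  moreover have "0 \<le> e" "e < 2 * int n" using n by (simp_all add: e_def side_of_label_def)
  ultimately have "glued m n l k e (Suc k) ((e + int n) mod (2 * int n))"
    unfolding glued_def using \<open>k < m - 1\<close> \<open>s \<in> {1..n}\<close> ls e_def by auto
  then show "\<exists>k e k' e'. crosses m n l k e k' e'" unfolding crosses_def by blast
qed

text \<open>The image of a label is well defined because the label determines its two glued sides,
  and injective because the sides determine the label. On a finite set of labels this
  suffices.\<close>

lemma induced_permI:
  assumes \<beta>: "bij_betw \<beta> {..<m} {..<m}"
    and vec: "\<And>k s. k < m \<Longrightarrow> bm_vec m n (\<beta> k) (g s) = T (bm_vec m n k s)"
    and inj: "\<And>x y. 0 \<le> x \<Longrightarrow> x < 2 * int n \<Longrightarrow> 0 \<le> y \<Longrightarrow> y < 2 * int n \<Longrightarrow>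
      g x mod (2 * int n) = g y mod (2 * int n) \<Longrightarrow> x = y"
    and ex: "\<And>l k e k' e'. glued m n l k e k' e' \<Longrightarrow>
      \<exists>l'. crosses m n l' (\<beta> k) (g e mod (2 * int n)) (\<beta> k') (g e' mod (2 * int n))"
  shows "\<exists>\<sigma>. induced_perm m n T g \<sigma>"
proof -
  define L where "L = {1..n * (m - 1)}"
  have L: "l \<in> L \<longleftrightarrow> (\<exists>k e k' e'. crosses m n l k e k' e')" for l by (simp only: L_def crosses_iff_label)
  define img where "img l l' \<longleftrightarrow> (\<exists>k e k' e'. crosses m n l k e k' e' \<and>
      crosses m n l' (\<beta> k) (g e mod (2 * int n)) (\<beta> k') (g e' mod (2 * int n)))" for l l'
  have ex': "\<exists>l'. img l l'" if l: "l \<in> L" for l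
  proof -
    obtain k e k' e' where "crosses m n l k e k' e'" using l unfolding L by blast
    then obtain k e k' e' where "glued m n l k e k' e'" unfolding crosses_def by blast
    then show ?thesis using ex[of l k e k' e'] unfolding img_def crosses_def[of m n l] by blast
  qed
  define \<sigma> where "\<sigma> l = (if l \<in> L then SOME l'. img l l' else l)" for l
  have \<sigma>: "img l (\<sigma> l)" if "l \<in> L" for l
    using someI_ex[OF ex'[OF that]] that by (simp add: \<sigma>_def)
  have cr: "crosses m n (\<sigma> l) (\<beta> k) (g e mod (2 * int n)) (\<beta> k') (g e' mod (2 * int n))"
    if x: "crosses m n l k e k' e'" for l k e k' e'
  proof -
    have "l \<in> L" using x unfolding L by blast
    from \<sigma>[OF this] obtain a x a' x' where y: "crosses m n l a x a' x'"
      "crosses m n (\<sigma> l) (\<beta> a) (g x mod (2 * int n)) (\<beta> a') (g x' mod (2 * int n))"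
      unfolding img_def by blast
    from crosses_sides_unique[OF y(1) x] y(2) show ?thesis by (metis crosses_sym)
  qed
  have inj\<beta>: "k = k'" if "\<beta> k = \<beta> k'" "k < m" "k' < m" for k k'
    using that \<beta> by (auto simp: bij_betw_def inj_on_def)
  have "inj_on \<sigma> L"
  proof (rule inj_onI)
    fix l1 l2 assume l: "l1 \<in> L" "l2 \<in> L" "\<sigma> l1 = \<sigma> l2"
    obtain k e k' e' where 1: "crosses m n l1 k e k' e'" using l(1) unfolding L by blast
    obtain a x a' x' where 2: "crosses m n l2 a x a' x'" using l(2) unfolding L by blast
    note b = crosses_bounds[OF 1] crosses_bounds[OF 2]
    from crosses_sides_unique[OF cr[OF 1] cr[OF 2, folded l(3)]]
    have "(a = k \<and> x = e \<and> a' = k' \<and> x' = e') \<or> (a = k' \<and> x = e' \<and> a' = k \<and> x' = e)"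
      using inj\<beta> inj b by metis
    then have "crosses m n l2 k e k' e'" using 2 crosses_sym by metis
    then show "l1 = l2" using crosses_label_unique[OF 1] by blast
  qed
  moreover have "\<sigma> ` L \<subseteq> L"
  proof
    fix y assume "y \<in> \<sigma> ` L"
    then obtain l where "l \<in> L" "y = \<sigma> l" by blast
    then show "y \<in> L" using \<sigma>[of l] unfolding img_def L by blast
  qed
  ultimately have "bij_betw \<sigma> L L"
    by (simp add: bij_betw_def card_image card_subset_eq L_def)
  then have "\<sigma> permutes L" by (rule bij_imp_permutes) (simp add: \<sigma>_def)
  then show ?thesis
    unfolding induced_perm_def L_def using \<beta> vec cr by blast
qed

lemma right_side_left:
  assumes "glued m n l k e k' e'"
  shows "\<not> right_side n k' e'"
  using assms right_side_glued[of n k e] by (auto simp: glued_def)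

lemma induced_perm_id:
  assumes "n > 0" and vec: "\<And>s. T (cis (of_int s * pi / n)) = cis (of_int (g s) * pi / n)"
    and T: "\<And>a z. T (of_real a * z) = of_real a * T z"
    and right: "\<And>k s. right_side n k (g s) = right_side n k s"
    and g: "\<And>x y. g x mod (2 * int n) = g y mod (2 * int n) \<Longrightarrow> x mod (2 * int n) = y mod (2 * int n)"
      "\<And>x. g (x + int n) mod (2 * int n) = (g x + int n) mod (2 * int n)"
      "\<And>x. g (x mod (2 * int n)) mod (2 * int n) = g x mod (2 * int n)"
  shows "\<exists>\<sigma>. induced_perm m n T g \<sigma>"
proof (rule induced_permI[where \<beta> = "\<lambda>k. k"])
  show "bij_betw (\<lambda>k. k) {..<m} {..<m}" by (simp add: bij_betw_def)
  show "bm_vec m n k (g s) = T (bm_vec m n k s)" for k s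
    by (simp add: bm_vec_slen T vec slen_def right)
  show "x = y" if "0 \<le> x" "x < 2 * int n" "0 \<le> y" "y < 2 * int n"
      "g x mod (2 * int n) = g y mod (2 * int n)" for x y
    using g(1)[of x y] that by simp
  show "\<exists>l'. crosses m n l' k (g e mod (2 * int n)) k' (g e' mod (2 * int n))"
    if gl: "glued m n l k e k' e'" for l k e k' e'
  proof -
    have "right_side n k (g e mod (2 * int n))" using gl by (simp add: glued_def right)
    moreover have "Suc k < m" "k' = Suc k" using gl by (simp_all add: glued_def)
    moreover have "(g e mod (2 * int n) + int n) mod (2 * int n) = g e' mod (2 * int n)"
      using g(2)[of e] g(3)[of "e + int n"] gl by (simp add: glued_def mod_add_left_eq)
    ultimately show ?thesis
      using label_exists[of n k "g e mod (2 * int n)" m] assms(1) by (auto simp: crosses_def)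
  qed
qed

text \<open>As sin (pi - x) = sin x, right sides of P(m - 1 - k) are as long as left sides of P(k).
  A map that exchanges left and right must therefore reverse the order of the polygons.\<close>

lemma induced_perm_exchange:
  assumes "n > 0" and vec: "\<And>s. T (cis (of_int s * pi / n)) = cis (of_int (g s) * pi / n)"
    and T: "\<And>a z. T (of_real a * z) = of_real a * T z"
    and right: "\<And>k s. k < m \<Longrightarrow> right_side n (m - 1 - k) (g s) \<longleftrightarrow> \<not> right_side n k s"
    and g: "\<And>x y. g x mod (2 * int n) = g y mod (2 * int n) \<Longrightarrow> x mod (2 * int n) = y mod (2 * int n)"
      "\<And>x. g (x + int n) mod (2 * int n) = (g x + int n) mod (2 * int n)"
      "\<And>x. g (x mod (2 * int n)) mod (2 * int n) = g x mod (2 * int n)"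
  shows "\<exists>\<sigma>. induced_perm m n T g \<sigma>"
proof (rule induced_permI[where \<beta> = "\<lambda>k. m - 1 - k"])
  show "bij_betw (\<lambda>k. m - 1 - k) {..<m} {..<m}"
    by (rule bij_betwI[where g = "\<lambda>k. m - 1 - k"]) auto
  show "bm_vec m n (m - 1 - k) (g s) = T (bm_vec m n k s)" if k: "k < m" for k s
  proof -
    have i: "int (m - 1 - k) = int m - (int k + 1)" "int m - (int k + 1) + 1 = int m - int k" using k by simp_all
    have m: "m > 0" using k by simp
    have "slen m n (m - 1 - k) (g s) = slen m n k s"
      unfolding slen_def right[OF k] i sn_supplement[OF m] by simp
    then show ?thesis by (simp add: bm_vec_slen T vec)
  qed
  show "x = y" if "0 \<le> x" "x < 2 * int n" "0 \<le> y" "y < 2 * int n"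
      "g x mod (2 * int n) = g y mod (2 * int n)" for x y
    using g(1)[of x y] that by simp
  show "\<exists>l'. crosses m n l' (m - 1 - k) (g e mod (2 * int n)) (m - 1 - k') (g e' mod (2 * int n))"
    if gl: "glued m n l k e k' e'" for l k e k' e'
  proof -
    have k: "Suc k < m" "k' = Suc k" using gl by (simp_all add: glued_def)
    have "right_side n (m - 1 - k') (g e' mod (2 * int n))"
      using right[of k' e'] right_side_left[OF gl] k by simp
    moreover have "Suc (m - 1 - k') = m - 1 - k" using k by simp
    moreover have "(g e' mod (2 * int n) + int n) mod (2 * int n) = g e mod (2 * int n)"
    proof -
      have "(g e' mod (2 * int n) + int n) mod (2 * int n) = (g (e + int n) + int n) mod (2 * int n)"
        using g(3)[of "e + int n"] gl by (simp add: glued_def mod_add_left_eq)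
      also have "\<dots> = (g e + int n + int n) mod (2 * int n)"
        using g(2)[of e] by (metis mod_add_left_eq)
      also have "\<dots> = (g e + 2 * int n) mod (2 * int n)" by (simp add: add.assoc)
      also have "\<dots> = g e mod (2 * int n)" by (rule mod_add_self2)
      finally show ?thesis .
    qed
    ultimately obtain l' where "glued m n l' (m - 1 - k') (g e' mod (2 * int n)) (m - 1 - k) (g e mod (2 * int n))"
      using label_exists[of n "m - 1 - k'" "g e' mod (2 * int n)" m] assms(1) k by auto
    then show ?thesis unfolding crosses_def by blast
  qed
qed

text \<open>The reflection keeps the parity of side indices iff n + i is odd; then each polygon goes
  to itself. Otherwise parities are exchanged, which exchanges left and right between P(k) and P(m -
  1 - k) if n is odd, or if m is odd and so both polygons follow the same convention. For n and i
  even, the rotation keeps parities.\<close>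

lemma label_perm_exists:
  assumes "m \<ge> 2" "n \<ge> 2"
  shows "(\<exists>\<sigma>. reflection_perm m n i \<sigma>) \<or> (\<exists>\<sigma>. rotation_perm m n i \<sigma>)"
proof -
  have n: "n > 0" using assms by simp
  let ?g = "\<lambda>s. int i + 1 + int n - s" and ?T = "\<lambda>z. - reflection n i z"
  have vec: "?T (cis (of_int s * pi / n)) = cis (of_int (?g s) * pi / n)" for s
  proof -
    have "of_int (?g s) * pi / n = real (i + 1) * pi / n - of_int s * pi / n + pi"
      using n by (simp add: field_simps)
    then show ?thesis by (simp add: reflection_def cis_cnj cis_mult flip: cis_mult[of _ pi])
  qed
  have T: "?T (of_real a * z) = of_real a * ?T z" for a z by (simp add: reflection_def)
  have g: "?g x mod (2 * int n) = ?g y mod (2 * int n) \<Longrightarrow> x mod (2 * int n) = y mod (2 * int n)"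
    "?g (x + int n) mod (2 * int n) = (?g x + int n) mod (2 * int n)"
    "?g (x mod (2 * int n)) mod (2 * int n) = ?g x mod (2 * int n)" for x y
  proof -
    show "?g x mod (2 * int n) = ?g y mod (2 * int n) \<Longrightarrow> x mod (2 * int n) = y mod (2 * int n)"
      by (auto simp: mod_eq_dvd_iff dvd_diff_commute)
    show "?g (x + int n) mod (2 * int n) = (?g x + int n) mod (2 * int n)"
      by (simp add: mod_eq_dvd_iff)
    show "?g (x mod (2 * int n)) mod (2 * int n) = ?g x mod (2 * int n)"
      by (rule mod_diff_right_eq)
  qed
  consider "(odd n \<and> even i) \<or> (even n \<and> odd i)" | "(odd n \<and> odd i) \<or> (even n \<and> even i \<and> odd m)"
    | "even n" "even i" by blast
  then show ?thesis
  proof cases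
    case 1
    have "right_side n k (?g s) = right_side n k s" for k s
      using 1 by (auto simp: right_side_def)
    from induced_perm_id[where T = ?T and g = ?g, OF n vec T this g]
    show ?thesis unfolding reflection_perm_def by blast
  next
    case 2
    have "right_side n (m - 1 - k) (?g s) \<longleftrightarrow> \<not> right_side n k s" if "k < m" for k s
      using 2 that by (auto simp: right_side_def)
    from induced_perm_exchange[where T = ?T and g = ?g, OF n vec T this g]
    show ?thesis unfolding reflection_perm_def by blast
  next
    case 3
    let ?h = "\<lambda>s. s - int i"
    let ?R = "\<lambda>z. cis (- (real i * pi / n)) * z"
    have right: "right_side n k (?h s) = right_side n k s" for k s
      using 3 by (auto simp: right_side_def)
    have vec: "?R (cis (of_int s * pi / n)) = cis (of_int (?h s) * pi / n)" for s
      by (simp add: cis_mult diff_divide_distrib left_diff_distrib)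
    have T: "?R (of_real a * z) = of_real a * ?R z" for a z by (simp add: mult.left_commute)
    have h: "?h x mod (2 * int n) = ?h y mod (2 * int n) \<Longrightarrow> x mod (2 * int n) = y mod (2 * int n)"
      "?h (x + int n) mod (2 * int n) = (?h x + int n) mod (2 * int n)"
      "?h (x mod (2 * int n)) mod (2 * int n) = ?h x mod (2 * int n)" for x y
    proof -
      show "?h x mod (2 * int n) = ?h y mod (2 * int n) \<Longrightarrow> x mod (2 * int n) = y mod (2 * int n)"
        by (simp add: mod_eq_dvd_iff)
      show "?h (x + int n) mod (2 * int n) = (?h x + int n) mod (2 * int n)"
        by (simp add: algebra_simps)
      show "?h (x mod (2 * int n)) mod (2 * int n) = ?h x mod (2 * int n)"
        by (rule mod_diff_left_eq)
    qed
    have "\<exists>\<sigma>. induced_perm m n ?R ?h \<sigma>"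
      by (rule induced_perm_id[where T = ?R and g = ?h, OF n vec T right h])
    then show ?thesis unfolding rotation_perm_def by blast
  qed
qed

text \<open>The last bound holds for reflections and rotations alike. Its ends are the opposites of
  the two boundary directions pi/n and 0, which \<open>first_diagram_direction\<close>
  exploits.\<close>

lemma label_perm_normalizes:
  assumes m: "m \<ge> 2" and n: "n \<ge> 2" and i: "i < n"
  obtains \<phi> :: "real \<Rightarrow> real" where
    "\<And>\<theta> w. cutting_sequence m n \<theta> w \<Longrightarrow> cutting_sequence m n (\<phi> \<theta>) (label_perm m n i \<circ> w)"
    "\<And>\<theta>. \<theta> \<in> sector n i \<Longrightarrow> \<phi> \<theta> \<in> sector n 0"
    "\<And>\<theta>. 0 \<le> \<theta> \<Longrightarrow> \<theta> \<le> pi \<Longrightarrow> pi / n - pi \<le> \<phi> \<theta> \<and> \<phi> \<theta> \<le> pi"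
proof (cases "\<exists>\<sigma>. reflection_perm m n i \<sigma>")
  case True
  have r: "reflection_perm m n i (label_perm m n i)"
    using someI_ex[OF True] True by (simp add: label_perm_def)
  let ?\<phi> = "\<lambda>\<theta>. real (i + 1) * pi / n - \<theta>"
  have le: "real (i + 1) * pi / n \<le> pi" "pi / n \<le> real (i + 1) * pi / n"
    using i by (auto simp: divide_simps mult_right_mono)
  show ?thesis
  proof (rule that[of ?\<phi>])
    fix \<theta> w assume "cutting_sequence m n \<theta> w"
    then obtain \<kappa> c \<tau> f e where "developed m n (cis \<theta>) \<kappa> c \<tau> f e w"
      unfolding cutting_sequence_developed[OF n] by blast
    moreover have "reflection n i (cis \<theta>) = cis (?\<phi> \<theta>)" by (simp add: reflection_def cis_cnj cis_mult)
    ultimately show "cutting_sequence m n (?\<phi> \<theta>) (label_perm m n i \<circ> w)"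
      unfolding cutting_sequence_developed[OF n] using developed_reflection[OF n r] by metis
  next
    fix \<theta> assume "\<theta> \<in> sector n i"
    moreover have "real (Suc i) * pi / n - real i * pi / n = pi / n"
      by (simp add: distrib_right add_divide_distrib)
    ultimately show "?\<phi> \<theta> \<in> sector n 0" by (auto simp: sector_def)
  qed (use le in auto)
next
  case False
  then have "\<exists>\<sigma>. rotation_perm m n i \<sigma>" using label_perm_exists[OF m n] by blast
  then have r: "rotation_perm m n i (label_perm m n i)"
    using someI_ex False by (metis label_perm_def)
  let ?\<phi> = "\<lambda>\<theta>. \<theta> - real i * pi / n"
  have "(real i + 1) * pi / n \<le> pi"
    using i by (auto simp: divide_simps mult_right_mono)
  then have le: "real i * pi / n + pi / n \<le> pi" by (simp only: distrib_right add_divide_distrib mult_1)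
  show ?thesis
  proof (rule that[of ?\<phi>])
    fix \<theta> w assume "cutting_sequence m n \<theta> w"
    then obtain \<kappa> c \<tau> f e where "developed m n (cis \<theta>) \<kappa> c \<tau> f e w"
      unfolding cutting_sequence_developed[OF n] by blast
    moreover have "cis (- (real i * pi / n)) * cis \<theta> = cis (?\<phi> \<theta>)" by (simp add: cis_mult)
    ultimately show "cutting_sequence m n (?\<phi> \<theta>) (label_perm m n i \<circ> w)"
      unfolding cutting_sequence_developed[OF n] using developed_rotation[OF n r] by metis
  next
    fix \<theta> assume "\<theta> \<in> sector n i"
    moreover have "real (Suc i) * pi / n - real i * pi / n = pi / n"
      by (simp add: distrib_right add_divide_distrib)
    ultimately show "?\<phi> \<theta> \<in> sector n 0" by (auto simp: sector_def)
  next
    fix \<theta> :: real assume "0 \<le> \<theta>" "\<theta> \<le> pi"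
    moreover have "0 \<le> real i * pi / n" by simp
    ultimately show "pi / n - pi \<le> ?\<phi> \<theta> \<and> ?\<phi> \<theta> \<le> pi" using le by linarith
  qed
qed

section \<open>Sequences admissible in the first diagram\<close>

lemma transition_0_grid_step:
  assumes n: "n \<ge> 2" and tr: "transition m n 0 p p'"
  shows "\<exists>r q r' q'. 1 \<le> r \<and> r < m \<and> 1 \<le> q \<and> q \<le> n \<and> 1 \<le> r' \<and> r' < m \<and> 1 \<le> q' \<and> q' \<le> n \<and>
    p = vertex n r q \<and> p' = vertex n r' q' \<and> grid_step r q r' q'"
proof -
  from tr obtain \<theta> w j where \<theta>: "\<theta> \<in> sector n 0" and w: "cutting_sequence m n \<theta> w" "w j = p" "w (j + 1) = p'"
    unfolding transition_def by blast
  from w(1) obtain \<kappa> c \<tau> f e where t: "developed m n (cis \<theta>) \<kappa> c \<tau> f e w"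
    unfolding cutting_sequence_developed[OF n] by blast
  note cone = in_cone_sector[OF n \<theta>]
  obtain r q where g: "on_grid m n \<kappa> f e w r q" by (rule first_sector_on_grid[OF n t cone])
  show ?thesis
    by (rule exI[of _ "r j"], rule exI[of _ "q j"], rule exI[of _ "r (j + 1)"], rule exI[of _ "q (j + 1)"])
      (use on_gridD(1-5)[OF g, of j] on_gridD(1-5)[OF g, of "j + 1"] w(2,3)
        first_sector_grid_step[OF n t cone g, of j] in simp)
qed

text \<open>M is twice the midpoint of the edge. Turn 0 displaces it in direction 0, since the
  second coordinates cancel, and turn 2 in direction pi/n, since the first ones do; turn 1 displaces
  it by the sum of two chords. The direction d of the trajectory does not enter.\<close>

lemma on_grid_midpoint:
  assumes n: "n \<ge> 2" and t: "developed m n d \<kappa> c \<tau> f e w" and g: "on_grid m n \<kappa> f e w r q"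
    and s: "grid_step (r j) (q j) (r (j + 1)) (q (j + 1))"
  defines "M \<equiv> \<lambda>j. near_end m n \<kappa> c e j + far_end m n \<kappa> c e j"
  shows "in_cone n (M (j + 1) - M j)"
proof -
  define i where "i = int n - e j"
  define k where "k = \<kappa> (j + 1)"
  have k: "k < m" using crosses_bounds(2)[OF developedD(4)[OF t, of j]] by (simp add: k_def)
  have i: "0 \<le> i" "i < int n" using on_gridD(10,11)[OF g, of j] by (auto simp: i_def)
  have e: "1 \<le> e (j + 1)" "e (j + 1) \<le> int n" using on_gridD(10,11)[OF g, of "j + 1"] by auto
  have n0: "n > 0" using n by simp
  have far: "far_end m n \<kappa> c e l = near_end m n \<kappa> c e l + bm_vec m n (\<kappa> l) (e l)" for l
    using far_minus_near[OF n, of m \<kappa> c e l] by (simp add: algebra_simps)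
  note mv = on_grid_moves[OF n t g, of j, folded k_def i_def]
  have b: "bm_vec m n (\<kappa> j) (e j) = - bm_vec m n k (- i)"
  proof -
    have "f (j + 1) = (- i + 2 * int n) mod (2 * int n)"
      using on_gridD(7,9)[OF g, of j] by (simp add: i_def algebra_simps)
    then have "bm_vec m n k (f (j + 1)) = bm_vec m n k (- i)"
      using bm_vec_mod[OF n0] by (metis mod_add_self2)
    then show ?thesis using crosses_bm_vec[OF developedD(4)[OF t, of j]] unfolding k_def by (metis minus_minus)
  qed
  have f0: "far_end m n \<kappa> c e j = near_end m n \<kappa> c e j - bm_vec m n k (- i)"
    using far[of j] unfolding b by simp
  have f1: "far_end m n \<kappa> c e (j + 1) = near_end m n \<kappa> c e (j + 1) + bm_vec m n k (e (j + 1))"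
    unfolding k_def by (rule far)
  note len = slen_nonneg[OF k]
  have xc2: "xc n (2 * x) = 2 * xc n x" for x using xc_linear(4)[of n 2 x] by simp
  note simps = in_cone_def xc_chord[OF n] Im_chord[OF n] xc_bm_vec[OF n0] Im_bm_vec slen_minus1 xc2
  have sm: "sn n (- i - 1) = - sn n (i + 1)" using sn_minus[of n "i + 1"] by (simp del: sn_minus)
  have sn: "0 \<le> sn n i" "0 \<le> sn n (i + 1)" using i by (auto intro!: sn_nonneg)
  have "e (j + 1) + e j - int n \<in> {0, 1, 2}"
    using s grid_step_iff[of "r j" "q j" n "r (j + 1)" "q (j + 1)"]
      on_gridD(1-8)[OF g, of j] on_gridD(1-8)[OF g, of "j + 1"] by simp
  then consider "e (j + 1) + e j - int n = 0" | "e (j + 1) + e j - int n = 1" | "e (j + 1) + e j - int n = 2"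
    by blast
  then show ?thesis
  proof cases
    case 1
    then have ei: "e (j + 1) = i" by (simp add: i_def)
    have "near_end m n \<kappa> c e (j + 1) = near_end m n \<kappa> c e j + chord m n k (i - 1) - bm_vec m n k i"
      using mv(1)[OF 1] f1 unfolding ei by (metis add_diff_cancel_right')
    then have "M (j + 1) - M j = chord m n k (i - 1) + chord m n k (i - 1) - bm_vec m n k i + bm_vec m n k (- i)"
      unfolding M_def mv(1)[OF 1] f0 by simp
    moreover have "0 \<le> sn n (i - 1)" using i e ei by (intro sn_nonneg) auto
    ultimately show ?thesis using sn len by (simp add: simps sm)
  next
    case 2
    have "M (j + 1) - M j = chord m n k (i - 1) + chord m n k i"
      using mv(2,3)[OF 2] by (simp add: M_def)
    then show ?thesis using sn len by (simp add: simps)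
  next
    case 3
    then have ei: "e (j + 1) = i + 2" by (simp add: i_def)
    have "M (j + 1) - M j = chord m n k i + chord m n k i + bm_vec m n k (i + 2) - bm_vec m n k (- i)"
      unfolding M_def f1 ei mv(4)[OF 3] f0 by simp
    moreover have "0 \<le> sn n (i + 2)" using i e ei by (intro sn_nonneg) auto
    moreover have "sn n (i + 2 - 1) = sn n (i + 1)" by (simp add: add.commute)
    ultimately show ?thesis using sn len by (simp add: simps sm)
  qed
qed

lemma sn_abs_le: "\<bar>sn n e\<bar> \<le> 1" by (simp add: sn_def)

text \<open>For L either coordinate, \<open>L (M j)\<close> does not decrease, and it differs by at
  most 1 from \<open>2 * \<tau> (j + 1) * L d\<close>, a coordinate of a side being a product of two
  sines. As the times tend to infinity, \<open>L d\<close> cannot be negative.\<close>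

lemma on_grid_in_cone:
  assumes n: "n \<ge> 2" and t: "developed m n d \<kappa> c \<tau> f e w" and g: "on_grid m n \<kappa> f e w r q"
    and s: "\<And>j. grid_step (r j) (q j) (r (j + 1)) (q (j + 1))"
  shows "in_cone n d"
proof -
  define M where "M j = near_end m n \<kappa> c e j + far_end m n \<kappa> c e j" for j
  note mid = on_grid_midpoint[OF n t g s, folded M_def]
  have limit: "0 \<le> L d"
    if add: "\<And>x y. L (x + y) = L x + L y" and diff: "\<And>x y. L (x - y) = L x - L y"
      and scale: "\<And>a x. L (of_real a * x) = a * L x"
      and mono: "\<And>j. 0 \<le> L (M (j + 1) - M j)" and bd: "\<And>j. \<bar>L (bm_vec m n (\<kappa> j) (e j))\<bar> \<le> 1"
    for L :: "complex \<Rightarrow> real"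
  proof (rule ccontr)
    assume neg: "\<not> 0 \<le> L d"
    \<comment> \<open>After time Z, \<open>\<tau> * L d\<close> is below
      \<open>- (1 + \<bar>L (M 0)\<bar>)\<close>, too small for the bound by
      \<open>L (M 0)\<close>.\<close>
    define Z where "Z = (1 + \<bar>L (M 0)\<bar>) / (- L d)"
    have "eventually (\<lambda>j. Z < \<tau> j) at_top"
      using developedD(6)[OF t] by (simp add: filterlim_at_top_dense)
    then obtain N where N: "\<And>j. N \<le> j \<Longrightarrow> Z < \<tau> j" by (auto simp: eventually_at_top_linorder)
    define j where "j = max N 0"
    have "L (M 0) \<le> L (M l)" if "0 \<le> l" for l
      using that
    proof (induction l rule: int_ge_induct)
      case (step l)
      then show ?case using mono[of l] diff[of "M (l + 1)" "M l"] by simp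
    qed simp
    then have M: "L (M 0) \<le> L (M j)" by (simp add: j_def)
    obtain u where u: "0 < u" "u < 1"
      and p1: "of_real (\<tau> (j + 1)) * d = near_end m n \<kappa> c e j + of_real u * bm_vec m n (\<kappa> j) (e j)"
      and p2: "of_real (\<tau> (j + 1)) * d = far_end m n \<kappa> c e j - of_real (1 - u) * bm_vec m n (\<kappa> j) (e j)"
      by (rule developed_ends[OF n t, of j])
    let ?b = "L (bm_vec m n (\<kappa> j) (e j))"
    define U V X where "U = u * ?b" and "V = (1 - u) * ?b" and "X = \<tau> (j + 1) * L d"
    have "X = L (near_end m n \<kappa> c e j) + U" "X = L (far_end m n \<kappa> c e j) - V"
      using arg_cong[OF p1, of L] arg_cong[OF p2, of L] unfolding add diff scale X_def U_def V_def .
    then have "2 * X = L (M j) + U - V" unfolding M_def add by simp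
    moreover have "u * - 1 \<le> U" unfolding U_def by (rule mult_left_mono) (use bd[of j] u in auto)
    moreover have "V \<le> (1 - u) * 1" unfolding V_def by (rule mult_left_mono) (use bd[of j] u in auto)
    ultimately have "- 1 - \<bar>L (M 0)\<bar> \<le> 2 * X" using M by simp
    moreover have "Z < \<tau> (j + 1)" by (rule N) (simp add: j_def)
    then have "X < Z * L d" unfolding X_def using neg by (simp add: mult_less_cancel_right_disj)
    moreover have "Z * L d = - (1 + \<bar>L (M 0)\<bar>)" using neg by (simp add: Z_def)
    ultimately show False by linarith
  qed
  have sl: "\<bar>slen m n k s\<bar> \<le> 1" for k s by (simp add: slen_def sn_abs_le)
  have bd: "\<bar>slen m n k s * sn n s'\<bar> \<le> 1" for k s s'
    unfolding abs_mult by (rule mult_le_one[OF sl _ sn_abs_le]) simp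
  have n0: "n > 0" using n by simp
  have "0 \<le> xc n d"
  proof (rule limit[of "xc n"])
    show "0 \<le> xc n (M (j + 1) - M j)" for j using mid[of j] by (simp only: in_cone_def)
    show "\<bar>xc n (bm_vec m n (\<kappa> j) (e j))\<bar> \<le> 1" for j
      unfolding xc_bm_vec[OF n0] abs_minus_cancel by (rule bd)
  qed simp_all
  moreover have "0 \<le> Im d"
  proof (rule limit[of Im])
    show "0 \<le> Im (M (j + 1) - M j)" for j using mid[of j] by (simp only: in_cone_def)
    show "\<bar>Im (bm_vec m n (\<kappa> j) (e j))\<bar> \<le> 1" for j
      unfolding Im_bm_vec by (rule bd)
  qed simp_all
  ultimately show ?thesis by (simp add: in_cone_def)
qed

lemma poly_before_neq_after: "1 \<le> r \<Longrightarrow> poly_before r q \<noteq> poly_after r q"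
  by (auto simp: poly_before_def poly_after_def)

text \<open>A trajectory along a path in the grid crosses either all edges in the sense of the first sector
  or all in the opposite sense; vertical arrows exclude the latter.\<close>

lemma grid_path_orientation:
  assumes n: "n \<ge> 2" and t: "developed m n d \<kappa> c \<tau> f e w"
    and b: "\<And>j. 1 \<le> r j \<and> r j < m \<and> 1 \<le> q j \<and> q j \<le> n \<and> w j = vertex n (r j) (q j)"
    and s: "\<And>j. grid_step (r j) (q j) (r (j + 1)) (q (j + 1))"
  obtains "on_grid m n \<kappa> f e w r q"
  | "on_grid m n (\<lambda>j. \<kappa> (1 - j)) (\<lambda>j. e (1 - j)) (\<lambda>j. f (1 - j)) (\<lambda>j. w (- j)) (\<lambda>j. r (- j)) (\<lambda>j. q (- j))"
    "\<And>j. r (j + 1) = r j \<and> (q (j + 1) = q j + 1 \<or> q j = q (j + 1) + 1)"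
proof -
  define fwd where "fwd j \<longleftrightarrow> \<kappa> j = poly_before (r j) (q j) \<and> e j = side_index n (r j) (q j) \<and>
      \<kappa> (j + 1) = poly_after (r j) (q j) \<and> f (j + 1) = (side_index n (r j) (q j) + int n) mod (2 * int n)" for j
  define bwd where "bwd j \<longleftrightarrow> \<kappa> (j + 1) = poly_before (r j) (q j) \<and> f (j + 1) = side_index n (r j) (q j) \<and>
      \<kappa> j = poly_after (r j) (q j) \<and> e j = (side_index n (r j) (q j) + int n) mod (2 * int n)" for j
  have fb: "fwd j \<or> bwd j" for j
  proof -
    from developedD(4)[OF t, of j] obtain r' q' where rq: "1 \<le> r'" "r' < m" "1 \<le> q'" "q' \<le> n" "w j = vertex n r' q'" and
     *: "(\<kappa> j = poly_before r' q' \<and> e j = side_index n r' q' \<and>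
      \<kappa> (j + 1) = poly_after r' q' \<and> f (j + 1) = (side_index n r' q' + int n) mod (2 * int n)) \<or>
      (\<kappa> (j + 1) = poly_before r' q' \<and> f (j + 1) = side_index n r' q' \<and>
      \<kappa> j = poly_after r' q' \<and> e j = (side_index n r' q' + int n) mod (2 * int n))"
      by (rule crosses_cases)
    have "r' = r j \<and> q' = q j" using vertex_inj[of n r' q' "r j" "q j"] rq b[of j] by simp
    then show ?thesis using * unfolding fwd_def bwd_def by blast
  qed
  have poly: "poly_before (r (j + 1)) (q (j + 1)) = poly_after (r j) (q j)" for j
    using grid_step_poly[OF s] b by blast
  have step: "fwd j \<longleftrightarrow> fwd (j + 1)" for j
  proof -
    have "poly_before (r j) (q j) \<noteq> poly_after (r j) (q j)"
      "poly_before (r (j + 1)) (q (j + 1)) \<noteq> poly_after (r (j + 1)) (q (j + 1))"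
      using poly_before_neq_after b by blast+
    then show ?thesis using fb[of j] fb[of "j + 1"] poly[of j] unfolding fwd_def bwd_def by metis
  qed
  have all: "fwd j \<longleftrightarrow> fwd 0" for j
  proof (induction j rule: int_induct[where k = 0])
    case base
    show ?case ..
  next
    case (step1 j)
    then show ?case using step[of j] by simp
  next
    case (step2 j)
    then show ?case using step[of "j - 1"] by simp
  qed
  show ?thesis
  proof (cases "fwd 0")
    case True
    then have "on_grid m n \<kappa> f e w r q"
      unfolding on_grid_def using all b unfolding fwd_def by blast
    then show ?thesis by (rule that(1))
  next
    case False
    then have bw: "bwd j" for j using all fb by blast
    have "on_grid m n (\<lambda>j. \<kappa> (1 - j)) (\<lambda>j. e (1 - j)) (\<lambda>j. f (1 - j)) (\<lambda>j. w (- j)) (\<lambda>j. r (- j)) (\<lambda>j. q (- j))"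
      unfolding on_grid_def
    proof
      fix j :: int
      have j: "1 - (j + 1) = - j" "1 - j = - j + 1" by simp_all
      show "1 \<le> r (- j) \<and> r (- j) < m \<and> 1 \<le> q (- j) \<and> q (- j) \<le> n \<and> w (- j) = vertex n (r (- j)) (q (- j)) \<and>
         \<kappa> (1 - j) = poly_before (r (- j)) (q (- j)) \<and> f (1 - j) = side_index n (r (- j)) (q (- j)) \<and>
         \<kappa> (1 - (j + 1)) = poly_after (r (- j)) (q (- j)) \<and>
         e (1 - (j + 1)) = (side_index n (r (- j)) (q (- j)) + int n) mod (2 * int n)"
        unfolding j using b[of "- j"] bw[of "- j"] unfolding bwd_def by blast
    qed
    moreover have "r (j + 1) = r j \<and> (q (j + 1) = q j + 1 \<or> q j = q (j + 1) + 1)" for j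
    proof (rule ccontr)
      assume "\<not> ?thesis"
      then have v: "q (j + 1) = q j" "if odd (q j) then r (j + 1) = r j + 1 else r j = r (j + 1) + 1"
        using s[of j] unfolding grid_step_def by blast+
      have "poly_before (r j) (q j) = poly_after (r (j + 1)) (q (j + 1))"
        using bw[of j] bw[of "j + 1"] unfolding bwd_def by simp
      then show False using v b[of j] b[of "j + 1"] unfolding poly_before_def poly_after_def
        by (auto split: if_splits)
    qed
    ultimately show ?thesis by (rule that(2))
  qed
qed

text \<open>A chord crossed at turn 2 would have to point strictly to the right of d, one crossed at
  turn 0 strictly to the left. Chords lie in the first sector, so direction 0 leaves only turn 0 and
  direction pi/n only turn 2. With r fixed and the parity of r + q alternating, equal turns go back
  and forth between two columns.\<close>

lemma (in first_sector_trajectory) horizontal_periodic: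
  assumes hor: "\<And>j. horizontal j" and d: "d = 1 \<or> d = cis (pi / n)"
  shows "w (j + 2) = w j"
proof -
  have ch: "0 \<le> sn n (int n - e l)" "0 \<le> sn n (int n - e l + 1)" "\<kappa> (l + 1) < m" for l
    using on_gridD(10,11)[OF grid, of l] crosses_bounds(2)[OF developedD(4)[OF traj, of l]]
    by (auto intro!: sn_nonneg)
  have "(\<forall>l. turn l = 0) \<or> (\<forall>l. turn l = 2)"
    using d
  proof
    assume d: "d = 1"
    have "turn l \<noteq> 2" for l
    proof
      assume 2: "turn l = 2"
      have "A (l + 1) = B l + chord m n (\<kappa> (l + 1)) (int n - e l)"
        by (rule on_grid_moves(4)[OF n traj grid]) (use 2 in \<open>simp add: turn_def\<close>)
      then have "height d (chord m n (\<kappa> (l + 1)) (int n - e l)) < 0"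
        using horizontal_crossing(1)[OF hor, of l] 2 by (simp add: right_end_def left_end_def)
      moreover have "0 \<le> height d (chord m n (\<kappa> (l + 1)) (int n - e l))"
        using ch[of l] slen_nonneg[OF ch(3)] by (simp add: height_def d Im_chord[OF n])
      ultimately show False by simp
    qed
    then show ?thesis using hor unfolding horizontal_def by blast
  next
    assume d: "d = cis (pi / n)"
    have "turn l \<noteq> 0" for l
    proof
      assume 0: "turn l = 0"
      let ?c = "chord m n (\<kappa> (l + 1)) (int n - e l - 1)"
      have "B (l + 1) = A l + ?c"
        by (rule on_grid_moves(1)[OF n traj grid]) (use 0 in \<open>simp add: turn_def\<close>)
      then have "0 < height d ?c"
        using horizontal_crossing(1)[OF hor, of l] 0 by (simp add: right_end_def left_end_def)
      moreover have "0 \<le> xc n ?c" "xc n d = 0" "0 \<le> Im d"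
        using ch[of l] slen_nonneg[OF ch(3), of n] cone by (simp_all add: xc_chord[OF n] d xc_cis in_cone_def)
      then have "height d ?c * sin (pi / n) \<le> 0" by (simp add: height_coords)
      ultimately show False using sin_pi_over_pos[OF n] by (simp add: mult_le_0_iff)
    qed
    then show ?thesis using hor unfolding horizontal_def by blast
  qed
  moreover have "odd (r l + q l) \<longleftrightarrow> even (r (l + 1) + q (l + 1))" for l
    using hor[of l] unfolding horizontal_iff by auto
  ultimately have "r (j + 1 + 1) = r j \<and> q (j + 1 + 1) = q j"
  proof (elim disjE)
    assume "\<forall>l. turn l = 0" and odd: "\<And>l. odd (r l + q l) \<longleftrightarrow> even (r (l + 1) + q (l + 1))"
    then show ?thesis using turn_0[of j] turn_0[of "j + 1"] odd[of j] by (cases "odd (r j + q j)") simp_all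
  next
    assume "\<forall>l. turn l = 2" and odd: "\<And>l. odd (r l + q l) \<longleftrightarrow> even (r (l + 1) + q (l + 1))"
    then show ?thesis using turn_2[of j] turn_2[of "j + 1"] odd[of j] by (cases "odd (r j + q j)") simp_all
  qed
  then show ?thesis using on_gridD(5)[OF grid, of j] on_gridD(5)[OF grid, of "j + 1 + 1"] by (simp add: add.assoc)
qed

lemma period_2_reflect:
  fixes w :: "int \<Rightarrow> 'a"
  assumes "\<And>j. w (j + 2) = w j"
  shows "w (- j) = w j"
proof -
  have "w (j + 2 * k) = w j" for j k
  proof (induction k rule: int_induct[where k = 0])
    case base
    show ?case by simp
  next
    case (step1 k)
    then show ?case using assms[of "j + 2 * k"] by (simp add: algebra_simps)
  next
    case (step2 k)
    then show ?case using assms[of "j + 2 * (k - 1)"] by (simp add: algebra_simps)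
  qed
  from this[of j "- j"] show ?thesis by simp
qed

lemma first_diagram_direction:
  assumes m: "m \<ge> 2" and n: "n \<ge> 2" and w: "cutting_sequence m n \<psi> w" and adm: "admissible_in m n 0 w"
    and \<psi>: "pi / n - pi \<le> \<psi>" "\<psi> \<le> pi"
  shows "\<exists>\<theta>\<in>sector n 0. cutting_sequence m n \<theta> w"
proof -
  have pn: "0 < pi / n" "pi / n < pi" using n by (simp_all add: divide_less_eq)
  from w obtain \<kappa> c \<tau> f e where t: "developed m n (cis \<psi>) \<kappa> c \<tau> f e w"
    unfolding cutting_sequence_developed[OF n] by blast
  have "\<exists>r q. 1 \<le> r \<and> r < m \<and> 1 \<le> q \<and> q \<le> n \<and> w j = vertex n r q" for j
    using transition_0_grid_step[OF n] adm unfolding admissible_in_def by metis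
  then obtain r q where b: "\<And>j. 1 \<le> r j \<and> r j < m \<and> 1 \<le> q j \<and> q j \<le> n \<and> w j = vertex n (r j) (q j)"
    by metis
  have s: "grid_step (r j) (q j) (r (j + 1)) (q (j + 1))" for j
  proof -
    obtain r1 q1 r2 q2 where x: "1 \<le> r1" "1 \<le> q1" "q1 \<le> n" "1 \<le> r2" "1 \<le> q2" "q2 \<le> n"
      "w j = vertex n r1 q1" "w (j + 1) = vertex n r2 q2" "grid_step r1 q1 r2 q2"
      using transition_0_grid_step[OF n, of m "w j" "w (j + 1)"] adm unfolding admissible_in_def by blast
    have "r1 = r j \<and> q1 = q j" "r2 = r (j + 1) \<and> q2 = q (j + 1)"
      using vertex_inj[of n r1 q1 "r j" "q j"] vertex_inj[of n r2 q2 "r (j + 1)" "q (j + 1)"] x b[of j] b[of "j + 1"]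
      by simp_all
    then show ?thesis using x(9) by simp
  qed
  from n t b s show ?thesis
  proof (cases rule: grid_path_orientation)
    case 1
    have "in_cone n (cis \<psi>)" by (rule on_grid_in_cone[OF n t 1 s])
    then have sin: "0 \<le> sin (pi / n - \<psi>)" "0 \<le> sin \<psi>" by (simp_all add: in_cone_def xc_cis)
    have "0 \<le> \<psi>"
    proof (rule ccontr)
      assume "\<not> 0 \<le> \<psi>"
      then have "0 < sin (- \<psi>)" using \<psi> pn by (intro sin_gt_zero) auto
      then show False using sin by simp
    qed
    moreover have "\<psi> \<le> pi / n"
    proof (rule ccontr)
      assume "\<not> \<psi> \<le> pi / n"
      then have "0 < sin (\<psi> - pi / n)" using \<psi> pn by (intro sin_gt_zero) auto
      moreover have "sin (\<psi> - pi / n) = - sin (pi / n - \<psi>)" using sin_minus[of "pi / n - \<psi>"] by simp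
      ultimately show False using sin by simp
    qed
    ultimately have "\<psi> \<in> sector n 0" by (simp add: sector_def)
    then show ?thesis using w by blast
  next
    case 2
    note t' = developed_reverse[OF n t]
    have s': "grid_step (r (- j)) (q (- j)) (r (- (j + 1))) (q (- (j + 1)))" for j
      using 2(2)[of "- (j + 1)"] unfolding grid_step_def by auto
    have cone: "in_cone n (- cis \<psi>)" by (rule on_grid_in_cone[OF n t' 2(1) s'])
    then have sin: "sin (pi / n - \<psi>) \<le> 0" "sin \<psi> \<le> 0" by (simp_all add: in_cone_def xc_cis)
    \<comment> \<open>The range of \<psi> meets the sector opposite to the first one only at its two
      ends.\<close>
    have "\<psi> = pi \<or> \<psi> = pi / n - pi"
    proof (rule ccontr)
      assume "\<not> ?thesis"
      then have "\<psi> < pi" "pi / n - pi < \<psi>" using \<psi> by auto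
      then have "\<psi> \<le> 0" using sin(2) sin_gt_zero[of \<psi>] by force
      then have "0 < sin (pi / n - \<psi>)" using pn \<open>pi / n - pi < \<psi>\<close> by (intro sin_gt_zero) auto
      then show False using sin by simp
    qed
    then obtain \<theta> where \<theta>: "\<theta> \<in> sector n 0" "cis \<theta> = - cis \<psi>" "\<theta> = 0 \<or> \<theta> = pi / n"
    proof
      assume "\<psi> = pi"
      then show thesis using pn by (intro that[of 0]) (auto simp: sector_def complex_eq_iff)
    next
      assume "\<psi> = pi / n - pi"
      then show thesis using pn by (intro that[of "pi / n"]) (auto simp: sector_def complex_eq_iff)
    qed
    interpret rev: first_sector_trajectory m n "- cis \<psi>" "\<lambda>j. \<kappa> (1 - j)" "\<lambda>j. c (1 - j)" "\<lambda>j. - \<tau> (2 - j)"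
      "\<lambda>j. e (1 - j)" "\<lambda>j. f (1 - j)" "\<lambda>j. w (- j)" "\<lambda>j. r (- j)" "\<lambda>j. q (- j)"
      using m n t' cone 2(1) by unfold_locales
    have hor: "rev.horizontal j" for j
      unfolding rev.horizontal_iff using 2(2)[of "- (j + 1)"] by auto
    have "- cis \<psi> = 1 \<or> - cis \<psi> = cis (pi / n)" using \<theta>(2,3) by auto
    then have per: "w (- (j + 2)) = w (- j)" for j by (rule rev.horizontal_periodic[OF hor])
    \<comment> \<open>A sequence of period two is its own reversal about 0, so the reversed
      trajectory cuts out w itself.\<close>
    have "w (- j) = w j" for j
      using period_2_reflect[of "\<lambda>j. w (- j)" j] per by simp
    then have "developed m n (cis \<theta>) (\<lambda>j. \<kappa> (1 - j)) (\<lambda>j. c (1 - j)) (\<lambda>j. - \<tau> (2 - j))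
      (\<lambda>j. e (1 - j)) (\<lambda>j. f (1 - j)) w"
      using t' \<theta>(2) by simp
    then show ?thesis using \<theta>(1) unfolding cutting_sequence_developed[OF n] by blast
  qed
qed

section \<open>Rounds of renormalization\<close>

lemma normalized_derived_cutting_sequence:
  assumes m: "m \<ge> 2" and n: "n \<ge> 2" and \<theta>: "0 \<le> \<theta>" "\<theta> \<le> pi" and w: "cutting_sequence m n \<theta> w"
    and i: "i < n" and adm: "admissible_in m n i w"
  shows "\<exists>\<theta>'. 0 \<le> \<theta>' \<and> \<theta>' \<le> pi \<and> cutting_sequence n m \<theta>' (derived_seq m n (label_perm m n i \<circ> w))"
proof -
  let ?\<sigma> = "label_perm m n i"
  obtain \<phi> :: "real \<Rightarrow> real" where \<phi>:
    "\<And>\<theta> w. cutting_sequence m n \<theta> w \<Longrightarrow> cutting_sequence m n (\<phi> \<theta>) (?\<sigma> \<circ> w)"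
    "\<And>\<theta>. \<theta> \<in> sector n i \<Longrightarrow> \<phi> \<theta> \<in> sector n 0"
    "\<And>\<theta>. 0 \<le> \<theta> \<Longrightarrow> \<theta> \<le> pi \<Longrightarrow> pi / n - pi \<le> \<phi> \<theta> \<and> \<phi> \<theta> \<le> pi"
    by (rule label_perm_normalizes[OF m n i]) (rule that)
  \<comment> \<open>The permutation acts on all trajectories of sector i at once, so it maps every
    arrow of diagram i to an arrow of the first diagram, whatever the direction of w.\<close>
  have "transition m n 0 (?\<sigma> (w j)) (?\<sigma> (w (j + 1)))" for j
  proof -
    from adm obtain \<theta>' w' l where "\<theta>' \<in> sector n i" "cutting_sequence m n \<theta>' w'" "w' l = w j" "w' (l + 1) = w (j + 1)"
      unfolding admissible_in_def transition_def by blast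
    then show ?thesis
      unfolding transition_def using \<phi>(1)[of \<theta>' w'] \<phi>(2)[of \<theta>']
      by (intro bexI[of _ "\<phi> \<theta>'"] exI[of _ "?\<sigma> \<circ> w'"] exI[of _ l]) auto
  qed
  then have "admissible_in m n 0 (?\<sigma> \<circ> w)" by (simp add: admissible_in_def)
  from first_diagram_direction[OF m n \<phi>(1)[OF w] this] \<phi>(3)[OF \<theta>]
  show ?thesis using derived_cutting_sequence[OF m n] by blast
qed

lemma cutting_sequence_admissible:
  assumes "n > 0" "0 \<le> \<theta>" "\<theta> \<le> pi" "cutting_sequence m n \<theta> w"
  shows "admissible m n w"
proof -
  have "\<exists>i<n. \<theta> \<in> sector n i"
  \<comment> \<open>For \<theta> = pi the floor below would give n, outside the range of
    sectors.\<close>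
  proof (cases "\<theta> = pi")
    case True
    have "\<theta> \<in> sector n (n - 1)"
      using assms(1) True by (simp add: sector_def divide_le_eq)
    then show ?thesis using assms(1) by (intro exI[of _ "n - 1"]) simp
  next
    case False
    define i where "i = nat \<lfloor>\<theta> * n / pi\<rfloor>"
    have x: "0 \<le> \<theta> * n / pi" "\<theta> * n / pi < n" using assms False by (simp_all add: divide_less_eq mult.commute)
    then have i: "real i \<le> \<theta> * n / pi" "\<theta> * n / pi \<le> real (Suc i)" unfolding i_def by linarith+
    then have "\<theta> \<in> sector n i" using assms(1) by (simp add: sector_def field_simps)
    moreover have "i < n" using i(1) x(2) by linarith
    ultimately show ?thesis by blast
  qed
  then show ?thesis
    using assms(4) unfolding admissible_def admissible_in_def transition_def by blast
qed

theorem proposition1p5: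
  fixes m n :: nat and \<theta> :: real and w :: "int \<Rightarrow> nat"
  assumes "m \<ge> 2" and "n \<ge> 2" and "m * n \<ge> 6"
    and "0 \<le> \<theta>" and "\<theta> \<le> pi"
    and "cutting_sequence m n \<theta> w"
  shows "infinitely_derivable m n w"
proof -
  have "2 \<le> p \<and> 2 \<le> q \<and> (\<exists>\<theta>. 0 \<le> \<theta> \<and> \<theta> \<le> pi \<and> cutting_sequence p q \<theta> v)" if "renormalized m n w p q v" for p q v
    using that
  proof induction
    case start
    then show ?case using assms by blast
  next
    case (step p q v i)
    then show ?case using normalized_derived_cutting_sequence by blast
  qed
  then show ?thesis
    unfolding infinitely_derivable_def using cutting_sequence_admissible
    by (metis less_le_trans zero_less_numeral)
qed

end
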